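(* The manifold $N$ of probability measures is dually ($\alpha=\pm1$) flat: it is both $\nabla^{1}$-flat and $\nabla^{-1}$-flat, with $\phi_e$ a (global) affine chart for $\nabla^1$ and $\phi_m$ a (global) affine chart for $\nabla^{-1}$; that is, for all smooth vector fields $\mathbf{U},\mathbf{V}\in\Gamma TN$, $$\nabla_{\mathbf{U}}^{1}\mathbf{V}\phi_e=\mathbf{U}\mathbf{V}\phi_e\qquad\text{and}\qquad\nabla_{\mathbf{U}}^{-1}\mathbf{V}\phi_m=\mathbf{U}\mathbf{V}\phi_m .$$
   Context: Let $B$ be an open subset of a (real) Banach space $\mathbb{X}$, let $\mathcal{X}_B$ be the Borel $\sigma$-algebra of $B$, and let $\mu$ be a probability measure on $(B,\mathcal{X}_B)$ such that $\mu(A)>0$ for every non-empty open $A\in\mathcal{X}_B$. Fix $k\in\mathbb{N}_0$. $\mathbb{G}:=C_b^k(B;\mathbb{R})$ is the Banach space of bounded continuous functions $a:B\to\mathbb{R}$ with bounded continuous Fréchet derivatives $a^{(i)}$ of all orders $1\le i\le k$, with norm $\|a\|_{\mathbb{G}}=\sup_{x\in B}|a(x)|+\sum_{i=1}^k\sup_{x\in B}\|a_x^{(i)}\|_{L(\mathbb{X}^i;\mathbb{R})}$. Products in $\mathbb{G}$ are pointwise, $\exp_{\mathbb{G}}(a)(x)=\exp(a(x))$; $\mathbf{E}_\mu a=\int_B a\,d\mu$. $\mathbb{G}_0:=\{a\in\mathbb{G}:\mathbf{E}_\mu a=0\}$. The manifold $M$: the set of finite measures $P$ on $(B,\mathcal{X}_B)$,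 mutually absolutely continuous with respect to $\mu$, with density $dP/d\mu=\exp_{\mathbb{G}}(a)$ for some $a\in\mathbb{G}$. Its charts (each global, with smooth transition maps) are $\phi_1(P)=\log(dP/d\mu)$ and, for $\alpha\ne1$, $\phi_\alpha(P)=\frac{2}{1-\alpha}\left(\exp_{\mathbb{G}}\left(\frac{1-\alpha}{2}\phi_1(P)\right)-1\right)$. The tangent space $T_PM$ consists of the signed measures $U$ with density $dU/dP=u\in\mathbb{G}$; for a differentiable Banach-space-valued map $f$ on $M$, $Uf:=(f\circ\phi_1^{-1})^{(1)}_{\phi_1(P)}u$ is the derivative of $f$ at $P$ in direction $U$ (so $U\phi_1=dU/dP$ and $U\phi_{-1}=dU/d\mu$). For each $\alpha$, $U\mapsto U\phi_\alpha$ is a linear bijection $T_PM\to\mathbb{G}$. The manifold $N:=\{P\in M:P(B)=1\}$ is a $C^\infty$-embedded submanifold of $M$, modelled on $\mathbb{G}_0$, with global charts $\phi_m,\phi_e:N\to\mathbb{G}_0$, $\phi_m(P)=dP/d\mu-1$ and $\phi_e(P)=\phi_1(P)-\mathbf{E}_\mu\phi_1(P)$. $T_PN$ is the set of $U\in T_PM$ with total mass zero. $\imath:N\to M$ is inclusion; $\nu:M\to N$, $\nu(P)=P/P(B)$, is normalisation, whose tangent map $T\nu:T_PM\to T_{\nu(P)}N$ satisfies $(T\nu X)\phi_e=X\phi_1-\mathbf{E}_\mu X\phi_1$. $\Gamma TN$ is the space of smooth vector fields on $N$, $\mathbf{V}f$ is the map $P\mapsto\mathbf{V}_Pf$, and $\mathbf{U}\mathbf{V}f:=\mathbf{U}(\mathbf{V}f)$.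 The $\alpha$-covariant derivative $\nabla^\alpha$ on $N$ is defined, for $\mathbf{U},\mathbf{V}\in\Gamma TN$ and $P\in N$, by $(\nabla_{\mathbf{U}}^\alpha\mathbf{V})_P:=T\nu\,\mathbf{W}_P$, where $\mathbf{W}_P\in T_PM$ is the unique tangent vector with $\mathbf{W}_P\phi_\alpha=\mathbf{U}_P\mathbf{V}(\phi_\alpha\circ\imath)$. $N$ is $\nabla^\alpha$-flat if the curvature $\nabla_{\mathbf{U}}^\alpha\nabla_{\mathbf{V}}^\alpha\mathbf{W}-\nabla_{\mathbf{V}}^\alpha\nabla_{\mathbf{U}}^\alpha\mathbf{W}-\nabla_{[\mathbf{U},\mathbf{V}]}^\alpha\mathbf{W}$ vanishes for all $\mathbf{U},\mathbf{V},\mathbf{W}\in\Gamma TN$, where $[\cdot,\cdot]$ is the Lie bracket. *)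

theory Defs
  imports
    "HOL-Probability.Probability_Measure"
    "HOL-Library.Function_Algebras"
begin

instantiation "fun" :: (type, real_vector) real_vector
begin

definition scaleR_fun :: "real \<Rightarrow> ('a \<Rightarrow> 'b) \<Rightarrow> 'a \<Rightarrow> 'b" where
  "scaleR_fun c f = (\<lambda>x. c *\<^sub>R f x)"

instance
  by standard (simp_all add: scaleR_fun_def fun_eq_iff algebra_simps)

end

section \<open>Calculus in normed spaces given by a carrier and a norm\<close>

text \<open>The space of functions of class \<open>C\<^sup>k\<close> on \<open>B\<close> depends on the terms \<open>B\<close> and \<open>k\<close>, so it cannot
  be a type. A normed space is therefore a pair of a linear subspace of an ambient real vector
  space and a norm, which only matters on that subspace.\<close>

type_synonym 'v nspace = "'v set \<times> ('v \<Rightarrow> real)"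

definition bdd_lin :: "'v::real_vector nspace \<Rightarrow> 'w::real_vector nspace \<Rightarrow> ('v \<Rightarrow> 'w) \<Rightarrow> bool" where
  "bdd_lin E F L \<longleftrightarrow>
     (\<forall>h\<in>fst E. L h \<in> fst F) \<and>
     (\<forall>g\<in>fst E. \<forall>h\<in>fst E. L (g + h) = L g + L h) \<and>
     (\<forall>c. \<forall>h\<in>fst E. L (c *\<^sub>R h) = c *\<^sub>R L h) \<and>
     (\<exists>C. \<forall>h\<in>fst E. snd F (L h) \<le> C * snd E h)"

text \<open>\<open>L\<close> is the Frechet derivative at \<open>x\<close> of the \<open>F\<close>-valued map \<open>f\<close> on the open set \<open>U\<close>
  of \<open>E\<close>. Values of \<open>L\<close> outside the carrier of \<open>E\<close> are irrelevant.\<close>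

definition has_fderiv ::
  "'v::real_vector nspace \<Rightarrow> 'w::real_vector nspace \<Rightarrow> 'v set \<Rightarrow> ('v \<Rightarrow> 'w) \<Rightarrow> 'v \<Rightarrow> ('v \<Rightarrow> 'w) \<Rightarrow> bool"
where
  "has_fderiv E F U f x L \<longleftrightarrow>
     x \<in> U \<and> (\<forall>y\<in>U. f y \<in> fst F) \<and> bdd_lin E F L \<and>
     (\<forall>\<epsilon>>0. \<exists>\<delta>>0. \<forall>y\<in>U. snd E (y - x) < \<delta> \<longrightarrow>
        snd F (f y - f x - L (y - x)) \<le> \<epsilon> * snd E (y - x))"

definition fderiv ::
  "'v::real_vector nspace \<Rightarrow> 'w::real_vector nspace \<Rightarrow> 'v set \<Rightarrow> ('v \<Rightarrow> 'w) \<Rightarrow> 'v \<Rightarrow> 'v \<Rightarrow> 'w" where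
  "fderiv E F U f x = (SOME L. has_fderiv E F U f x L)"

definition cont_on_nspace ::
  "'v::real_vector nspace \<Rightarrow> 'w::real_vector nspace \<Rightarrow> 'v set \<Rightarrow> ('v \<Rightarrow> 'w) \<Rightarrow> bool" where
  "cont_on_nspace E F U f \<longleftrightarrow>
     (\<forall>x\<in>U. \<forall>\<epsilon>>0. \<exists>\<delta>>0. \<forall>y\<in>U. snd E (y - x) < \<delta> \<longrightarrow> snd F (f y - f x) < \<epsilon>)"

text \<open>The space \<open>L(E\<^sup>i; F)\<close> of bounded \<open>i\<close>-linear maps with the operator norm. An \<open>i\<close>-linear map
  is a function on lists of length \<open>i\<close> over the carrier of \<open>E\<close>, and is 0 on all other lists.\<close>

definition args :: "'v nspace \<Rightarrow> nat \<Rightarrow> 'v list set" where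
  "args E i = {hs. length hs = i \<and> set hs \<subseteq> fst E}"

definition mlin_set ::
  "nat \<Rightarrow> 'v::real_vector nspace \<Rightarrow> 'w::real_vector nspace \<Rightarrow> ('v list \<Rightarrow> 'w) set" where
  "mlin_set i E F = {m.
     (\<forall>hs. hs \<notin> args E i \<longrightarrow> m hs = 0) \<and>
     (\<forall>hs\<in>args E i. m hs \<in> fst F) \<and>
     (\<forall>hs\<in>args E i. \<forall>j<i. \<forall>g\<in>fst E. \<forall>h\<in>fst E. m (hs[j := g + h]) = m (hs[j := g]) + m (hs[j := h])) \<and>
     (\<forall>hs\<in>args E i. \<forall>j<i. \<forall>c. \<forall>h\<in>fst E. m (hs[j := c *\<^sub>R h]) = c *\<^sub>R m (hs[j := h])) \<and>
     (\<exists>C. \<forall>hs\<in>args E i. snd F (m hs) \<le> C * prod_list (map (snd E) hs))}"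

definition mlin_norm ::
  "nat \<Rightarrow> 'v::real_vector nspace \<Rightarrow> 'w::real_vector nspace \<Rightarrow> ('v list \<Rightarrow> 'w) \<Rightarrow> real" where
  "mlin_norm i E F m = Sup {snd F (m hs) | hs. hs \<in> args E i \<and> (\<forall>h\<in>set hs. snd E h \<le> 1)}"

definition mlin ::
  "nat \<Rightarrow> 'v::real_vector nspace \<Rightarrow> 'w::real_vector nspace \<Rightarrow> ('v list \<Rightarrow> 'w) nspace" where
  "mlin i E F = (mlin_set i E F, mlin_norm i E F)"

text \<open>The \<open>i\<close>-th derivative of \<open>f\<close>, as a map into \<open>L(E\<^sup>i; F)\<close>, using the identification
  \<open>L(E; L(E\<^sup>i; F)) = L(E\<^sup>(\<^sup>i\<^sup>+\<^sup>1\<^sup>); F)\<close>.\<close>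

primrec nth_fderiv ::
  "'v::real_vector nspace \<Rightarrow> 'w::real_vector nspace \<Rightarrow> 'v set \<Rightarrow> ('v \<Rightarrow> 'w) \<Rightarrow> nat \<Rightarrow> 'v \<Rightarrow> 'v list \<Rightarrow> 'w"
where
  "nth_fderiv E F U f 0 = (\<lambda>x hs. if hs = [] then f x else 0)"
| "nth_fderiv E F U f (Suc i) = (\<lambda>x hs. case hs of [] \<Rightarrow> 0 | h # hs' \<Rightarrow>
     if h \<in> fst E then fderiv E (mlin i E F) U (nth_fderiv E F U f i) x h hs' else 0)"

definition Ck_on ::
  "nat \<Rightarrow> 'v::real_vector nspace \<Rightarrow> 'w::real_vector nspace \<Rightarrow> 'v set \<Rightarrow> ('v \<Rightarrow> 'w) \<Rightarrow> bool" where
  "Ck_on k E F U f \<longleftrightarrow>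
     (\<forall>x\<in>U. f x \<in> fst F) \<and>
     (\<forall>i<k. \<forall>x\<in>U. \<exists>L. has_fderiv E (mlin i E F) U (nth_fderiv E F U f i) x L) \<and>
     (\<forall>i\<le>k. cont_on_nspace E (mlin i E F) U (nth_fderiv E F U f i))"

definition smooth_on_nspace ::
  "'v::real_vector nspace \<Rightarrow> 'w::real_vector nspace \<Rightarrow> 'v set \<Rightarrow> ('v \<Rightarrow> 'w) \<Rightarrow> bool" where
  "smooth_on_nspace E F U f \<longleftrightarrow> (\<forall>k. Ck_on k E F U f)"

abbreviation type_nspace :: "'v::real_normed_vector nspace" where
  "type_nspace \<equiv> (UNIV, norm)"


section \<open>The manifolds of finite measures and of probability measures\<close>

context
  fixes B :: "'a::banach set" and \<mu> :: "'a measure" and k :: nat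
begin

text \<open>A function on \<open>B\<close> is represented by its extension by 0, so that equality of functions is
  equality on \<open>B\<close>; \<open>one_B\<close> and \<open>exp_B\<close> are the unit and the exponential of the algebra of
  functions on \<open>B\<close>.\<close>

definition one_B :: "'a \<Rightarrow> real" where
  "one_B = (\<lambda>x. if x \<in> B then 1 else 0)"

definition exp_B :: "('a \<Rightarrow> real) \<Rightarrow> 'a \<Rightarrow> real" where
  "exp_B a = (\<lambda>x. if x \<in> B then exp (a x) else 0)"

abbreviation deriv_B :: "('a \<Rightarrow> real) \<Rightarrow> nat \<Rightarrow> 'a \<Rightarrow> 'a list \<Rightarrow> real" where
  "deriv_B a i \<equiv> nth_fderiv type_nspace type_nspace B a i"

abbreviation deriv_B_norm :: "('a \<Rightarrow> real) \<Rightarrow> nat \<Rightarrow> 'a \<Rightarrow> real" where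
  "deriv_B_norm a i x \<equiv> snd (mlin i (type_nspace :: 'a nspace) (type_nspace :: real nspace)) (deriv_B a i x)"

definition G_norm :: "('a \<Rightarrow> real) \<Rightarrow> real" where
  "G_norm a = (SUP x\<in>B. \<bar>a x\<bar>) + (\<Sum>i=1..k. SUP x\<in>B. deriv_B_norm a i x)"

definition G_set :: "('a \<Rightarrow> real) set" where
  "G_set = {a. (\<forall>x. x \<notin> B \<longrightarrow> a x = 0) \<and>
     Ck_on k type_nspace type_nspace B a \<and>
     bdd_above ((\<lambda>x. \<bar>a x\<bar>) ` B) \<and>
     (\<forall>i\<in>{1..k}. bdd_above ((\<lambda>x. deriv_B_norm a i x) ` B))}"

definition G :: "('a \<Rightarrow> real) nspace" where
  "G = (G_set, G_norm)"

definition E\<^sub>\<mu> :: "('a \<Rightarrow> real) \<Rightarrow> real" where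
  "E\<^sub>\<mu> a = (\<integral>x. a x \<partial>\<mu>)"

definition G0 :: "('a \<Rightarrow> real) nspace" where
  "G0 = ({a \<in> G_set. E\<^sub>\<mu> a = 0}, G_norm)"

definition meas_of :: "('a \<Rightarrow> real) \<Rightarrow> 'a measure" where
  "meas_of a = density \<mu> (\<lambda>x. ennreal (exp_B a x))"

definition M :: "'a measure set" where
  "M = {P. finite_measure P \<and> sets P = sets \<mu> \<and>
     absolutely_continuous \<mu> P \<and> absolutely_continuous P \<mu> \<and>
     (\<exists>a\<in>fst G. P = meas_of a)}"

definition phi1 :: "'a measure \<Rightarrow> 'a \<Rightarrow> real" where
  "phi1 P = (THE a. a \<in> fst G \<and> P = meas_of a)"

definition phi :: "real \<Rightarrow> 'a measure \<Rightarrow> 'a \<Rightarrow> real" where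
  "phi \<alpha> P = (if \<alpha> = 1 then phi1 P
     else (2 / (1 - \<alpha>)) *\<^sub>R (exp_B (((1 - \<alpha>) / 2) *\<^sub>R phi1 P) - one_B))"

text \<open>Tangent vectors of \<open>M\<close> at \<open>P\<close> are finite signed measures, as set functions with value 0
  outside the \<open>\<sigma>\<close>-algebra.\<close>

definition signed_meas :: "'a measure \<Rightarrow> ('a \<Rightarrow> real) \<Rightarrow> 'a set \<Rightarrow> real" where
  "signed_meas P u = (\<lambda>A. if A \<in> sets P then set_lebesgue_integral P A u else 0)"

definition TM :: "'a measure \<Rightarrow> ('a set \<Rightarrow> real) set" where
  "TM P = signed_meas P ` fst G"

definition tdens :: "'a measure \<Rightarrow> ('a set \<Rightarrow> real) \<Rightarrow> 'a \<Rightarrow> real" where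
  "tdens P X = (THE u. u \<in> fst G \<and> X = signed_meas P u)"

text \<open>Derivative \<open>X f\<close> of an \<open>F\<close>-valued map \<open>f\<close> on \<open>M\<close> in the direction \<open>X \<in> TM P\<close>.\<close>

definition dM :: "'w::real_vector nspace \<Rightarrow> ('a measure \<Rightarrow> 'w) \<Rightarrow> 'a measure \<Rightarrow> ('a set \<Rightarrow> real) \<Rightarrow> 'w" where
  "dM F f P X = fderiv G F (fst G) (f \<circ> inv_into M phi1) (phi1 P) (tdens P X)"

definition N :: "'a measure set" where
  "N = {P \<in> M. measure P B = 1}"

definition TN :: "'a measure \<Rightarrow> ('a set \<Rightarrow> real) set" where
  "TN P = {X \<in> TM P. X B = 0}"

definition phi_m :: "'a measure \<Rightarrow> 'a \<Rightarrow> real" where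
  "phi_m P = exp_B (phi1 P) - one_B"

definition phi_e :: "'a measure \<Rightarrow> 'a \<Rightarrow> real" where
  "phi_e P = phi1 P - E\<^sub>\<mu> (phi1 P) *\<^sub>R one_B"

definition normalise :: "'a measure \<Rightarrow> 'a measure" where
  "normalise P = scale_measure (ennreal (1 / measure P B)) P"

text \<open>Derivative \<open>X f\<close> of an \<open>F\<close>-valued map \<open>f\<close> on \<open>N\<close> in the direction \<open>X \<in> TN P\<close>, computed in
  the chart \<open>phi_e\<close>. In that chart the coordinate of \<open>X \<in> TN P \<subseteq> TM P\<close> is the derivative
  \<open>X phi_e\<close> of the map \<open>phi_e\<close>, which its defining formula extends to all of \<open>M\<close>.\<close>

definition dN :: "'w::real_vector nspace \<Rightarrow> ('a measure \<Rightarrow> 'w) \<Rightarrow> 'a measure \<Rightarrow> ('a set \<Rightarrow> real) \<Rightarrow> 'w" where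
  "dN F f P X = fderiv G0 F (fst G0) (f \<circ> inv_into N phi_e) (phi_e P) (dM G0 phi_e P X)"

text \<open>The tangent vector of \<open>N\<close> whose \<open>phi_e\<close>-coordinate is \<open>X (phi_e \<circ> normalise)\<close>.\<close>

definition T_normalise :: "'a measure \<Rightarrow> ('a set \<Rightarrow> real) \<Rightarrow> 'a set \<Rightarrow> real" where
  "T_normalise P X = (THE Y. Y \<in> TN (normalise P) \<and>
     dN G0 phi_e (normalise P) Y = dM G0 (phi_e \<circ> normalise) P X)"

type_synonym 'b vfield = "'b measure \<Rightarrow> 'b set \<Rightarrow> real"

text \<open>Smoothness refers to the chart of the tangent bundle induced by \<open>phi_e\<close>,
  \<open>(P, X) \<mapsto> (phi_e P, X phi_e)\<close>.\<close>

definition vfields :: "'a vfield set" where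
  "vfields = {V. (\<forall>P\<in>N. V P \<in> TN P) \<and>
     smooth_on_nspace G0 G0 (fst G0)
       (\<lambda>a. dN G0 phi_e (inv_into N phi_e a) (V (inv_into N phi_e a)))}"

text \<open>The maps \<open>V f : P \<mapsto> V\<^sub>P f\<close> and \<open>U V f = U (V f)\<close> on \<open>N\<close>.\<close>

definition vf :: "'w::real_vector nspace \<Rightarrow> 'a vfield \<Rightarrow> ('a measure \<Rightarrow> 'w) \<Rightarrow> 'a measure \<Rightarrow> 'w" where
  "vf F V f = (\<lambda>P. dN F f P (V P))"

definition lie_bracket :: "'a vfield \<Rightarrow> 'a vfield \<Rightarrow> 'a vfield" where
  "lie_bracket U V P = (THE Z. Z \<in> TN P \<and>
     dN G0 phi_e P Z = vf G0 U (vf G0 V phi_e) P - vf G0 V (vf G0 U phi_e) P)"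

definition nabla :: "real \<Rightarrow> 'a vfield \<Rightarrow> 'a vfield \<Rightarrow> 'a vfield" where
  "nabla \<alpha> U V P = T_normalise P (THE W. W \<in> TM P \<and>
     dM G (phi \<alpha>) P W = vf G U (vf G V (phi \<alpha>)) P)"

definition nabla_flat :: "real \<Rightarrow> bool" where
  "nabla_flat \<alpha> \<longleftrightarrow> (\<forall>U\<in>vfields. \<forall>V\<in>vfields. \<forall>W\<in>vfields. \<forall>P\<in>N.
     nabla \<alpha> U (nabla \<alpha> V W) P - nabla \<alpha> V (nabla \<alpha> U W) P - nabla \<alpha> (lie_bracket U V) W P = 0)"

end

end

theory Submission
  imports Defs
begin

text \<open>The chart \<open>phi_e\<close> turns the theorem into calculus on the linear space \<open>G0\<close>. A point \<open>a\<close> of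
  \<open>G0\<close> is the coordinate of the probability measure with log-density
  \<open>log_dens a = a - ln (E (exp a))\<close>; the derivative of \<open>log_dens\<close> at \<open>a\<close> in the direction \<open>h\<close> is
  \<open>dlog a h = h - E (dens a * h)\<close>, and this function is the density, with respect to that measure, of
  the tangent vector with coordinate \<open>h\<close>.

  For \<open>\<alpha> = 1\<close> the map \<open>phi 1\<close> becomes \<open>log_dens\<close>, so a vector field with coordinates \<open>v\<close> sends it to
  \<open>v\<close> minus a scalar function. Differentiating along \<open>u\<close> gives \<open>Dv u\<close> minus a constant, and the
  tangent map of the normalisation removes exactly the constants. Hence the coordinate of the
  covariant derivative is \<open>Dv u\<close> (lemma \<open>nabla_one\<close>). For \<open>\<alpha> = -1\<close> the map \<open>phi (-1)\<close> is \<open>phi_m\<close> on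
  \<open>N\<close> and takes values of mean zero; derivatives of such maps have mean zero, so the vector \<open>W\<close> of
  the definition is already tangent to \<open>N\<close>, and its \<open>phi_m\<close>-component is the second derivative
  \<open>U V phi_m\<close> (lemma \<open>nabla_minus_one\<close>). These are the two statements about affine charts. In an
  affine chart the curvature applied to \<open>W\<close> has the component
  \<open>U V f - V U f - [U, V] f\<close>, where \<open>f\<close> is the function \<open>W phi\<close>; it vanishes by the symmetry of the
  second derivative of \<open>f\<close> (lemma \<open>commutator\<close>).

  Two things need work because \<open>G\<close> is a carrier set with a norm and not a type. First, second
  derivatives: \<open>twice_fdiff\<close> asks that \<open>(a, h) \<mapsto> Df(a) h\<close> is differentiable as a map of two
  variables. The tangent map of a composition is the composition of the tangent maps, which yields
  closure under composition, products, \<open>exp\<close> and \<open>ln\<close>. Symmetry may be checked after evaluation at a point of \<open>B\<close>,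
  where it is Young's theorem for real functions. Second, \<open>G\<close> has to be a normed algebra on which
  \<open>exp\<close> is differentiable. The higher derivatives of functions on \<open>B\<close> are treated as tensor fields;
  the derivative of a tensor product is a sum of two tensor products (\<open>Cb_field_otimes\<close>), and the
  derivative of \<open>exp h - 1 - h\<close> is the product of \<open>exp h - 1\<close> and \<open>Dh\<close>. An induction over the order
  of differentiability thus shows that the norm of \<open>exp h - 1 - h\<close> is \<open>O(\<parallel>h\<parallel>\<^sup>2)\<close>.

  Besides the mean, the measure theory enters through the fact that \<open>\<mu>\<close> charges every nonempty open set: a
  continuous density is determined by its measure, so that the charts and the densities of tangent
  vectors are well defined.\<close>

section \<open>Calculus in normed spaces given by a carrier\<close>

definition normed_nspace :: "'v::real_vector nspace \<Rightarrow> bool" where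
  "normed_nspace E \<longleftrightarrow> subspace (fst E) \<and>
     (\<forall>x\<in>fst E. snd E x = 0 \<longrightarrow> x = 0) \<and>
     (\<forall>x\<in>fst E. \<forall>y\<in>fst E. snd E (x + y) \<le> snd E x + snd E y) \<and>
     (\<forall>c. \<forall>x\<in>fst E. snd E (c *\<^sub>R x) = \<bar>c\<bar> * snd E x)"

text \<open>One inequality suffices for homogeneity: applied to the scalar \<open>1 / c\<close> it gives the other one.\<close>

lemma normed_nspaceI:
  assumes "subspace (fst E)" "\<And>x. x \<in> fst E \<Longrightarrow> snd E x = 0 \<Longrightarrow> x = 0"
    and tri: "\<And>x y. x \<in> fst E \<Longrightarrow> y \<in> fst E \<Longrightarrow> snd E (x + y) \<le> snd E x + snd E y"
    and hom: "\<And>c x. x \<in> fst E \<Longrightarrow> snd E (c *\<^sub>R x) \<le> \<bar>c\<bar> * snd E x"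
  shows "normed_nspace E"
proof -
  have "snd E (c *\<^sub>R x) = \<bar>c\<bar> * snd E x" if x: "x \<in> fst E" for c x
  proof (cases "c = 0")
    case True
    have "0 \<le> snd E 0" using tri[OF x subspace_0[OF assms(1)]] by simp
    then show ?thesis using hom[OF x, of 0] True by simp
  next
    case False
    have "snd E x \<le> \<bar>1 / c\<bar> * snd E (c *\<^sub>R x)"
      using hom[OF subspace_scale[OF assms(1) x, of c], of "1 / c"] False by simp
    then have "\<bar>c\<bar> * snd E x \<le> snd E (c *\<^sub>R x)"
      using False by (simp add: field_simps)
    then show ?thesis using hom[OF x, of c] by simp
  qed
  then show ?thesis using assms by (auto simp: normed_nspace_def)
qed

lemma nspace_closed:
  assumes "normed_nspace E"
  shows "0 \<in> fst E" "\<And>x y. x \<in> fst E \<Longrightarrow> y \<in> fst E \<Longrightarrow> x + y \<in> fst E"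
    "\<And>x y. x \<in> fst E \<Longrightarrow> y \<in> fst E \<Longrightarrow> x - y \<in> fst E"
    "\<And>c x. x \<in> fst E \<Longrightarrow> c *\<^sub>R x \<in> fst E" "\<And>x. x \<in> fst E \<Longrightarrow> - x \<in> fst E"
  using assms
  by (auto simp: normed_nspace_def subspace_0 subspace_add subspace_diff subspace_scale subspace_neg)

lemma nspace_norm:
  assumes "normed_nspace E"
  shows "\<And>x y. x \<in> fst E \<Longrightarrow> y \<in> fst E \<Longrightarrow> snd E (x + y) \<le> snd E x + snd E y"
    "\<And>c x. x \<in> fst E \<Longrightarrow> snd E (c *\<^sub>R x) = \<bar>c\<bar> * snd E x"
    "\<And>x. x \<in> fst E \<Longrightarrow> snd E x = 0 \<Longrightarrow> x = 0"
  using assms by (auto simp: normed_nspace_def)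

lemma nspace_norm_zero [simp]:
  assumes "normed_nspace E"
  shows "snd E 0 = 0"
  using nspace_norm(2)[OF assms nspace_closed(1)[OF assms], of 0] by simp

lemma nspace_norm_minus:
  assumes "normed_nspace E" "x \<in> fst E"
  shows "snd E (- x) = snd E x"
  using nspace_norm(2)[OF assms, of "-1"] by simp

lemma nspace_norm_nonneg:
  assumes "normed_nspace E" "x \<in> fst E"
  shows "0 \<le> snd E x"
  using nspace_norm(1)[OF assms(1) assms(2) nspace_closed(5)[OF assms]]
    nspace_norm_minus[OF assms] nspace_norm_zero[OF assms(1)] by simp

lemma nspace_norm_diff:
  assumes "normed_nspace E" "x \<in> fst E" "y \<in> fst E"
  shows "snd E (x - y) \<le> snd E x + snd E y"
  using nspace_norm(1)[OF assms(1,2) nspace_closed(5)[OF assms(1,3)]]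
    nspace_norm_minus[OF assms(1,3)] by simp

lemma nspace_type: "normed_nspace (type_nspace :: 'v::real_normed_vector nspace)"
  by (simp add: normed_nspace_def norm_triangle_ineq)

lemma bdd_lin_bound:
  assumes "bdd_lin E F L" "normed_nspace E"
  obtains C where "C > 0" "\<And>h. h \<in> fst E \<Longrightarrow> snd F (L h) \<le> C * snd E h"
proof -
  obtain C where C: "\<forall>h\<in>fst E. snd F (L h) \<le> C * snd E h"
    using assms(1) by (auto simp: bdd_lin_def)
  have "snd F (L h) \<le> (\<bar>C\<bar> + 1) * snd E h" if "h \<in> fst E" for h
  proof -
    have "C * snd E h \<le> (\<bar>C\<bar> + 1) * snd E h"
      by (rule mult_right_mono) (use nspace_norm_nonneg[OF assms(2) that] in auto)
    then show ?thesis using C that by force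
  qed
  then show ?thesis using that[of "\<bar>C\<bar> + 1"] by auto
qed

lemma bdd_lin_simps:
  assumes "bdd_lin E F L" "normed_nspace E"
  shows "\<And>h. h \<in> fst E \<Longrightarrow> L h \<in> fst F"
    "\<And>g h. g \<in> fst E \<Longrightarrow> h \<in> fst E \<Longrightarrow> L (g + h) = L g + L h"
    "\<And>c h. h \<in> fst E \<Longrightarrow> L (c *\<^sub>R h) = c *\<^sub>R L h"
    "\<And>h. h \<in> fst E \<Longrightarrow> L (- h) = - L h"
    "\<And>g h. g \<in> fst E \<Longrightarrow> h \<in> fst E \<Longrightarrow> L (g - h) = L g - L h"
    "L 0 = 0"
proof -
  show 1: "\<And>h. h \<in> fst E \<Longrightarrow> L h \<in> fst F"
    and 2: "\<And>g h. g \<in> fst E \<Longrightarrow> h \<in> fst E \<Longrightarrow> L (g + h) = L g + L h"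
    and 3: "\<And>c h. h \<in> fst E \<Longrightarrow> L (c *\<^sub>R h) = c *\<^sub>R L h"
    using assms(1) by (auto simp: bdd_lin_def)
  show 4: "L (- h) = - L h" if "h \<in> fst E" for h
    using 3[OF that, of "-1"] by simp
  show "L (g - h) = L g - L h" if "g \<in> fst E" "h \<in> fst E" for g h
    using 2[OF that(1) nspace_closed(5)[OF assms(2) that(2)]] 4[OF that(2)] by simp
  show "L 0 = 0" using 3[OF nspace_closed(1)[OF assms(2)], of 0] by simp
qed

lemma bdd_linI:
  assumes "\<And>h. h \<in> fst E \<Longrightarrow> L h \<in> fst F"
    "\<And>g h. g \<in> fst E \<Longrightarrow> h \<in> fst E \<Longrightarrow> L (g + h) = L g + L h"
    "\<And>c h. h \<in> fst E \<Longrightarrow> L (c *\<^sub>R h) = c *\<^sub>R L h"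
    "\<And>h. h \<in> fst E \<Longrightarrow> snd F (L h) \<le> C * snd E h"
  shows "bdd_lin E F L"
  using assms unfolding bdd_lin_def by blast

lemma bdd_lin_comp:
  assumes "bdd_lin E F L" "bdd_lin F H K" "normed_nspace E" "normed_nspace F"
  shows "bdd_lin E H (\<lambda>h. K (L h))"
proof -
  obtain C where C: "C > 0" "\<And>h. h \<in> fst E \<Longrightarrow> snd F (L h) \<le> C * snd E h"
    using bdd_lin_bound[OF assms(1,3)] by blast
  obtain D where D: "D > 0" "\<And>h. h \<in> fst F \<Longrightarrow> snd H (K h) \<le> D * snd F h"
    using bdd_lin_bound[OF assms(2,4)] by blast
  note L = bdd_lin_simps[OF assms(1,3)] and K = bdd_lin_simps[OF assms(2,4)]
  show ?thesis
  proof (rule bdd_linI)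
    show "snd H (K (L h)) \<le> (D * C) * snd E h" if "h \<in> fst E" for h
      using order_trans[OF D(2)[OF L(1)[OF that]] mult_left_mono[OF C(2)[OF that], of D]] D(1)
      by (simp add: mult.assoc)
  qed (simp_all add: L K)
qed

lemma has_fderiv_cong:
  assumes "\<And>y. y \<in> U \<Longrightarrow> f y = g y" "\<And>h. h \<in> fst E \<Longrightarrow> L h = K h"
    "normed_nspace E" "U \<subseteq> fst E"
  shows "has_fderiv E F U f x L \<longleftrightarrow> has_fderiv E F U g x K"
proof (cases "x \<in> U")
  case True
  have cl: "c *\<^sub>R h \<in> fst E" "g + h \<in> fst E" "g - h \<in> fst E"
    if "h \<in> fst E" "g \<in> fst E" for c h g
    using nspace_closed[OF assms(3)] that by auto
  have "bdd_lin E F L \<longleftrightarrow> bdd_lin E F K"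
    unfolding bdd_lin_def by (simp add: assms(2) cl cong: ball_cong)
  moreover have "f y - f x - L (y - x) = g y - g x - K (y - x)" if "y \<in> U" for y
    using assms(1)[OF that] assms(1)[OF True] assms(2)[OF cl(3)] that True assms(4) by auto
  ultimately show ?thesis
    unfolding has_fderiv_def by (simp add: assms(1) assms(1)[OF True] cong: ball_cong)
qed (simp add: has_fderiv_def)

lemma fderiv_cong:
  assumes "\<And>y. y \<in> U \<Longrightarrow> f y = g y" "normed_nspace E" "U \<subseteq> fst E"
  shows "fderiv E F U f x = fderiv E F U g x"
  unfolding fderiv_def by (rule arg_cong[where f = Eps], rule ext, rule has_fderiv_cong[OF assms(1) refl assms(2,3)])

lemma has_fderiv_into:
  assumes "has_fderiv E F U f x L"
  shows "x \<in> U" "\<And>y. y \<in> U \<Longrightarrow> f y \<in> fst F" "bdd_lin E F L"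
  using assms by (auto simp: has_fderiv_def)

lemma has_fderiv_estimate:
  assumes "has_fderiv E F U f x L" "e > 0"
  obtains d where "d > 0" "\<And>y. y \<in> U \<Longrightarrow> snd E (y - x) < d \<Longrightarrow>
    snd F (f y - f x - L (y - x)) \<le> e * snd E (y - x)"
  using assms unfolding has_fderiv_def by blast

lemma has_fderiv_bdd_lin:
  assumes "bdd_lin E F L" "normed_nspace E" "normed_nspace F" "x \<in> fst E"
  shows "has_fderiv E F (fst E) L x L"
proof -
  note L = bdd_lin_simps[OF assms(1,2)]
  have "snd F (L y - L x - L (y - x)) \<le> e * snd E (y - x)" if "y \<in> fst E" "e > 0" for y e
  proof -
    have "L y - L x - L (y - x) = 0" using L(5) that assms(4) by simp
    then show ?thesis using nspace_norm_zero[OF assms(3)] that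
      nspace_norm_nonneg[OF assms(2) nspace_closed(3)[OF assms(2) that(1) assms(4)]] by simp
  qed
  then show ?thesis unfolding has_fderiv_def using assms L(1) zero_less_one by blast
qed

lemma has_fderiv_lipschitz:
  assumes f: "has_fderiv E F U f x L" and E: "normed_nspace E" and F: "normed_nspace F"
    and U: "U \<subseteq> fst E"
  obtains C d where "C > 0" "d > 0"
    "\<And>y. y \<in> U \<Longrightarrow> snd E (y - x) < d \<Longrightarrow> snd F (f y - f x) \<le> C * snd E (y - x)"
proof -
  have x: "x \<in> U" and fF: "\<And>y. y \<in> U \<Longrightarrow> f y \<in> fst F" and L: "bdd_lin E F L"
    using f by (auto simp: has_fderiv_def)
  obtain C where C: "C > 0" "\<And>h. h \<in> fst E \<Longrightarrow> snd F (L h) \<le> C * snd E h"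
    using bdd_lin_bound[OF L E] by blast
  obtain d where d: "d > 0" "\<And>y. y \<in> U \<Longrightarrow> snd E (y - x) < d \<Longrightarrow>
      snd F (f y - f x - L (y - x)) \<le> 1 * snd E (y - x)"
    using has_fderiv_estimate[OF f zero_less_one] by blast
  have "snd F (f y - f x) \<le> (C + 1) * snd E (y - x)" if y: "y \<in> U" "snd E (y - x) < d" for y
  proof -
    have h: "y - x \<in> fst E" using nspace_closed(3)[OF E] y x U by auto
    have "snd F (f y - f x) = snd F ((f y - f x - L (y - x)) + L (y - x))" by simp
    also have "\<dots> \<le> snd F (f y - f x - L (y - x)) + snd F (L (y - x))"
      by (intro nspace_norm(1)[OF F] nspace_closed(3)[OF F] fF bdd_lin_simps(1)[OF L E] y x h)
    also have "\<dots> \<le> (C + 1) * snd E (y - x)"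
      using d(2)[OF y] C(2)[OF h] by (simp add: algebra_simps)
    finally show ?thesis .
  qed
  then show ?thesis using that[of "C + 1" d] C d by auto
qed

lemma has_fderiv_comp:
  assumes f: "has_fderiv E F U f x L" and g: "has_fderiv F H V g (f x) K"
    and V: "\<And>y. y \<in> U \<Longrightarrow> f y \<in> V"
    and E: "normed_nspace E" and F: "normed_nspace F" and H: "normed_nspace H"
    and U: "U \<subseteq> fst E"
  shows "has_fderiv E H U (\<lambda>y. g (f y)) x (\<lambda>h. K (L h))"
proof -
  have x: "x \<in> U" and fF: "\<And>y. y \<in> U \<Longrightarrow> f y \<in> fst F" and L: "bdd_lin E F L"
    using f by (auto simp: has_fderiv_def)
  have gH: "\<And>y. y \<in> V \<Longrightarrow> g y \<in> fst H" and K: "bdd_lin F H K"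
    using g by (auto simp: has_fderiv_def)
  obtain C d1 where C: "C > 0" "d1 > 0" 
    "\<And>y. y \<in> U \<Longrightarrow> snd E (y - x) < d1 \<Longrightarrow> snd F (f y - f x) \<le> C * snd E (y - x)"
    using has_fderiv_lipschitz[OF f E F U] by blast
  obtain D where D: "D > 0" "\<And>h. h \<in> fst F \<Longrightarrow> snd H (K h) \<le> D * snd F h"
    using bdd_lin_bound[OF K F] by blast
  have "\<exists>d>0. \<forall>y\<in>U. snd E (y - x) < d \<longrightarrow>
        snd H (g (f y) - g (f x) - K (L (y - x))) \<le> e * snd E (y - x)" if e: "e > 0" for e
  proof -
    obtain d2 where d2: "d2 > 0" "\<And>z. z \<in> V \<Longrightarrow> snd F (z - f x) < d2 \<Longrightarrow>
        snd H (g z - g (f x) - K (z - f x)) \<le> (e / (2 * C)) * snd F (z - f x)"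
      using has_fderiv_estimate[OF g, of "e / (2 * C)"] e C(1) by auto
    obtain d3 where d3: "d3 > 0" "\<And>y. y \<in> U \<Longrightarrow> snd E (y - x) < d3 \<Longrightarrow>
        snd F (f y - f x - L (y - x)) \<le> (e / (2 * D)) * snd E (y - x)"
      using has_fderiv_estimate[OF f, of "e / (2 * D)"] e D(1) by auto
    show ?thesis
    proof (intro exI[of _ "min d1 (min (d2 / C) d3)"] conjI ballI impI)
      show "0 < min d1 (min (d2 / C) d3)" using C d2 d3 by simp
      fix y assume y: "y \<in> U" "snd E (y - x) < min d1 (min (d2 / C) d3)"
      have h: "y - x \<in> fst E" using nspace_closed(3)[OF E] y x U by auto
      have fyx: "f y - f x \<in> fst F" using nspace_closed(3)[OF F] fF y x by auto
      have Lh: "L (y - x) \<in> fst F" using bdd_lin_simps(1)[OF L E h] .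
      have lip: "snd F (f y - f x) \<le> C * snd E (y - x)" using C(3) y by auto
      also have "\<dots> < d2" using y C(1) by (simp add: field_simps)
      finally have "snd H (g (f y) - g (f x) - K (f y - f x)) \<le> (e / (2 * C)) * snd F (f y - f x)"
        using d2(2) V y by auto
      also have "\<dots> \<le> (e / (2 * C)) * (C * snd E (y - x))"
        using lip e C(1) by (intro mult_left_mono) auto
      also have "\<dots> = e / 2 * snd E (y - x)" using C(1) by simp
      finally have 1: "snd H (g (f y) - g (f x) - K (f y - f x)) \<le> e / 2 * snd E (y - x)" .
      have "snd H (K (f y - f x - L (y - x))) \<le> D * snd F (f y - f x - L (y - x))"
        using D(2) nspace_closed(3)[OF F fyx Lh] by auto
      also have "\<dots> \<le> D * ((e / (2 * D)) * snd E (y - x))"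
        using d3(2) y D(1) by (intro mult_left_mono) auto
      also have "\<dots> = e / 2 * snd E (y - x)" using D(1) by simp
      finally have 2: "snd H (K (f y - f x - L (y - x))) \<le> e / 2 * snd E (y - x)" .
      have "g (f y) - g (f x) - K (L (y - x)) =
          (g (f y) - g (f x) - K (f y - f x)) + K (f y - f x - L (y - x))"
        using bdd_lin_simps(5)[OF K F fyx Lh] by simp
      also have "snd H \<dots> \<le> snd H (g (f y) - g (f x) - K (f y - f x)) + snd H (K (f y - f x - L (y - x)))"
        by (intro nspace_norm(1)[OF H] nspace_closed(3)[OF H] gH bdd_lin_simps(1)[OF K F] V
            nspace_closed(3)[OF F] fyx Lh y x)
      also have "\<dots> \<le> e * snd E (y - x)" using 1 2 by simp
      finally show "snd H (g (f y) - g (f x) - K (L (y - x))) \<le> e * snd E (y - x)" .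
    qed
  qed
  then show ?thesis unfolding has_fderiv_def
    using x gH V bdd_lin_comp[OF L K E F] by auto
qed

text \<open>Relatively open in the carrier. Derivatives are unique on such sets, which cover both an open
  set of a normed type and the whole carrier of a space such as \<open>G\<close>.\<close>

definition nopen :: "'v::real_vector nspace \<Rightarrow> 'v set \<Rightarrow> bool" where
  "nopen E U \<longleftrightarrow> U \<subseteq> fst E \<and>
     (\<forall>x\<in>U. \<exists>d>0. \<forall>y\<in>fst E. snd E (y - x) < d \<longrightarrow> y \<in> U)"

lemma nopen_carrier: "nopen E (fst E)"
  unfolding nopen_def using zero_less_one by blast

lemma nopen_type: "nopen type_nspace U \<longleftrightarrow> open U"
  by (simp add: nopen_def open_dist dist_norm)

lemma has_fderiv_unique:
  assumes L: "has_fderiv E F U f x L" and K: "has_fderiv E F U f x K"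
    and E: "normed_nspace E" and F: "normed_nspace F" and U: "nopen E U" and h: "h \<in> fst E"
  shows "L h = K h"
proof -
  have x: "x \<in> U" and fF: "\<And>y. y \<in> U \<Longrightarrow> f y \<in> fst F" and bL: "bdd_lin E F L"
    and bK: "bdd_lin E F K"
    using L K by (auto simp: has_fderiv_def)
  have UE: "U \<subseteq> fst E" using U by (simp add: nopen_def)
  have LK: "L h - K h \<in> fst F"
    using bdd_lin_simps(1)[OF bL E h] bdd_lin_simps(1)[OF bK E h] nspace_closed(3)[OF F] by auto
  have hn: "0 \<le> snd E h" using nspace_norm_nonneg[OF E h] .
  have "snd F (L h - K h) \<le> e" if e: "e > 0" for e
  proof -
    define e' where "e' = e / (2 * (snd E h + 1))"
    have e': "e' > 0" using e hn by (simp add: e'_def)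
    obtain d1 where d1: "d1 > 0" "\<And>y. y \<in> U \<Longrightarrow> snd E (y - x) < d1 \<Longrightarrow>
        snd F (f y - f x - L (y - x)) \<le> e' * snd E (y - x)"
      using has_fderiv_estimate[OF L e'] by blast
    obtain d2 where d2: "d2 > 0" "\<And>y. y \<in> U \<Longrightarrow> snd E (y - x) < d2 \<Longrightarrow>
        snd F (f y - f x - K (y - x)) \<le> e' * snd E (y - x)"
      using has_fderiv_estimate[OF K e'] by blast
    obtain d3 where d3: "d3 > 0" "\<And>y. y \<in> fst E \<Longrightarrow> snd E (y - x) < d3 \<Longrightarrow> y \<in> U"
      using U x unfolding nopen_def by blast
    define d where "d = min d1 (min d2 d3)"
    have d: "d > 0" using d1 d2 d3 by (simp add: d_def)
    define t where "t = d / (2 * (snd E h + 1))"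
    have t: "t > 0" using d hn by (simp add: t_def)
    have "t * snd E h < d"
    proof -
      have "d * snd E h < d * (2 * (snd E h + 1))" using d hn by simp
      then show ?thesis unfolding t_def using hn by (simp add: field_simps)
    qed
    moreover have th: "t *\<^sub>R h \<in> fst E" using nspace_closed(4)[OF E h] .
    ultimately have n: "snd E (t *\<^sub>R h) < d" using nspace_norm(2)[OF E h] t by simp
    define y where "y = x + t *\<^sub>R h"
    have yx: "y - x = t *\<^sub>R h" by (simp add: y_def)
    have "y \<in> fst E" using nspace_closed(2)[OF E _ th] x UE by (auto simp: y_def)
    then have y: "y \<in> U" using d3(2) n yx by (auto simp: d_def)
    have Lt: "L (t *\<^sub>R h) \<in> fst F" and Kt: "K (t *\<^sub>R h) \<in> fst F"
      using bdd_lin_simps(1)[OF bL E th] bdd_lin_simps(1)[OF bK E th] by auto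
    have fyx: "f y - f x \<in> fst F" using nspace_closed(3)[OF F] fF y x by auto
    have eq: "t *\<^sub>R (L h - K h) = (f y - f x - K (t *\<^sub>R h)) - (f y - f x - L (t *\<^sub>R h))"
      using bdd_lin_simps(3)[OF bL E h] bdd_lin_simps(3)[OF bK E h] by (simp add: scaleR_diff_right)
    have "t * snd F (L h - K h) = snd F (t *\<^sub>R (L h - K h))"
      using nspace_norm(2)[OF F LK] t by simp
    also have "\<dots> = snd F ((f y - f x - K (t *\<^sub>R h)) - (f y - f x - L (t *\<^sub>R h)))"
      using eq by simp
    also have "\<dots> \<le> snd F (f y - f x - K (t *\<^sub>R h)) + snd F (f y - f x - L (t *\<^sub>R h))"
      by (intro nspace_norm_diff[OF F] nspace_closed(3)[OF F] fyx Lt Kt fF y x)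
    also have "\<dots> \<le> e' * snd E (t *\<^sub>R h) + e' * snd E (t *\<^sub>R h)"
      using d1(2)[OF y] d2(2)[OF y] n yx by (intro add_mono) (auto simp: d_def)
    also have "\<dots> = t * (2 * e' * snd E h)" using nspace_norm(2)[OF E h] t by simp
    finally have "snd F (L h - K h) \<le> 2 * e' * snd E h" using t by simp
    also have "\<dots> \<le> e" using e hn unfolding e'_def by (simp add: field_simps)
    finally show ?thesis .
  qed
  then have "snd F (L h - K h) \<le> 0" by (rule field_le_epsilon[of _ 0, simplified]) 
  then have "snd F (L h - K h) = 0" using nspace_norm_nonneg[OF F LK] by simp
  then show ?thesis using nspace_norm(3)[OF F LK] by simp
qed

text \<open>Outside the carrier \<open>fderiv\<close> is an arbitrary choice; on the carrier uniqueness of the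
  derivative removes the choice operator.\<close>

lemma fderiv_eq:
  assumes "has_fderiv E F U f x L"
    and "normed_nspace E" "normed_nspace F" "nopen E U" "h \<in> fst E"
  shows "fderiv E F U f x h = L h"
proof -
  have "has_fderiv E F U f x (fderiv E F U f x)"
    unfolding fderiv_def using assms(1) by (rule someI[where P = "has_fderiv E F U f x"])
  then show ?thesis using has_fderiv_unique assms by blast
qed

definition nprod :: "'v nspace \<Rightarrow> 'w nspace \<Rightarrow> ('v \<times> 'w) nspace" where
  "nprod E F = (fst E \<times> fst F, \<lambda>z. snd E (fst z) + snd F (snd z))"

lemma nprod_simps [simp]:
  "fst (nprod E F) = fst E \<times> fst F" "snd (nprod E F) z = snd E (fst z) + snd F (snd z)"
  by (simp_all add: nprod_def)

lemma nspace_nprod: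
  assumes E: "normed_nspace E" and F: "normed_nspace F"
  shows "normed_nspace (nprod E F)"
proof -
  have "z = 0" if "z \<in> fst E \<times> fst F" "snd E (fst z) + snd F (snd z) = 0" for z
  proof -
    have "0 \<le> snd E (fst z)" "0 \<le> snd F (snd z)"
      using that nspace_norm_nonneg[OF E] nspace_norm_nonneg[OF F] by auto
    then show ?thesis using that nspace_norm(3)[OF E, of "fst z"] nspace_norm(3)[OF F, of "snd z"]
      by (auto simp: prod_eq_iff)
  qed
  moreover have "subspace (fst E \<times> fst F)"
    using nspace_closed[OF E] nspace_closed[OF F] by (auto simp: subspace_def zero_prod_def)
  moreover have "snd E (fst (x + y)) + snd F (snd (x + y)) \<le>
      (snd E (fst x) + snd F (snd x)) + (snd E (fst y) + snd F (snd y))"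
    if "x \<in> fst E \<times> fst F" "y \<in> fst E \<times> fst F" for x y
    using nspace_norm(1)[OF E, of "fst x" "fst y"] nspace_norm(1)[OF F, of "snd x" "snd y"] that
    by auto
  ultimately show ?thesis unfolding normed_nspace_def nprod_simps
    using nspace_norm(2)[OF E] nspace_norm(2)[OF F] by (auto simp: algebra_simps)
qed

lemma bdd_lin_fst: "normed_nspace F \<Longrightarrow> bdd_lin (nprod E F) E fst"
  and bdd_lin_snd: "normed_nspace E \<Longrightarrow> bdd_lin (nprod E F) F snd"
  using nspace_norm_nonneg[of F] nspace_norm_nonneg[of E] 
  by (auto intro!: bdd_linI[where C = 1])

lemma bdd_lin_pair:
  assumes "bdd_lin E F L" "bdd_lin E H K" "normed_nspace E"
  shows "bdd_lin E (nprod F H) (\<lambda>h. (L h, K h))"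
proof -
  obtain C where C: "C > 0" "\<And>h. h \<in> fst E \<Longrightarrow> snd F (L h) \<le> C * snd E h"
    using bdd_lin_bound[OF assms(1,3)] by blast
  obtain D where D: "D > 0" "\<And>h. h \<in> fst E \<Longrightarrow> snd H (K h) \<le> D * snd E h"
    using bdd_lin_bound[OF assms(2,3)] by blast
  show ?thesis
    by (rule bdd_linI[where C = "C + D"])
      (use bdd_lin_simps[OF assms(1,3)] bdd_lin_simps[OF assms(2,3)] in 
        \<open>auto simp: algebra_simps intro!: add_mono C(2) D(2)\<close>)
qed

lemma has_fderiv_pair:
  assumes f: "has_fderiv E F U f x L" and g: "has_fderiv E H U g x K"
    and E: "normed_nspace E"
  shows "has_fderiv E (nprod F H) U (\<lambda>y. (f y, g y)) x (\<lambda>h. (L h, K h))"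
  unfolding has_fderiv_def
proof (intro conjI allI impI)
  show "x \<in> U" "\<forall>y\<in>U. (f y, g y) \<in> fst (nprod F H)"
    using f g by (auto simp: has_fderiv_def)
  show "bdd_lin E (nprod F H) (\<lambda>h. (L h, K h))"
    using f g by (intro bdd_lin_pair[OF _ _ E]) (auto simp: has_fderiv_def)
  fix e :: real assume e: "e > 0"
  obtain d1 where d1: "d1 > 0" "\<And>y. y \<in> U \<Longrightarrow> snd E (y - x) < d1 \<Longrightarrow>
        snd F (f y - f x - L (y - x)) \<le> e / 2 * snd E (y - x)"
    using has_fderiv_estimate[OF f half_gt_zero[OF e]] by blast
  obtain d2 where d2: "d2 > 0" "\<And>y. y \<in> U \<Longrightarrow> snd E (y - x) < d2 \<Longrightarrow>
        snd H (g y - g x - K (y - x)) \<le> e / 2 * snd E (y - x)"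
    using has_fderiv_estimate[OF g half_gt_zero[OF e]] by blast
  show "\<exists>d>0. \<forall>y\<in>U. snd E (y - x) < d \<longrightarrow>
      snd (nprod F H) ((f y, g y) - (f x, g x) - (L (y - x), K (y - x))) \<le> e * snd E (y - x)"
    using d1 d2 by (intro exI[of _ "min d1 d2"]) fastforce
qed

definition bdd_bilin :: "'v::real_vector nspace \<Rightarrow> 'w::real_vector nspace \<Rightarrow> 'z::real_vector nspace
    \<Rightarrow> ('v \<times> 'w \<Rightarrow> 'z) \<Rightarrow> bool" where
  "bdd_bilin E F H b \<longleftrightarrow>
     (\<forall>x\<in>fst E. \<forall>y\<in>fst F. b (x, y) \<in> fst H) \<and>
     (\<forall>x\<in>fst E. \<forall>x'\<in>fst E. \<forall>y\<in>fst F. b (x + x', y) = b (x, y) + b (x', y)) \<and>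
     (\<forall>x\<in>fst E. \<forall>y\<in>fst F. \<forall>y'\<in>fst F. b (x, y + y') = b (x, y) + b (x, y')) \<and>
     (\<forall>c. \<forall>x\<in>fst E. \<forall>y\<in>fst F. b (c *\<^sub>R x, y) = c *\<^sub>R b (x, y)) \<and>
     (\<forall>c. \<forall>x\<in>fst E. \<forall>y\<in>fst F. b (x, c *\<^sub>R y) = c *\<^sub>R b (x, y)) \<and>
     (\<exists>C\<ge>0. \<forall>x\<in>fst E. \<forall>y\<in>fst F. snd H (b (x, y)) \<le> C * snd E x * snd F y)"

lemma bdd_bilinD:
  assumes "bdd_bilin E F H b"
  shows "\<And>x y. x \<in> fst E \<Longrightarrow> y \<in> fst F \<Longrightarrow> b (x, y) \<in> fst H"
   "\<And>x x' y. x \<in> fst E \<Longrightarrow> x' \<in> fst E \<Longrightarrow> y \<in> fst F \<Longrightarrow> b (x + x', y) = b (x, y) + b (x', y)"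
   "\<And>x y y'. x \<in> fst E \<Longrightarrow> y \<in> fst F \<Longrightarrow> y' \<in> fst F \<Longrightarrow> b (x, y + y') = b (x, y) + b (x, y')"
   "\<And>c x y. x \<in> fst E \<Longrightarrow> y \<in> fst F \<Longrightarrow> b (c *\<^sub>R x, y) = c *\<^sub>R b (x, y)"
   "\<And>c x y. x \<in> fst E \<Longrightarrow> y \<in> fst F \<Longrightarrow> b (x, c *\<^sub>R y) = c *\<^sub>R b (x, y)"
   "\<exists>C\<ge>0. \<forall>x\<in>fst E. \<forall>y\<in>fst F. snd H (b (x, y)) \<le> C * snd E x * snd F y"
  using assms unfolding bdd_bilin_def by blast+

lemma has_fderiv_bilin:
  assumes b: "bdd_bilin E F H b"
    and E: "normed_nspace E" and F: "normed_nspace F" and H: "normed_nspace H"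
    and z: "z \<in> fst E \<times> fst F"
  shows "has_fderiv (nprod E F) H (fst E \<times> fst F) b z
    (\<lambda>w. b (fst w, snd z) + b (fst z, snd w))"
proof -
  note B = bdd_bilinD[OF b]
  note cE = nspace_closed[OF E] and cF = nspace_closed[OF F] and cH = nspace_closed[OF H]
  obtain C where C: "C \<ge> 0" "\<And>x y. x \<in> fst E \<Longrightarrow> y \<in> fst F \<Longrightarrow> snd H (b (x, y)) \<le> C * snd E x * snd F y"
    using B(6) by blast
  have z': "fst z \<in> fst E" "snd z \<in> fst F" using z by auto
  have nn: "0 \<le> snd E x" "0 \<le> snd F y" if "x \<in> fst E" "y \<in> fst F" for x y
    using nspace_norm_nonneg[OF E that(1)] nspace_norm_nonneg[OF F that(2)] by auto
  have lin: "bdd_lin (nprod E F) H (\<lambda>w. b (fst w, snd z) + b (fst z, snd w))"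
  proof (rule bdd_linI[where C = "C * (snd E (fst z) + snd F (snd z))"], unfold nprod_simps)
    fix h assume h: "h \<in> fst E \<times> fst F"
    then have h': "fst h \<in> fst E" "snd h \<in> fst F" by auto
    show "b (fst h, snd z) + b (fst z, snd h) \<in> fst H"
      by (intro cH B(1) h' z')
    have "snd H (b (fst h, snd z) + b (fst z, snd h)) \<le> snd H (b (fst h, snd z)) + snd H (b (fst z, snd h))"
      by (intro nspace_norm(1)[OF H] B(1) h' z')
    also have "\<dots> \<le> C * snd E (fst h) * snd F (snd z) + C * snd E (fst z) * snd F (snd h)"
      by (intro add_mono C h' z')
    also have "\<dots> \<le> C * (snd E (fst z) + snd F (snd z)) * (snd E (fst h) + snd F (snd h))"
      using C(1) nn[OF h'] nn[OF z'] by (simp add: algebra_simps)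
    finally show "snd H (b (fst h, snd z) + b (fst z, snd h)) \<le>
        C * (snd E (fst z) + snd F (snd z)) * (snd E (fst h) + snd F (snd h))" .
    show "b (fst (c *\<^sub>R h), snd z) + b (fst z, snd (c *\<^sub>R h)) = c *\<^sub>R (b (fst h, snd z) + b (fst z, snd h))" for c
      using B(4,5) h' z' by (simp add: scaleR_add_right)
    fix g assume g: "g \<in> fst E \<times> fst F"
    then have g': "fst g \<in> fst E" "snd g \<in> fst F" by auto
    show "b (fst (g + h), snd z) + b (fst z, snd (g + h)) =
        b (fst g, snd z) + b (fst z, snd g) + (b (fst h, snd z) + b (fst z, snd h))"
      using B(2,3) h' g' z' by simp
  qed
  have key: "b y - b z - (b (fst (y - z), snd z) + b (fst z, snd (y - z))) = b (fst (y - z), snd (y - z))"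
    if "y \<in> fst E \<times> fst F" for y
  proof -
    have "b (fst (y - z) + fst z, snd (y - z) + snd z) =
       b (fst (y - z), snd (y - z)) + b (fst (y - z), snd z) + (b (fst z, snd (y - z)) + b (fst z, snd z))"
      using that z' cE(3) cF(3) B(2)[of "fst (y - z)" "fst z" "snd (y - z) + snd z"]
        B(3)[of "fst (y - z)" "snd (y - z)" "snd z"] B(3)[of "fst z" "snd (y - z)" "snd z"]
      by (simp add: mem_Times_iff)
    then show ?thesis by (simp add: algebra_simps)
  qed
  have "\<exists>d>0. \<forall>y\<in>fst E \<times> fst F. snd (nprod E F) (y - z) < d \<longrightarrow>
      snd H (b y - b z - (b (fst (y - z), snd z) + b (fst z, snd (y - z)))) \<le> e * snd (nprod E F) (y - z)"
    if e: "e > 0" for e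
  proof (intro exI[of _ "e / (C + 1)"] conjI ballI impI)
    show "0 < e / (C + 1)" using e C by simp
    fix y assume y: "y \<in> fst E \<times> fst F" "snd (nprod E F) (y - z) < e / (C + 1)"
    have h: "fst (y - z) \<in> fst E" "snd (y - z) \<in> fst F" using y z' cE cF by auto
    define s where "s = snd E (fst (y - z)) + snd F (snd (y - z))"
    have s: "0 \<le> s" "s < e / (C + 1)" using nn[OF h] y by (auto simp: s_def)
    have "snd H (b (fst (y - z), snd (y - z))) \<le> C * snd E (fst (y - z)) * snd F (snd (y - z))"
      by (rule C(2)[OF h])
    also have "\<dots> \<le> C * s * s"
      by (intro mult_mono) (use C(1) nn[OF h] in \<open>auto simp: s_def\<close>)
    also have "\<dots> \<le> e * s"
    proof (rule mult_right_mono[OF _ s(1)])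
      have "C * s \<le> (C + 1) * s" using s by (simp add: algebra_simps)
      also have "\<dots> \<le> e" using s(2) C(1) by (simp add: field_simps)
      finally show "C * s \<le> e" .
    qed
    finally show "snd H (b y - b z - (b (fst (y - z), snd z) + b (fst z, snd (y - z)))) \<le>
        e * snd (nprod E F) (y - z)" using key[OF y(1)] by (simp add: s_def)
  qed
  then show ?thesis unfolding has_fderiv_def using lin z B(1) by auto
qed

lemma bdd_lin_add_pair: 
  assumes "normed_nspace E" shows "bdd_lin (nprod E E) E (\<lambda>z. fst z + snd z)"
  by (rule bdd_linI[where C = 1])
    (use nspace_closed[OF assms] nspace_norm[OF assms] in \<open>auto simp: scaleR_add_right\<close>)

lemma bdd_lin_scaleR: 
  assumes "normed_nspace E" shows "bdd_lin E E (\<lambda>z. c *\<^sub>R z)"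
  by (rule bdd_linI[where C = "\<bar>c\<bar>"])
    (use nspace_closed[OF assms] nspace_norm[OF assms] in \<open>auto simp: scaleR_add_right\<close>)

lemma has_fderiv_add:
  assumes f: "has_fderiv E F U f x L" and g: "has_fderiv E F U g x K"
    and E: "normed_nspace E" and F: "normed_nspace F" and U: "U \<subseteq> fst E"
  shows "has_fderiv E F U (\<lambda>y. f y + g y) x (\<lambda>h. L h + K h)"
proof -
  have "f y \<in> fst F" "g y \<in> fst F" if "y \<in> U" for y using f g that by (auto simp: has_fderiv_def)
  moreover have "x \<in> U" using f by (auto simp: has_fderiv_def)
  ultimately show ?thesis
    using has_fderiv_comp[OF has_fderiv_pair[OF f g E] has_fderiv_bdd_lin[OF bdd_lin_add_pair[OF F]
       nspace_nprod[OF F F] F] _ E nspace_nprod[OF F F] F U] by simp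
qed

lemma has_fderiv_scaleR:
  assumes f: "has_fderiv E F U f x L"
    and E: "normed_nspace E" and F: "normed_nspace F" and U: "U \<subseteq> fst E"
  shows "has_fderiv E F U (\<lambda>y. c *\<^sub>R f y) x (\<lambda>h. c *\<^sub>R L h)"
proof -
  have "f y \<in> fst F" if "y \<in> U" for y using f that by (auto simp: has_fderiv_def)
  moreover have "x \<in> U" using f by (auto simp: has_fderiv_def)
  ultimately show ?thesis
    using has_fderiv_comp[OF f has_fderiv_bdd_lin[OF bdd_lin_scaleR[OF F] F F] _ E F F U] by simp
qed

lemma has_fderiv_linear_comp:
  assumes f: "has_fderiv E F U f x L" and K: "bdd_lin F H K"
    and E: "normed_nspace E" and F: "normed_nspace F" and H: "normed_nspace H" and U: "U \<subseteq> fst E"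
  shows "has_fderiv E H U (\<lambda>y. K (f y)) x (\<lambda>h. K (L h))"
proof -
  have "f y \<in> fst F" if "y \<in> U" for y using f that by (auto simp: has_fderiv_def)
  moreover have "x \<in> U" using f by (auto simp: has_fderiv_def)
  ultimately show ?thesis
    using has_fderiv_comp[OF f has_fderiv_bdd_lin[OF K F H] _ E F H U] by simp
qed

lemma has_fderiv_bilin_comp:
  assumes f: "has_fderiv E F U f x L" and g: "has_fderiv E H U g x K" and b: "bdd_bilin F H I b"
    and E: "normed_nspace E" and F: "normed_nspace F" and H: "normed_nspace H"
    and I: "normed_nspace I" and U: "U \<subseteq> fst E"
  shows "has_fderiv E I U (\<lambda>y. b (f y, g y)) x (\<lambda>h. b (L h, g x) + b (f x, K h))"
proof -
  have "f y \<in> fst F" "g y \<in> fst H" if "y \<in> U" for y using f g that by (auto simp: has_fderiv_def)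
  moreover have "x \<in> U" using f by (auto simp: has_fderiv_def)
  ultimately show ?thesis
    using has_fderiv_comp[OF has_fderiv_pair[OF f g E] has_fderiv_bilin[OF b F H I] _ E
      nspace_nprod[OF F H] I U] by simp
qed

lemma has_fderiv_restrict:
  assumes f: "has_fderiv F H V f x L" and E: "fst E \<subseteq> fst F" "snd E = snd F"
    and U: "U \<subseteq> V" "x \<in> U"
  shows "has_fderiv E H U f x L"
proof -
  obtain C where C: "\<And>h. h \<in> fst F \<Longrightarrow> snd H (L h) \<le> C * snd F h"
    and L: "\<And>h. h \<in> fst F \<Longrightarrow> L h \<in> fst H"
      "\<And>g h. g \<in> fst F \<Longrightarrow> h \<in> fst F \<Longrightarrow> L (g + h) = L g + L h"
      "\<And>c h. h \<in> fst F \<Longrightarrow> L (c *\<^sub>R h) = c *\<^sub>R L h"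
    using has_fderiv_into(3)[OF f] unfolding bdd_lin_def by blast
  have "bdd_lin E H L"
    by (rule bdd_linI[where C = C]) (use C L subsetD[OF E(1)] E(2) in auto)
  moreover have "\<exists>d>0. \<forall>y\<in>U. snd E (y - x) < d \<longrightarrow> snd H (f y - f x - L (y - x)) \<le> e * snd E (y - x)"
    if "e > 0" for e
    using has_fderiv_estimate[OF f that] subsetD[OF U(1)] unfolding E(2) by metis
  ultimately show ?thesis
    unfolding has_fderiv_def using U has_fderiv_into(2)[OF f] by auto
qed

lemma has_fderiv_type:
  fixes f :: "'v::real_normed_vector \<Rightarrow> 'w::real_normed_vector"
  assumes "open U" "x \<in> U"
  shows "has_fderiv type_nspace type_nspace U f x L \<longleftrightarrow> (f has_derivative L) (at x)"
proof -
  have b: "bdd_lin type_nspace type_nspace L \<longleftrightarrow> bounded_linear L"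
    unfolding bdd_lin_def bounded_linear_def bounded_linear_axioms_def
    by (auto simp: linear_iff mult.commute)
  obtain d0 where d0: "d0 > 0" "\<And>y. norm (y - x) < d0 \<Longrightarrow> y \<in> U"
    using assms by (auto simp: open_dist dist_norm)
  have "(\<exists>d>0. \<forall>y\<in>U. norm (y - x) < d \<longrightarrow> norm (f y - f x - L (y - x)) \<le> e * norm (y - x)) \<longleftrightarrow>
    (\<exists>d>0. \<forall>y. norm (y - x) < d \<longrightarrow> norm (f y - f x - L (y - x)) \<le> e * norm (y - x))" (is "?l \<longleftrightarrow> ?r") for e
  proof
    assume ?l
    then obtain d where "d > 0" "\<forall>y\<in>U. norm (y - x) < d \<longrightarrow> norm (f y - f x - L (y - x)) \<le> e * norm (y - x)"
      by blast
    then show ?r using d0 by (intro exI[of _ "min d d0"]) auto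
  qed blast
  then show ?thesis
    unfolding has_fderiv_def has_derivative_within_alt using b assms by simp
qed

section \<open>Twice differentiable maps and the symmetry of second derivatives\<close>

text \<open>The tangent map \<open>T (a, h) = Df(a) h\<close> is itself differentiable on the product space. This replaces
  the differentiability of \<open>Df\<close> in the operator norm, and makes the chain rule functorial: the tangent
  map of a composition is the composition of the tangent maps.\<close>

definition twice_fdiff :: "'v::real_vector nspace \<Rightarrow> 'w::real_vector nspace \<Rightarrow> 'v set \<Rightarrow> ('v \<Rightarrow> 'w) \<Rightarrow> ('v \<times> 'v \<Rightarrow> 'w) \<Rightarrow> bool" where
  "twice_fdiff E F U f T \<longleftrightarrow> (\<forall>a\<in>U. has_fderiv E F U f a (\<lambda>h. T (a, h))) \<and>
     (\<forall>z\<in>U \<times> fst E. \<exists>L. has_fderiv (nprod E E) F (U \<times> fst E) T z L)"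

lemma twice_fdiff_deriv: "twice_fdiff E F U f T \<Longrightarrow> a \<in> U \<Longrightarrow> has_fderiv E F U f a (\<lambda>h. T (a, h))"
  by (auto simp: twice_fdiff_def)

lemma twice_fdiff_comp:
  assumes f: "twice_fdiff E F U f T" and g: "twice_fdiff F H V g S" and V: "\<And>y. y \<in> U \<Longrightarrow> f y \<in> V"
    and E: "normed_nspace E" and F: "normed_nspace F" and H: "normed_nspace H"
    and U: "U \<subseteq> fst E"
  shows "twice_fdiff E H U (\<lambda>x. g (f x)) (\<lambda>z. S (f (fst z), T z))"
  unfolding twice_fdiff_def
proof (intro conjI ballI)
  fix a assume a: "a \<in> U"
  show "has_fderiv E H U (\<lambda>x. g (f x)) a (\<lambda>h. S (f (fst (a, h)), T (a, h)))"
    using has_fderiv_comp[OF twice_fdiff_deriv[OF f a] twice_fdiff_deriv[OF g V[OF a]] V E F H U] by simp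
next
  fix z assume z: "z \<in> U \<times> fst E"
  note EE = nspace_nprod[OF E E] and FF = nspace_nprod[OF F F]
  have UE: "U \<times> fst E \<subseteq> fst (nprod E E)" using U by auto
  have 1: "has_fderiv (nprod E E) E (U \<times> fst E) fst z fst"
    by (rule has_fderiv_restrict[OF has_fderiv_bdd_lin[OF bdd_lin_fst[OF E] EE E]])
      (use z U in auto)
  have 2: "has_fderiv (nprod E E) F (U \<times> fst E) (\<lambda>z. f (fst z)) z (\<lambda>h. T (fst z, fst h))"
    using has_fderiv_comp[OF 1 twice_fdiff_deriv[OF f, of "fst z"] _ EE E F UE] z by auto
  obtain L where L: "has_fderiv (nprod E E) F (U \<times> fst E) T z L"
    using f z unfolding twice_fdiff_def by blast
  have z2: "(f (fst z), T z) \<in> V \<times> fst F"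
    using V z has_fderiv_into(2)[OF L z] by auto
  obtain K where K: "has_fderiv (nprod F F) H (V \<times> fst F) S (f (fst z), T z) K"
    using g z2 unfolding twice_fdiff_def by blast
  have "has_fderiv (nprod E E) H (U \<times> fst E) (\<lambda>z. S (f (fst z), T z)) z (\<lambda>h. K (T (fst z, fst h), L h))"
    by (rule has_fderiv_comp[OF has_fderiv_pair[OF 2 L EE] K _ EE FF H UE])
      (use V has_fderiv_into(2)[OF L] in auto)
  then show "\<exists>L. has_fderiv (nprod E E) H (U \<times> fst E) (\<lambda>z. S (f (fst z), T z)) z L" by blast
qed

lemma twice_fdiff_pair:
  assumes f: "twice_fdiff E F U f T" and g: "twice_fdiff E H U g S" and E: "normed_nspace E" and U: "U \<subseteq> fst E"
  shows "twice_fdiff E (nprod F H) U (\<lambda>x. (f x, g x)) (\<lambda>z. (T z, S z))"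
  unfolding twice_fdiff_def
proof (intro conjI ballI)
  fix a assume a: "a \<in> U"
  show "has_fderiv E (nprod F H) U (\<lambda>x. (f x, g x)) a (\<lambda>h. (T (a, h), S (a, h)))"
    using has_fderiv_pair[OF twice_fdiff_deriv[OF f a] twice_fdiff_deriv[OF g a] E] .
next
  fix z assume z: "z \<in> U \<times> fst E"
  then obtain L K where "has_fderiv (nprod E E) F (U \<times> fst E) T z L"
     "has_fderiv (nprod E E) H (U \<times> fst E) S z K"
    using f g unfolding twice_fdiff_def by blast
  from has_fderiv_pair[OF this nspace_nprod[OF E E]]
  show "\<exists>L. has_fderiv (nprod E E) (nprod F H) (U \<times> fst E) (\<lambda>z. (T z, S z)) z L" by blast
qed

lemma twice_fdiff_bdd_lin:
  assumes L: "bdd_lin E F L" and E: "normed_nspace E" and F: "normed_nspace F"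
  shows "twice_fdiff E F (fst E) L (\<lambda>z. L (snd z))"
proof -
  have "has_fderiv (nprod E E) F (fst E \<times> fst E) (\<lambda>z. L (snd z)) z (\<lambda>z. L (snd z))"
    if "z \<in> fst E \<times> fst E" for z
    using has_fderiv_bdd_lin[OF bdd_lin_comp[OF bdd_lin_snd[OF E] L nspace_nprod[OF E E] E]
      nspace_nprod[OF E E] F] that by simp
  then show ?thesis unfolding twice_fdiff_def using has_fderiv_bdd_lin[OF L E F] by auto
qed

lemma twice_fdiff_const:
  assumes "c \<in> fst F" and E: "normed_nspace E" and F: "normed_nspace F"
  shows "twice_fdiff E F (fst E) (\<lambda>x. c) (\<lambda>z. 0)"
proof -
  have 0: "has_fderiv E' F U (\<lambda>x. v) z (\<lambda>h. 0)" 
    if "z \<in> U" "v \<in> fst F" "normed_nspace E'" "U \<subseteq> fst E'" for z v U and E' :: "'z::real_vector nspace"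
  proof -
    have "bdd_lin E' F (\<lambda>h. 0)"
      by (rule bdd_linI[where C = 0]) (use nspace_closed(1)[OF F] F in auto)
    moreover have "0 \<le> e * snd E' (y - z)" if "e > 0" "y \<in> U" for e y
      by (intro mult_nonneg_nonneg nspace_norm_nonneg[OF \<open>normed_nspace E'\<close>]
          nspace_closed(3)[OF \<open>normed_nspace E'\<close>])
        (use that \<open>z \<in> U\<close> \<open>U \<subseteq> fst E'\<close> in auto)
    ultimately show ?thesis unfolding has_fderiv_def using that F zero_less_one by auto
  qed
  have "has_fderiv (nprod E E) F (fst E \<times> fst E) (\<lambda>z. 0) z (\<lambda>h. 0)" if "z \<in> fst E \<times> fst E" for z
    by (rule 0[OF that nspace_closed(1)[OF F] nspace_nprod[OF E E]]) simp
  then show ?thesis unfolding twice_fdiff_def using 0[OF _ assms(1) E order_refl] by blast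
qed

lemma twice_fdiff_bilin:
  assumes b: "bdd_bilin E F H b"
    and E: "normed_nspace E" and F: "normed_nspace F" and H: "normed_nspace H"
  shows "twice_fdiff (nprod E F) H (fst E \<times> fst F) b
     (\<lambda>z. b (fst (snd z), snd (fst z)) + b (fst (fst z), snd (snd z)))"
  unfolding twice_fdiff_def
proof (intro conjI ballI)
  fix a assume a: "a \<in> fst E \<times> fst F"
  show "has_fderiv (nprod E F) H (fst E \<times> fst F) b a
      (\<lambda>h. b (fst (snd (a, h)), snd (fst (a, h))) + b (fst (fst (a, h)), snd (snd (a, h))))"
    using has_fderiv_bilin[OF b E F H a] by simp
next
  fix z assume z: "z \<in> (fst E \<times> fst F) \<times> fst (nprod E F)"
  let ?E = "nprod (nprod E F) (nprod E F)"
  let ?U = "(fst E \<times> fst F) \<times> fst (nprod E F)"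
  note P = nspace_nprod[OF E F]
  note PP = nspace_nprod[OF P P]
  have zP: "z \<in> fst ?E" using z by simp
  note bl = bdd_lin_comp[OF _ _ PP P]
  have 1: "has_fderiv ?E E ?U (\<lambda>z. fst (fst z)) z (\<lambda>z. fst (fst z))"
    "has_fderiv ?E F ?U (\<lambda>z. snd (fst z)) z (\<lambda>z. snd (fst z))"
    "has_fderiv ?E E ?U (\<lambda>z. fst (snd z)) z (\<lambda>z. fst (snd z))"
    "has_fderiv ?E F ?U (\<lambda>z. snd (snd z)) z (\<lambda>z. snd (snd z))"
    using has_fderiv_bdd_lin[OF bl[OF bdd_lin_fst[OF P] bdd_lin_fst[OF F]] PP E zP]
      has_fderiv_bdd_lin[OF bl[OF bdd_lin_fst[OF P] bdd_lin_snd[OF E]] PP F zP]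
      has_fderiv_bdd_lin[OF bl[OF bdd_lin_snd[OF P] bdd_lin_fst[OF F]] PP E zP]
      has_fderiv_bdd_lin[OF bl[OF bdd_lin_snd[OF P] bdd_lin_snd[OF E]] PP F zP]
    by simp_all
  have U: "?U \<subseteq> fst ?E" by simp
  show "\<exists>L. has_fderiv ?E H ?U
     (\<lambda>z. b (fst (snd z), snd (fst z)) + b (fst (fst z), snd (snd z))) z L"
    using has_fderiv_add[OF has_fderiv_bilin_comp[OF 1(3) 1(2) b PP E F H U]
        has_fderiv_bilin_comp[OF 1(1) 1(4) b PP E F H U] PP H U] by blast
qed

lemma twice_fdiff_linear_comp:
  assumes f: "twice_fdiff E F U f T" and L: "bdd_lin F H L"
    and E: "normed_nspace E" and F: "normed_nspace F" and H: "normed_nspace H" and U: "U \<subseteq> fst E"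
  shows "twice_fdiff E H U (\<lambda>x. L (f x)) (\<lambda>z. L (T z))"
proof -
  have "f y \<in> fst F" if "y \<in> U" for y using twice_fdiff_deriv[OF f that] has_fderiv_into that by blast
  from twice_fdiff_comp[OF f twice_fdiff_bdd_lin[OF L F H] this E F H U] show ?thesis by simp
qed

lemma twice_fdiff_bilin_comp:
  assumes f: "twice_fdiff E F U f T" and g: "twice_fdiff E H U g S" and b: "bdd_bilin F H I b"
    and E: "normed_nspace E" and F: "normed_nspace F" and H: "normed_nspace H"
    and I: "normed_nspace I" and U: "U \<subseteq> fst E"
  shows "twice_fdiff E I U (\<lambda>x. b (f x, g x)) (\<lambda>z. b (T z, g (fst z)) + b (f (fst z), S z))"
proof -
  have "(f y, g y) \<in> fst F \<times> fst H" if "y \<in> U" for y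
    using has_fderiv_into(2)[OF twice_fdiff_deriv[OF f that] that] has_fderiv_into(2)[OF twice_fdiff_deriv[OF g that] that] by simp
  from twice_fdiff_comp[OF twice_fdiff_pair[OF f g E U] twice_fdiff_bilin[OF b F H I] this E nspace_nprod[OF F H] I U]
  show ?thesis by simp
qed

lemma twice_fdiff_diff:
  assumes f: "twice_fdiff E F U f T" and g: "twice_fdiff E F U g S" 
    and E: "normed_nspace E" and F: "normed_nspace F" and U: "U \<subseteq> fst E"
  shows "twice_fdiff E F U (\<lambda>x. f x - g x) (\<lambda>z. T z - S z)"
proof -
  have "bdd_lin (nprod F F) F (\<lambda>z. fst z - snd z)"
    by (rule bdd_linI[where C = 1])
      (use nspace_closed[OF F] nspace_norm[OF F] nspace_norm_diff[OF F] in \<open>auto simp: scaleR_diff_right\<close>)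
  from twice_fdiff_linear_comp[OF twice_fdiff_pair[OF f g E U] this E nspace_nprod[OF F F] F U]
  show ?thesis by simp
qed

lemma twice_fdiff_cong:
  assumes "twice_fdiff E F U f T" "\<And>x. x \<in> U \<Longrightarrow> f x = g x" "normed_nspace E" "U \<subseteq> fst E"
  shows "twice_fdiff E F U g T"
  using assms(1) has_fderiv_cong[OF assms(2) refl assms(3,4)] unfolding twice_fdiff_def by auto

text \<open>The product rule for \<open>Df \<cdot> v\<close>: the derivative of the tangent map along \<open>(h, Dv h)\<close> splits into a
  second derivative of \<open>f\<close> and \<open>Df\<close> applied to \<open>Dv h\<close>.\<close>

lemma twice_fdiff_field_deriv:
  assumes f: "twice_fdiff E F U f T" and v: "has_fderiv E E U v a K" and L: "has_fderiv (nprod E E) F (U \<times> fst E) T (a, v a) L"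
    and E: "normed_nspace E" and F: "normed_nspace F" and U: "nopen E U"
  shows "has_fderiv E F U (\<lambda>x. T (x, v x)) a (\<lambda>h. L (h, 0) + T (a, K h))"
proof -
  have UE: "U \<subseteq> fst E" using U by (simp add: nopen_def)
  note EE = nspace_nprod[OF E E]
  have a: "a \<in> U" using has_fderiv_into[OF v] by simp
  have "bdd_lin E E (\<lambda>h. h)" by (rule bdd_linI[where C = 1]) auto
  then have id: "has_fderiv E E U (\<lambda>x. x) a (\<lambda>h. h)"
    using has_fderiv_restrict[OF has_fderiv_bdd_lin[OF _ E E subsetD[OF UE a]] order_refl refl UE a] by blast
  have K: "K h \<in> fst E" if "h \<in> fst E" for h using has_fderiv_into(3)[OF v] E that bdd_lin_simps(1) by blast
  have va: "v a \<in> fst E" using has_fderiv_into(2)[OF v a] .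
  have c: "has_fderiv E F U (\<lambda>x. T (x, v x)) a (\<lambda>h. L (h, K h))"
    by (rule has_fderiv_comp[OF has_fderiv_pair[OF id v E] L _ E EE F UE])
      (use has_fderiv_into(2)[OF v] in auto)
  \<comment> \<open>in the second slot the tangent map is linear, so it is its own derivative\<close>
  have sl: "L (0, l) = T (a, l)" if l: "l \<in> fst E" for l
  proof -
    have c0: "bdd_lin E E (\<lambda>h. 0)" by (rule bdd_linI[where C = 0]) (use nspace_closed(1)[OF E] E in auto)
    have ca: "has_fderiv E E (fst E) (\<lambda>x. a) (v a) (\<lambda>h. 0)"
      using twice_fdiff_deriv[OF twice_fdiff_const[OF _ E E, of a] va] a UE by auto
    have i2: "has_fderiv E E (fst E) (\<lambda>x. x) (v a) (\<lambda>h. h)"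
      using has_fderiv_bdd_lin[OF \<open>bdd_lin E E (\<lambda>h. h)\<close> E E va] .
    have "has_fderiv E F (fst E) (\<lambda>x. T (a, x)) (v a) (\<lambda>h. L (0, h))"
      by (rule has_fderiv_comp[OF has_fderiv_pair[OF ca i2 E] L _ E EE F]) (use a in auto)
    moreover have "has_fderiv E F (fst E) (\<lambda>x. T (a, x)) (v a) (\<lambda>x. T (a, x))"
      using has_fderiv_bdd_lin[OF has_fderiv_into(3)[OF twice_fdiff_deriv[OF f a]] E F va] .
    ultimately show ?thesis using has_fderiv_unique[OF _ _ E F nopen_carrier l] by blast
  qed
  have "L (h, K h) = L (h, 0) + T (a, K h)" if "h \<in> fst E" for h
  proof -
    have "L ((h, 0) + (0, K h)) = L (h, 0) + L (0, K h)"
      by (rule bdd_lin_simps(2)[OF has_fderiv_into(3)[OF L] EE]) (use that K nspace_closed(1)[OF E] in auto)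
    then show ?thesis using sl[OF K[OF that]] by simp
  qed
  then show ?thesis using has_fderiv_cong[OF refl _ E UE,
      of "\<lambda>h. L (h, K h)" "\<lambda>h. L (h, 0) + T (a, K h)" F "\<lambda>x. T (x, v x)" a] c by simp
qed

text \<open>Young's theorem. The second difference of \<open>f\<close> over the parallelogram spanned by \<open>t h\<close> and \<open>t k\<close> is
  symmetric in \<open>h\<close> and \<open>k\<close>. By the mean value theorem in the direction \<open>h\<close> and the differentiability of
  \<open>T (\<cdot>, h)\<close> at \<open>a\<close>, it equals \<open>t\<^sup>2 L (k, 0)\<close> up to \<open>o(t\<^sup>2)\<close>.\<close>

lemma second_deriv_symmetric:
  fixes f :: "'v::real_vector \<Rightarrow> real"
  assumes f: "twice_fdiff E type_nspace (fst E) f T" and E: "normed_nspace E" and a: "a \<in> fst E"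
    and h: "h \<in> fst E" and k: "k \<in> fst E"
    and L: "has_fderiv (nprod E E) type_nspace (fst E \<times> fst E) T (a, h) L"
    and K: "has_fderiv (nprod E E) type_nspace (fst E \<times> fst E) T (a, k) K"
  shows "L (k, 0) = K (h, 0)"
proof -
  note cE = nspace_closed[OF E]
  define D where "D t = f (a + t *\<^sub>R h + t *\<^sub>R k) - f (a + t *\<^sub>R h) - f (a + t *\<^sub>R k) + f a" for t
  have key: "\<exists>d>0. \<forall>t. 0 < t \<and> t < d \<longrightarrow>
      \<bar>(f (a + t *\<^sub>R h + t *\<^sub>R k) - f (a + t *\<^sub>R h) - f (a + t *\<^sub>R k) + f a) - t\<^sup>2 * L (k, 0)\<bar> \<le> e * t\<^sup>2"
    if e: "e > 0" and h: "h \<in> fst E" and k: "k \<in> fst E"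
      and L: "has_fderiv (nprod E E) type_nspace (fst E \<times> fst E) T (a, h) L" for e h k L
  proof -
    \<comment> \<open>The increments \<open>r h + t k\<close> and \<open>r h\<close> with \<open>r \<le> t\<close> have norms with sum at most \<open>t s\<close>.\<close>
    define s where "s = 2 * snd E h + snd E k + 1"
    have hn: "0 \<le> snd E h" "0 \<le> snd E k" using nspace_norm_nonneg[OF E] h k by auto
    then have s: "s > 0" by (simp add: s_def)
    have e': "e / (2 * s) > 0" using e s by simp
    obtain d where d: "d > 0" "\<And>y. y \<in> fst E \<times> fst E \<Longrightarrow> snd (nprod E E) (y - (a, h)) < d \<Longrightarrow>
        \<bar>T y - T (a, h) - L (y - (a, h))\<bar> \<le> e / (2 * s) * snd (nprod E E) (y - (a, h))"
      using has_fderiv_estimate[OF L e'] by auto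
    have est: "\<bar>T (a + v, h) - T (a, h) - L (v, 0)\<bar> \<le> e / (2 * s) * snd E v"
      if "v \<in> fst E" "snd E v < d" for v
      using d(2)[of "(a + v, h)"] that cE(2)[OF a] h nspace_norm_zero[OF E] by simp
    note Ls = bdd_lin_simps[OF has_fderiv_into(3)[OF L] nspace_nprod[OF E E]]
    show ?thesis
    proof (intro exI[of _ "d / s"] conjI allI impI)
      show "0 < d / s" using d s by simp
      fix t assume t: "0 < t \<and> t < d / s"
      then have ts: "t * s < d" using s by (simp add: field_simps)
      define \<phi> where "\<phi> r = f (a + r *\<^sub>R h + t *\<^sub>R k) - f (a + r *\<^sub>R h)" for r
      have line: "((\<lambda>r. f (b + r *\<^sub>R h)) has_real_derivative T (b + r *\<^sub>R h, h)) (at r)"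
        if b: "b \<in> fst E" for b r
      proof -
        have r: "b + r *\<^sub>R h \<in> fst E" for r using b h cE by auto
        have "has_fderiv type_nspace E UNIV (\<lambda>r. b + r *\<^sub>R h) r (\<lambda>x. x *\<^sub>R h)"
        proof -
          have "bdd_lin type_nspace E (\<lambda>x. x *\<^sub>R h)"
            by (rule bdd_linI[where C = "snd E h"])
              (use h cE nspace_norm(2)[OF E h] in \<open>auto simp: scaleR_add_left\<close>)
          moreover have "b + y *\<^sub>R h - (b + r *\<^sub>R h) - (y - r) *\<^sub>R h = 0" for y
            by (simp add: algebra_simps)
          ultimately show ?thesis unfolding has_fderiv_def
            using r nspace_norm_zero[OF E] by (auto intro: exI[of _ 1])
        qed
        from has_fderiv_comp[OF this twice_fdiff_deriv[OF f r] _ nspace_type E nspace_type]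
        have "has_fderiv type_nspace type_nspace UNIV (\<lambda>r. f (b + r *\<^sub>R h)) r (\<lambda>x. T (b + r *\<^sub>R h, x *\<^sub>R h))"
          using r by auto
        then have "((\<lambda>r. f (b + r *\<^sub>R h)) has_derivative (\<lambda>x. T (b + r *\<^sub>R h, x *\<^sub>R h))) (at r)"
          using has_fderiv_type[of UNIV] by auto
        moreover have "T (b + r *\<^sub>R h, x *\<^sub>R h) = T (b + r *\<^sub>R h, h) * x" for x
          using bdd_lin_simps(3)[OF has_fderiv_into(3)[OF twice_fdiff_deriv[OF f r]] E h] by simp
        ultimately show ?thesis unfolding has_field_derivative_def by simp
      qed
      have phi: "(\<phi> has_real_derivative (T (a + r *\<^sub>R h + t *\<^sub>R k, h) - T (a + r *\<^sub>R h, h))) (at r)" for r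
        using DERIV_diff[OF line[OF cE(2)[OF a cE(4)[OF k, of t]], of r] line[OF a, of r]]
        unfolding \<phi>_def by (simp add: add_ac)
      then obtain r where r: "0 < r" "r < t"
        "\<phi> t - \<phi> 0 = (t - 0) * (T (a + r *\<^sub>R h + t *\<^sub>R k, h) - T (a + r *\<^sub>R h, h))"
        using MVT2[of 0 t \<phi>, OF _ phi] t by auto
      define v where "v = r *\<^sub>R h + t *\<^sub>R k"
      have v: "v \<in> fst E" "r *\<^sub>R h \<in> fst E" "t *\<^sub>R k \<in> fst E" using h k cE by (auto simp: v_def)
      have nv: "snd E v \<le> r * snd E h + t * snd E k"
        using nspace_norm(1)[OF E v(2,3)] nspace_norm(2)[OF E h] nspace_norm(2)[OF E k] r t by (simp add: v_def)
      have nr: "snd E (r *\<^sub>R h) = r * snd E h" using nspace_norm(2)[OF E h] r by simp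
      have rt: "r * snd E h \<le> t * snd E h" using r hn by (intro mult_right_mono) auto
      have sum: "snd E v + snd E (r *\<^sub>R h) \<le> t * s"
        using nv nr rt t by (simp add: s_def algebra_simps)
      have "snd E v < d" "snd E (r *\<^sub>R h) < d"
        using sum ts nspace_norm_nonneg[OF E v(1)] nspace_norm_nonneg[OF E v(2)] by auto
      note e1 = est[OF v(1) this(1)] and e2 = est[OF v(2) this(2)]
      have "L (v, 0) - L (r *\<^sub>R h, 0) = L (t *\<^sub>R k, 0)"
        using Ls(2)[of "(r *\<^sub>R h, 0)" "(t *\<^sub>R k, 0)"] v cE(1) by (simp add: v_def)
      also have "\<dots> = t * L (k, 0)" using Ls(3)[of "(k, 0)" t] k cE(1) by simp
      finally have "\<bar>(T (a + v, h) - T (a + r *\<^sub>R h, h)) - t * L (k, 0)\<bar> \<le>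
          e / (2 * s) * snd E v + e / (2 * s) * snd E (r *\<^sub>R h)"
        using e1 e2 by linarith
      also have "\<dots> \<le> e / (2 * s) * (t * s)"
        using mult_left_mono[OF sum, of "e / (2 * s)"] e' by (simp add: distrib_left)
      also have "\<dots> \<le> e * t" using s e t by simp
      finally have m: "\<bar>(T (a + v, h) - T (a + r *\<^sub>R h, h)) - t * L (k, 0)\<bar> \<le> e * t" .
      have eq: "(f (a + t *\<^sub>R h + t *\<^sub>R k) - f (a + t *\<^sub>R h) - f (a + t *\<^sub>R k) + f a) - t\<^sup>2 * L (k, 0) =
          t * ((T (a + v, h) - T (a + r *\<^sub>R h, h)) - t * L (k, 0))"
        using r(3) by (simp add: \<phi>_def v_def algebra_simps power2_eq_square)
      show "\<bar>(f (a + t *\<^sub>R h + t *\<^sub>R k) - f (a + t *\<^sub>R h) - f (a + t *\<^sub>R k) + f a) - t\<^sup>2 * L (k, 0)\<bar> \<le> e * t\<^sup>2"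
        unfolding eq abs_mult using mult_left_mono[OF m, of t] t
        by (simp add: power2_eq_square mult_ac)
    qed
  qed
  have "\<bar>L (k, 0) - K (h, 0)\<bar> \<le> 2 * e" if e: "e > 0" for e
  proof -
    obtain d1 d2 where d: "d1 > 0" "d2 > 0" "\<forall>t. 0 < t \<and> t < d1 \<longrightarrow> \<bar>D t - t\<^sup>2 * L (k, 0)\<bar> \<le> e * t\<^sup>2"
      "\<forall>t. 0 < t \<and> t < d2 \<longrightarrow> \<bar>(f (a + t *\<^sub>R k + t *\<^sub>R h) - f (a + t *\<^sub>R k) - f (a + t *\<^sub>R h) + f a) - t\<^sup>2 * K (h, 0)\<bar> \<le> e * t\<^sup>2"
      using key[OF e h k L] key[OF e k h K] unfolding D_def by blast
    define t where "t = min d1 d2 / 2"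
    have t: "0 < t" "t < d1" "t < d2" using d(1,2) by (auto simp: t_def)
    have "f (a + t *\<^sub>R k + t *\<^sub>R h) - f (a + t *\<^sub>R k) - f (a + t *\<^sub>R h) + f a = D t"
      by (simp add: D_def add_ac)
    then have "\<bar>D t - t\<^sup>2 * L (k, 0)\<bar> \<le> e * t\<^sup>2" "\<bar>D t - t\<^sup>2 * K (h, 0)\<bar> \<le> e * t\<^sup>2"
      using d(3,4) t by auto
    then have "\<bar>t\<^sup>2 * L (k, 0) - t\<^sup>2 * K (h, 0)\<bar> \<le> 2 * e * t\<^sup>2" by linarith
    then have "t\<^sup>2 * \<bar>L (k, 0) - K (h, 0)\<bar> \<le> t\<^sup>2 * (2 * e)"
      by (simp add: abs_mult flip: right_diff_distrib) (simp add: mult.commute)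
    then show ?thesis using t by simp
  qed
  from this[of "\<bar>L (k, 0) - K (h, 0)\<bar> / 4"] show ?thesis by fastforce
qed

section \<open>Spaces of multilinear maps\<close>

lemma mlin_simps [simp]: "fst (mlin i E F) = mlin_set i E F" "snd (mlin i E F) = mlin_norm i E F"
  by (simp_all add: mlin_def)

lemma mlin_setD:
  assumes "m \<in> mlin_set i E F"
  shows "\<And>hs. hs \<notin> args E i \<Longrightarrow> m hs = 0" "\<And>hs. hs \<in> args E i \<Longrightarrow> m hs \<in> fst F"
    "\<And>hs j g h. hs \<in> args E i \<Longrightarrow> j < i \<Longrightarrow> g \<in> fst E \<Longrightarrow> h \<in> fst E \<Longrightarrow>
      m (hs[j := g + h]) = m (hs[j := g]) + m (hs[j := h])"
    "\<And>hs j c h. hs \<in> args E i \<Longrightarrow> j < i \<Longrightarrow> h \<in> fst E \<Longrightarrow> m (hs[j := c *\<^sub>R h]) = c *\<^sub>R m (hs[j := h])"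
    "\<exists>C. \<forall>hs\<in>args E i. snd F (m hs) \<le> C * prod_list (map (snd E) hs)"
  using assms unfolding mlin_set_def mem_Collect_eq by blast+

lemma mlin_setI:
  assumes "\<And>hs. hs \<notin> args E i \<Longrightarrow> m hs = 0" "\<And>hs. hs \<in> args E i \<Longrightarrow> m hs \<in> fst F"
    "\<And>hs j g h. hs \<in> args E i \<Longrightarrow> j < i \<Longrightarrow> g \<in> fst E \<Longrightarrow> h \<in> fst E \<Longrightarrow>
      m (hs[j := g + h]) = m (hs[j := g]) + m (hs[j := h])"
    "\<And>hs j c h. hs \<in> args E i \<Longrightarrow> j < i \<Longrightarrow> h \<in> fst E \<Longrightarrow> m (hs[j := c *\<^sub>R h]) = c *\<^sub>R m (hs[j := h])"
    "\<And>hs. hs \<in> args E i \<Longrightarrow> snd F (m hs) \<le> C * prod_list (map (snd E) hs)"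
  shows "m \<in> mlin_set i E F"
  using assms unfolding mlin_set_def mem_Collect_eq by blast

lemma prod_list_norm_nonneg:
  assumes "normed_nspace E" "hs \<in> args E i"
  shows "0 \<le> prod_list (map (snd E) hs)"
  using assms nspace_norm_nonneg[OF assms(1)] by (intro prod_list_nonneg) (auto simp: args_def)

lemma mlin_scale_args:
  assumes m: "m \<in> mlin_set i E F" and E: "normed_nspace E" and hs: "hs \<in> args E i" and "n \<le> i"
  shows "m (map (\<lambda>h. c h *\<^sub>R h) (take n hs) @ drop n hs) = prod_list (map c (take n hs)) *\<^sub>R m hs"
  using \<open>n \<le> i\<close>
proof (induction n)
  case (Suc n)
  have len: "length hs = i" and hsE: "set hs \<subseteq> fst E" using hs by (auto simp: args_def)
  define xs where "xs = map (\<lambda>h. c h *\<^sub>R h) (take n hs) @ drop n hs"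
  have n: "n < length hs" using Suc len by simp
  have xs: "xs \<in> args E i"
    using len hsE Suc nspace_closed(4)[OF E] set_take_subset[of n hs] set_drop_subset[of n hs]
    by (auto simp: xs_def args_def)
  have "xs ! n = hs ! n" using n by (simp add: xs_def nth_append)
  then have up: "xs[n := hs ! n] = xs" by (metis list_update_id)
  have "map (\<lambda>h. c h *\<^sub>R h) (take (Suc n) hs) @ drop (Suc n) hs = xs[n := c (hs ! n) *\<^sub>R (hs ! n)]"
    using n by (simp add: xs_def take_Suc_conv_app_nth list_update_append Cons_nth_drop_Suc[symmetric])
  then have "m (map (\<lambda>h. c h *\<^sub>R h) (take (Suc n) hs) @ drop (Suc n) hs) = c (hs ! n) *\<^sub>R m xs"
    using mlin_setD(4)[OF m xs, of n "hs ! n" "c (hs ! n)"] up n len subsetD[OF hsE nth_mem[OF n]] by auto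
  also have "\<dots> = prod_list (map c (take (Suc n) hs)) *\<^sub>R m hs"
    using Suc n by (simp add: xs_def take_Suc_conv_app_nth mult.commute)
  finally show ?case .
qed simp

text \<open>By homogeneity in each slot a bound on unit vectors extends to all arguments; a vector of norm 0 is
  0 and makes both sides vanish.\<close>

lemma mlin_unit_bound:
  assumes m: "m \<in> mlin_set i E F" and E: "normed_nspace E" and F: "normed_nspace F"
    and K: "\<And>hs. hs \<in> args E i \<Longrightarrow> \<forall>h\<in>set hs. snd E h \<le> 1 \<Longrightarrow> snd F (m hs) \<le> K"
    and hs: "hs \<in> args E i"
  shows "snd F (m hs) \<le> K * prod_list (map (snd E) hs)"
proof (cases "\<exists>h\<in>set hs. snd E h = 0")
  case True
  then obtain h where h: "h \<in> set hs" "snd E h = 0" by blast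
  then have "h = 0" using nspace_norm(3)[OF E] hs by (auto simp: args_def)
  then obtain j where j: "j < length hs" "hs ! j = 0" using h by (auto simp: in_set_conv_nth)
  then have "m (hs[j := 0 *\<^sub>R 0]) = 0 *\<^sub>R m (hs[j := 0])"
    using mlin_setD(4)[OF m hs, of j 0 0] nspace_closed(1)[OF E] hs by (auto simp: args_def)
  then have "m hs = 0" using j by (metis list_update_id scale_zero_left)
  moreover have "prod_list (map (snd E) hs) = 0" using h by (force simp: prod_list_zero_iff)
  ultimately show ?thesis using F by simp
next
  case False
  have len: "length hs = i" and hsE: "set hs \<subseteq> fst E" using hs by (auto simp: args_def)
  have pos: "snd E h > 0" if "h \<in> set hs" for h
    using False that nspace_norm_nonneg[OF E, of h] hsE by (metis less_eq_real_def subsetD)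
  define c where "c h = 1 / snd E h" for h
  let ?hs = "map (\<lambda>h. c h *\<^sub>R h) hs"
  have un: "snd E (c h *\<^sub>R h) \<le> 1" if "h \<in> set hs" for h
    using pos[OF that] nspace_norm(2)[OF E, of h "c h"] that hsE by (auto simp: c_def)
  have "?hs \<in> args E i" using len hsE nspace_closed(4)[OF E] by (auto simp: args_def)
  then have "snd F (m ?hs) \<le> K" using K un by auto
  moreover have "m ?hs = prod_list (map c hs) *\<^sub>R m hs"
    using mlin_scale_args[OF m E hs order_refl, of c] len by simp
  moreover have cpos: "prod_list (map c hs) * prod_list (map (snd E) hs) = 1"
    using pos by (induction hs) (force simp: c_def field_simps)+
  moreover have p: "0 < prod_list (map (snd E) hs)"
    using pos by (induction hs) auto
  ultimately have "prod_list (map c hs) * snd F (m hs) \<le> K"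
    using nspace_norm(2)[OF F mlin_setD(2)[OF m hs], of "prod_list (map c hs)"]
    by (metis abs_of_nonneg less_eq_real_def zero_less_mult_pos2 zero_less_one)
  then have "prod_list (map (snd E) hs) * (prod_list (map c hs) * snd F (m hs)) \<le> prod_list (map (snd E) hs) * K"
    using p by (intro mult_left_mono) auto
  also have "prod_list (map (snd E) hs) * (prod_list (map c hs) * snd F (m hs)) = 
      (prod_list (map c hs) * prod_list (map (snd E) hs)) * snd F (m hs)" by (simp add: mult_ac)
  finally show ?thesis using cpos by (simp add: mult.commute)
qed

lemma mlin_norm_bdd:
  assumes m: "m \<in> mlin_set i E F" and E: "normed_nspace E"
  shows "bdd_above {snd F (m hs) | hs. hs \<in> args E i \<and> (\<forall>h\<in>set hs. snd E h \<le> 1)}"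
proof -
  obtain C where C: "\<forall>hs\<in>args E i. snd F (m hs) \<le> C * prod_list (map (snd E) hs)"
    using mlin_setD(5)[OF m] by blast
  have "snd F (m hs) \<le> \<bar>C\<bar>" if hs: "hs \<in> args E i" "\<forall>h\<in>set hs. snd E h \<le> 1" for hs
  proof -
    have nn: "0 \<le> snd E h" if "h \<in> set hs" for h using nspace_norm_nonneg[OF E] that hs by (auto simp: args_def)
    have le1: "prod_list (map (snd E) hs) \<le> 1"
      using hs(2) nn by (induction hs) (auto intro!: mult_le_one prod_list_nonneg)
    have "C * prod_list (map (snd E) hs) \<le> \<bar>C\<bar> * 1"
      by (intro mult_mono) (use le1 prod_list_norm_nonneg[OF E hs(1)] in auto)
    then show ?thesis using C hs by force
  qed
  then show ?thesis by (auto intro!: bdd_aboveI[where M = "\<bar>C\<bar>"])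
qed

lemma mlin_bound:
  assumes m: "m \<in> mlin_set i E F" and E: "normed_nspace E" and F: "normed_nspace F"
    and hs: "hs \<in> args E i"
  shows "snd F (m hs) \<le> mlin_norm i E F m * prod_list (map (snd E) hs)"
  by (rule mlin_unit_bound[OF m E F _ hs], unfold mlin_norm_def)
    (auto intro!: cSup_upper mlin_norm_bdd[OF m E])

lemma mlin_norm_le:
  assumes "normed_nspace E" "0 \<le> K"
    and K: "\<And>hs. hs \<in> args E i \<Longrightarrow> snd F (m hs) \<le> K * prod_list (map (snd E) hs)"
  shows "mlin_norm i E F m \<le> K"
  unfolding mlin_norm_def
proof (rule cSup_least)
  have "replicate i 0 \<in> args E i" "\<forall>h\<in>set (replicate i 0). snd E h \<le> 1"
    using nspace_closed(1)[OF assms(1)] assms(1) by (auto simp: args_def)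
  then show "{snd F (m hs) | hs. hs \<in> args E i \<and> (\<forall>h\<in>set hs. snd E h \<le> 1)} \<noteq> {}" by blast
next
  fix x assume "x \<in> {snd F (m hs) | hs. hs \<in> args E i \<and> (\<forall>h\<in>set hs. snd E h \<le> 1)}"
  then obtain hs where hs: "x = snd F (m hs)" "hs \<in> args E i" "\<forall>h\<in>set hs. snd E h \<le> 1" by blast
  have nn: "0 \<le> snd E h" if "h \<in> set hs" for h using nspace_norm_nonneg[OF assms(1)] that hs by (auto simp: args_def)
  have le1: "prod_list (map (snd E) hs) \<le> 1"
    using hs(3) nn by (induction hs) (auto intro!: mult_le_one prod_list_nonneg)
  show "x \<le> K" using K[OF hs(2)] mult_left_mono[OF le1 assms(2)] hs(1) by simp
qed

lemma mlin_norm_nonneg: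
  assumes m: "m \<in> mlin_set i E F" and E: "normed_nspace E" and F: "normed_nspace F"
  shows "0 \<le> mlin_norm i E F m"
proof -
  let ?z = "replicate i 0 :: 'a list"
  have z: "?z \<in> args E i" "\<forall>h\<in>set ?z. snd E h \<le> 1"
    using nspace_closed(1)[OF E] E by (auto simp: args_def)
  have "0 \<le> snd F (m ?z)" using nspace_norm_nonneg[OF F mlin_setD(2)[OF m z(1)]] .
  also have "\<dots> \<le> mlin_norm i E F m"
    unfolding mlin_norm_def using z by (intro cSup_upper mlin_norm_bdd[OF m E]) blast
  finally show ?thesis .
qed

lemma nspace_mlin:
  assumes E: "normed_nspace E" and F: "normed_nspace F"
  shows "normed_nspace (mlin i E F)"
proof -
  note cF = nspace_closed[OF F]
  have add: "m + m' \<in> mlin_set i E F" and tri: "mlin_norm i E F (m + m') \<le> mlin_norm i E F m + mlin_norm i E F m'"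
    if m: "m \<in> mlin_set i E F" and m': "m' \<in> mlin_set i E F" for m m'
  proof -
    let ?C = "mlin_norm i E F m + mlin_norm i E F m'"
    have b: "snd F ((m + m') hs) \<le> ?C * prod_list (map (snd E) hs)" if hs: "hs \<in> args E i" for hs
      using nspace_norm(1)[OF F mlin_setD(2)[OF m hs] mlin_setD(2)[OF m' hs]]
        mlin_bound[OF m E F hs] mlin_bound[OF m' E F hs] by (simp add: distrib_right)
    show "m + m' \<in> mlin_set i E F"
      by (rule mlin_setI[where C = ?C])
        (use b in \<open>simp_all add: cF mlin_setD[OF m] mlin_setD[OF m'] scaleR_add_right\<close>)
    show "mlin_norm i E F (m + m') \<le> ?C"
      by (rule mlin_norm_le[OF E _ b]) (use mlin_norm_nonneg[OF m E F] mlin_norm_nonneg[OF m' E F] in simp_all)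
  qed
  have hom: "c *\<^sub>R m \<in> mlin_set i E F" and hom_norm: "mlin_norm i E F (c *\<^sub>R m) \<le> \<bar>c\<bar> * mlin_norm i E F m"
    if m: "m \<in> mlin_set i E F" for m c
  proof -
    let ?C = "\<bar>c\<bar> * mlin_norm i E F m"
    have b: "snd F ((c *\<^sub>R m) hs) \<le> ?C * prod_list (map (snd E) hs)" if hs: "hs \<in> args E i" for hs
      using nspace_norm(2)[OF F mlin_setD(2)[OF m hs]] mult_left_mono[OF mlin_bound[OF m E F hs], of "\<bar>c\<bar>"]
      by (simp add: scaleR_fun_def mult.assoc)
    show "c *\<^sub>R m \<in> mlin_set i E F"
      by (rule mlin_setI[where C = ?C])
        (use b in \<open>simp_all add: scaleR_fun_def cF mlin_setD[OF m] scaleR_add_right\<close>)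
    show "mlin_norm i E F (c *\<^sub>R m) \<le> ?C"
      using mlin_norm_le[OF E _ b] mlin_norm_nonneg[OF m E F] by simp
  qed
  have z: "0 \<in> mlin_set i E F"
    by (rule mlin_setI[where C = 0]) (use cF(1) F in auto)
  have def: "m = 0" if m: "m \<in> mlin_set i E F" and n: "mlin_norm i E F m = 0" for m
  proof
    fix hs
    show "m hs = 0 hs"
    proof (cases "hs \<in> args E i")
      case True
      then have "snd F (m hs) = 0"
        using mlin_bound[OF m E F True] n nspace_norm_nonneg[OF F mlin_setD(2)[OF m True]] by simp
      then show ?thesis using nspace_norm(3)[OF F mlin_setD(2)[OF m True]] by simp
    qed (simp add: mlin_setD[OF m])
  qed
  show ?thesis
    by (rule normed_nspaceI) (use add tri hom hom_norm z def in \<open>simp_all add: subspace_def\<close>)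
qed

lemma bdd_lin_to_mlin0:
  assumes "normed_nspace E" "normed_nspace F"
  shows "bdd_lin F (mlin 0 E F) (\<lambda>v hs. if hs = [] then v else 0)"
proof (rule bdd_linI[where C = 1])
  fix v assume v: "v \<in> fst F"
  show "(\<lambda>hs. if hs = [] then v else 0) \<in> fst (mlin 0 E F)"
    unfolding mlin_simps by (rule mlin_setI[where C = "snd F v"]) (use v in \<open>auto simp: args_def\<close>)
  show "snd (mlin 0 E F) (\<lambda>hs. if hs = [] then v else 0) \<le> 1 * snd F v"
    unfolding mlin_simps by (rule mlin_norm_le[OF assms(1)])
      (use v nspace_norm_nonneg[OF assms(2)] in \<open>auto simp: args_def\<close>)
qed (auto simp: fun_eq_iff scaleR_fun_def)

lemma bdd_lin_from_mlin0:
  assumes "normed_nspace E" "normed_nspace F"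
  shows "bdd_lin (mlin 0 E F) F (\<lambda>m. m [])"
proof (rule bdd_linI[where C = 1])
  fix m assume m: "m \<in> fst (mlin 0 E F)"
  then show "m [] \<in> fst F" using mlin_setD(2)[of m 0 E F "[]"] by (simp add: args_def)
  show "snd F (m []) \<le> 1 * snd (mlin 0 E F) m"
    using mlin_bound[of m 0 E F "[]"] m assms by (simp add: args_def)
qed (auto simp: scaleR_fun_def)

text \<open>The identification of \<open>L(E; L(E\<^sup>i; F))\<close> with \<open>L(E\<^sup>i\<^sup>+\<^sup>1; F)\<close> by which \<open>nth_fderiv\<close> is built.\<close>

definition uncurry_mlin :: "'v nspace \<Rightarrow> ('v \<Rightarrow> 'v list \<Rightarrow> 'w::zero) \<Rightarrow> 'v list \<Rightarrow> 'w" where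
  "uncurry_mlin E L = (\<lambda>hs. case hs of [] \<Rightarrow> 0 | h # hs' \<Rightarrow> if h \<in> fst E then L h hs' else 0)"

lemma args_Suc: "hs \<in> args E (Suc i) \<longleftrightarrow> (\<exists>h hs'. hs = h # hs' \<and> h \<in> fst E \<and> hs' \<in> args E i)"
  by (cases hs) (auto simp: args_def)

lemma uncurry_mlin_in_mlin_set:
  assumes L: "bdd_lin E (mlin i E F) L" and E: "normed_nspace E" and F: "normed_nspace F"
  shows "uncurry_mlin E L \<in> mlin_set (Suc i) E F"
proof -
  note Ls = bdd_lin_simps[OF L E, unfolded mlin_simps]
  obtain C where C: "C > 0" "\<And>h. h \<in> fst E \<Longrightarrow> mlin_norm i E F (L h) \<le> C * snd E h"
    using bdd_lin_bound[OF L E] by auto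
  show ?thesis
  proof (rule mlin_setI[where C = C])
    show "uncurry_mlin E L hs = 0" if "hs \<notin> args E (Suc i)" for hs
      using that mlin_setD(1)[OF Ls(1)] by (auto simp: uncurry_mlin_def args_Suc split: list.splits)
    fix hs assume hs: "hs \<in> args E (Suc i)"
    then obtain h hs' where h: "hs = h # hs'" "h \<in> fst E" "hs' \<in> args E i" by (auto simp: args_Suc)
    show "uncurry_mlin E L hs \<in> fst F" using mlin_setD(2)[OF Ls(1)] h by (simp add: uncurry_mlin_def)
    have "snd F (L h hs') \<le> mlin_norm i E F (L h) * prod_list (map (snd E) hs')"
      by (rule mlin_bound[OF Ls(1)[OF h(2)] E F h(3)])
    also have "\<dots> \<le> C * snd E h * prod_list (map (snd E) hs')"
      by (intro mult_right_mono C h prod_list_norm_nonneg[OF E h(3)])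
    finally show "snd F (uncurry_mlin E L hs) \<le> C * prod_list (map (snd E) hs)"
      using h by (simp add: uncurry_mlin_def mult.assoc)
    fix j assume j: "j < Suc i"
    show "uncurry_mlin E L (hs[j := c *\<^sub>R x]) = c *\<^sub>R uncurry_mlin E L (hs[j := x])" if "x \<in> fst E" for c x
      using h j that Ls(3)[OF that] mlin_setD(4)[OF Ls(1)[OF h(2)] h(3)] nspace_closed(4)[OF E that]
      by (cases j) (auto simp: uncurry_mlin_def scaleR_fun_def)
    show "uncurry_mlin E L (hs[j := g + x]) = uncurry_mlin E L (hs[j := g]) + uncurry_mlin E L (hs[j := x])"
      if "g \<in> fst E" "x \<in> fst E" for g x
      using h j that Ls(2)[OF that] mlin_setD(3)[OF Ls(1)[OF h(2)] h(3)] nspace_closed(2)[OF E that]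
      by (cases j) (auto simp: uncurry_mlin_def)
  qed
qed

lemma cont_comp:
  assumes "cont_on_nspace E F U f" "cont_on_nspace F H V g" "\<And>x. x \<in> U \<Longrightarrow> f x \<in> V"
  shows "cont_on_nspace E H U (\<lambda>x. g (f x))"
  unfolding cont_on_nspace_def
proof (intro ballI allI impI)
  fix x and e :: real assume x: "x \<in> U" and e: "e > 0"
  obtain d1 where d1: "d1 > 0" "\<And>y. y \<in> V \<Longrightarrow> snd F (y - f x) < d1 \<Longrightarrow> snd H (g y - g (f x)) < e"
    using assms(2) assms(3)[OF x] e unfolding cont_on_nspace_def by blast
  obtain d2 where d2: "d2 > 0" "\<And>y. y \<in> U \<Longrightarrow> snd E (y - x) < d2 \<Longrightarrow> snd F (f y - f x) < d1"
    using assms(1) x d1(1) unfolding cont_on_nspace_def by blast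
  show "\<exists>d>0. \<forall>y\<in>U. snd E (y - x) < d \<longrightarrow> snd H (g (f y) - g (f x)) < e"
    using d1 d2 assms(3) by blast
qed

lemma cont_pair:
  assumes "cont_on_nspace E F U f" "cont_on_nspace E H U g"
  shows "cont_on_nspace E (nprod F H) U (\<lambda>x. (f x, g x))"
  unfolding cont_on_nspace_def
proof (intro ballI allI impI)
  fix x and e :: real assume x: "x \<in> U" and "e > 0"
  then have e: "e / 2 > 0" by simp
  obtain d1 where d1: "d1 > 0" "\<And>y. y \<in> U \<Longrightarrow> snd E (y - x) < d1 \<Longrightarrow> snd F (f y - f x) < e / 2"
    using assms(1) x e unfolding cont_on_nspace_def by blast
  obtain d2 where d2: "d2 > 0" "\<And>y. y \<in> U \<Longrightarrow> snd E (y - x) < d2 \<Longrightarrow> snd H (g y - g x) < e / 2"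
    using assms(2) x e unfolding cont_on_nspace_def by blast
  have "snd (nprod F H) ((f y, g y) - (f x, g x)) < e" if "y \<in> U" "snd E (y - x) < min d1 d2" for y
    using d1(2)[of y] d2(2)[of y] that by auto
  then show "\<exists>d>0. \<forall>y\<in>U. snd E (y - x) < d \<longrightarrow> snd (nprod F H) ((f y, g y) - (f x, g x)) < e"
    using d1(1) d2(1) by (intro exI[of _ "min d1 d2"]) auto
qed

lemma cont_of_has_fderiv:
  assumes f: "\<And>x. x \<in> U \<Longrightarrow> has_fderiv E F U f x (L x)"
    and E: "normed_nspace E" and F: "normed_nspace F" and U: "U \<subseteq> fst E"
  shows "cont_on_nspace E F U f"
  unfolding cont_on_nspace_def
proof (intro ballI allI impI)
  fix x and e :: real assume x: "x \<in> U" and e: "e > 0"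
  obtain C d where C: "C > 0" "d > 0"
    "\<And>y. y \<in> U \<Longrightarrow> snd E (y - x) < d \<Longrightarrow> snd F (f y - f x) \<le> C * snd E (y - x)"
    using has_fderiv_lipschitz[OF f[OF x] E F U] by blast
  have "snd F (f y - f x) < e" if "y \<in> U" "snd E (y - x) < min d (e / C)" for y
  proof -
    have "C * snd E (y - x) < e" using that C(1) by (simp add: field_simps)
    then show ?thesis using C(3)[of y] that by auto
  qed
  then show "\<exists>d>0. \<forall>y\<in>U. snd E (y - x) < d \<longrightarrow> snd F (f y - f x) < e"
    using C e by (intro exI[of _ "min d (e / C)"]) auto
qed

lemma cont_bilin:
  assumes f: "cont_on_nspace E F U f" "\<And>x. x \<in> U \<Longrightarrow> f x \<in> fst F"
    and g: "cont_on_nspace E H U g" "\<And>x. x \<in> U \<Longrightarrow> g x \<in> fst H"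
    and b: "bdd_bilin F H I b" and F: "normed_nspace F" and H: "normed_nspace H" and I: "normed_nspace I"
  shows "cont_on_nspace E I U (\<lambda>x. b (f x, g x))"
  by (rule cont_comp[OF cont_pair[OF f(1) g(1)] cont_of_has_fderiv[OF has_fderiv_bilin[OF b F H I] nspace_nprod[OF F H] I]])
    (use f(2) g(2) in auto)

lemma cont_linear_comp:
  assumes f: "cont_on_nspace E F U f" "\<And>x. x \<in> U \<Longrightarrow> f x \<in> fst F"
    and L: "bdd_lin F H L" and F: "normed_nspace F" and H: "normed_nspace H"
  shows "cont_on_nspace E H U (\<lambda>x. L (f x))"
  by (rule cont_comp[OF f(1) cont_of_has_fderiv[OF has_fderiv_bdd_lin[OF L F H] F H order_refl] f(2)])

lemma cont_add:
  assumes f: "cont_on_nspace E F U f" "\<And>x. x \<in> U \<Longrightarrow> f x \<in> fst F"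
    and g: "cont_on_nspace E F U g" "\<And>x. x \<in> U \<Longrightarrow> g x \<in> fst F" and F: "normed_nspace F"
  shows "cont_on_nspace E F U (\<lambda>x. f x + g x)"
  using cont_linear_comp[OF cont_pair[OF f(1) g(1)] _ bdd_lin_add_pair[OF F] nspace_nprod[OF F F] F]
    f(2) g(2) by simp

lemma cont_cong:
  assumes "\<And>x. x \<in> U \<Longrightarrow> f x = g x"
  shows "cont_on_nspace E F U f \<longleftrightarrow> cont_on_nspace E F U g"
  unfolding cont_on_nspace_def using assms by (simp cong: ball_cong)

section \<open>Tensor fields\<close>

abbreviation tens :: "nat \<Rightarrow> ('a::real_normed_vector list \<Rightarrow> real) nspace" where
  "tens j \<equiv> mlin j type_nspace type_nspace"

abbreviation tens_norm :: "nat \<Rightarrow> ('a::real_normed_vector list \<Rightarrow> real) \<Rightarrow> real" where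
  "tens_norm j \<equiv> mlin_norm j type_nspace type_nspace"

abbreviation tens_set :: "nat \<Rightarrow> ('a::real_normed_vector list \<Rightarrow> real) set" where
  "tens_set j \<equiv> mlin_set j type_nspace type_nspace"

lemma nspace_tens: "normed_nspace (tens j :: ('a::real_normed_vector list \<Rightarrow> real) nspace)"
  by (intro nspace_mlin nspace_type)

lemma args_type [simp]: "hs \<in> args type_nspace j \<longleftrightarrow> length hs = j"
  by (simp add: args_def)

text \<open>Differentiating a tensor field adds a slot in front, so tensor fields of all ranks share one type
  and are closed under differentiation. This makes inductions over the order of differentiability
  possible.\<close>

definition has_tderiv :: "'a::real_normed_vector set \<Rightarrow> nat \<Rightarrow> ('a \<Rightarrow> 'a list \<Rightarrow> real) \<Rightarrow> ('a \<Rightarrow> 'a list \<Rightarrow> real) \<Rightarrow> bool" where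
  "has_tderiv B j T T' \<longleftrightarrow> (\<forall>x\<in>B. T' x \<in> tens_set (Suc j) \<and>
     has_fderiv type_nspace (tens j) B T x (\<lambda>h hs. T' x (h # hs)))"

definition tbound :: "'a::real_normed_vector set \<Rightarrow> nat \<Rightarrow> ('a \<Rightarrow> 'a list \<Rightarrow> real) \<Rightarrow> real \<Rightarrow> bool" where
  "tbound B j T C \<longleftrightarrow> cont_on_nspace type_nspace (tens j) B T \<and>
     (\<forall>x\<in>B. T x \<in> tens_set j \<and> (\<forall>hs. length hs = j \<longrightarrow> \<bar>T x hs\<bar> \<le> C * prod_list (map norm hs)))"

text \<open>A tensor field of class \<open>C\<^sup>k\<close> whose derivatives up to order \<open>k\<close> are all bounded by \<open>C\<close>. The best \<open>C\<close>
  for a scalar field is a norm equivalent to that of \<open>G\<close>.\<close>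

primrec Cb_field :: "'a::real_normed_vector set \<Rightarrow> nat \<Rightarrow> nat \<Rightarrow> ('a \<Rightarrow> 'a list \<Rightarrow> real) \<Rightarrow> real \<Rightarrow> bool" where
  "Cb_field B 0 j T C \<longleftrightarrow> tbound B j T C"
| "Cb_field B (Suc k) j T C \<longleftrightarrow> tbound B j T C \<and> (\<exists>T'. has_tderiv B j T T' \<and> Cb_field B k (Suc j) T' C)"

lemma Cb_field_tbound: "Cb_field B k j T C \<Longrightarrow> tbound B j T C"
  by (cases k) auto

lemma Cb_field_Suc_imp: "Cb_field B (Suc k) j T C \<Longrightarrow> Cb_field B k j T C"
  by (induction k arbitrary: j T) auto

lemma prod_list_norm_ge0: "0 \<le> prod_list (map norm hs)"
  by (induction hs) auto

lemma tbound_mono: "tbound B j T C \<Longrightarrow> C \<le> D \<Longrightarrow> tbound B j T D"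
  unfolding tbound_def using mult_right_mono[OF _ prod_list_norm_ge0] order_trans by meson

lemma Cb_field_mono: "Cb_field B k j T C \<Longrightarrow> C \<le> D \<Longrightarrow> Cb_field B k j T D"
  by (induction k arbitrary: j T) (auto intro: tbound_mono)

lemma tbound_cong: 
  assumes "\<And>x. x \<in> B \<Longrightarrow> T x = S x" shows "tbound B j T C \<longleftrightarrow> tbound B j S C"
proof -
  have "cont_on_nspace type_nspace (tens j) B T \<longleftrightarrow> cont_on_nspace type_nspace (tens j) B S"
    by (rule cont_cong[OF assms])
  then show ?thesis unfolding tbound_def using assms by simp
qed

lemma has_tderiv_cong: 
  assumes "\<And>x. x \<in> B \<Longrightarrow> T x = S x" shows "has_tderiv B j T T' \<longleftrightarrow> has_tderiv B j S T'"
proof -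
  have "has_fderiv type_nspace (tens j) B T x L \<longleftrightarrow> has_fderiv type_nspace (tens j) B S x L" for x L
    by (rule has_fderiv_cong[OF assms refl nspace_type]) auto
  then show ?thesis by (simp add: has_tderiv_def)
qed

lemma Cb_field_cong:
  assumes "\<And>x. x \<in> B \<Longrightarrow> T x = S x" shows "Cb_field B k j T C \<longleftrightarrow> Cb_field B k j S C"
  by (cases k) (auto simp: tbound_cong[OF assms] has_tderiv_cong[OF assms])

lemma tbound_add:
  assumes T: "tbound B j T C" and S: "tbound B j S D"
  shows "tbound B j (\<lambda>x. T x + S x) (C + D)"
  unfolding tbound_def
proof (intro conjI ballI allI impI)
  have TS: "\<And>x. x \<in> B \<Longrightarrow> T x \<in> fst (tens j)" "\<And>x. x \<in> B \<Longrightarrow> S x \<in> fst (tens j)"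
    using T S by (auto simp: tbound_def)
  show "cont_on_nspace type_nspace (tens j) B (\<lambda>x. T x + S x)"
    by (rule cont_add[OF _ TS(1) _ TS(2) nspace_tens]) (use T S in \<open>auto simp: tbound_def\<close>)
  fix x assume x: "x \<in> B"
  show "T x + S x \<in> tens_set j" using nspace_closed(2)[OF nspace_tens TS[OF x]] by simp
  fix hs :: "'a list" assume "length hs = j"
  then have "\<bar>T x hs\<bar> \<le> C * prod_list (map norm hs)" "\<bar>S x hs\<bar> \<le> D * prod_list (map norm hs)"
    using T S x by (auto simp: tbound_def)
  then show "\<bar>(T x + S x) hs\<bar> \<le> (C + D) * prod_list (map norm hs)" by (simp add: distrib_right)
qed

lemma Cb_field_add:
  assumes "Cb_field B k j T C" "Cb_field B k j S D"
  shows "Cb_field B k j (\<lambda>x. T x + S x) (C + D)"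
  using assms
proof (induction k arbitrary: j T S)
  case (Suc k)
  then obtain T' S' where T': "has_tderiv B j T T'" "Cb_field B k (Suc j) T' C"
    and S': "has_tderiv B j S S'" "Cb_field B k (Suc j) S' D" by auto
  have "has_tderiv B j (\<lambda>x. T x + S x) (\<lambda>x. T' x + S' x)"
    unfolding has_tderiv_def
  proof (intro ballI conjI)
    fix x assume x: "x \<in> B"
    show "T' x + S' x \<in> tens_set (Suc j)"
      using nspace_closed(2)[OF nspace_tens[of "Suc j"], of "T' x" "S' x"] T' S' x by (simp add: has_tderiv_def)
    have "has_fderiv type_nspace (tens j) B (\<lambda>x. T x + S x) x (\<lambda>h. (\<lambda>hs. T' x (h # hs)) + (\<lambda>hs. S' x (h # hs)))"
      by (rule has_fderiv_add[OF _ _ nspace_type nspace_tens])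
        (use T' S' x in \<open>auto simp: has_tderiv_def\<close>)
    then show "has_fderiv type_nspace (tens j) B (\<lambda>x. T x + S x) x (\<lambda>h hs. (T' x + S' x) (h # hs))"
      by (simp add: func_plus)
  qed
  then show ?case unfolding Cb_field.simps
    using Suc.IH[OF T'(2) S'(2)] tbound_add[OF Cb_field_tbound[OF Suc.prems(1)] Cb_field_tbound[OF Suc.prems(2)]] by blast
qed (simp add: tbound_add)

text \<open>The tensor product in which the first factor receives the arguments with positions in \<open>J\<close> and the
  second factor the others. Arbitrary sets \<open>J\<close> are needed because differentiating the second factor
  puts its new slot at position 0, in front of the slots of the first one.\<close>

definition otimes :: "nat set \<Rightarrow> nat \<Rightarrow> ('a list \<Rightarrow> real) \<times> ('a list \<Rightarrow> real) \<Rightarrow> 'a list \<Rightarrow> real" where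
  "otimes J n z hs = (if length hs = n then fst z (nths hs J) * snd z (nths hs (- J)) else 0)"

definition splits :: "nat set \<Rightarrow> nat \<Rightarrow> nat \<Rightarrow> bool" where
  "splits J i j \<longleftrightarrow> card {p. p < i + j \<and> p \<in> J} = i \<and> card {p. p < i + j \<and> p \<in> - J} = j"

lemma splits_length:
  assumes "splits J i j" "length hs = i + j"
  shows "length (nths hs J) = i" "length (nths hs (- J)) = j"
  using assms by (auto simp: length_nths splits_def)

lemma splits_iff: "splits J i j \<longleftrightarrow> (\<forall>hs :: unit list. length hs = i + j \<longrightarrow> 
   length (nths hs J) = i \<and> length (nths hs (- J)) = j)"
proof
  assume r: "\<forall>hs :: unit list. length hs = i + j \<longrightarrow> length (nths hs J) = i \<and> length (nths hs (- J)) = j"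
  show "splits J i j" using r[rule_format, of "replicate (i + j) ()"] by (simp add: length_nths splits_def)
qed (auto simp: splits_length)

text \<open>The position sets after a new slot has been added in front, for the first or for the second factor.\<close>

lemma nths_shift:
  "nths (h # hs) (insert 0 (Suc ` J)) = h # nths hs J" "nths (h # hs) (- insert 0 (Suc ` J)) = nths hs (- J)"
  "nths (h # hs) (Suc ` J) = nths hs J" "nths (h # hs) (- (Suc ` J)) = h # nths hs (- J)"
proof -
  have "{j. Suc j \<in> insert 0 (Suc ` J)} = J" "{j. Suc j \<in> - insert 0 (Suc ` J)} = - J"
    "{j. Suc j \<in> Suc ` J} = J" "{j. Suc j \<in> - (Suc ` J)} = - J" by auto
  then show "nths (h # hs) (insert 0 (Suc ` J)) = h # nths hs J" "nths (h # hs) (- insert 0 (Suc ` J)) = nths hs (- J)"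
  "nths (h # hs) (Suc ` J) = nths hs J" "nths (h # hs) (- (Suc ` J)) = h # nths hs (- J)"
    by (auto simp: nths_Cons)
qed

lemma splits_shift:
  assumes "splits J i j"
  shows "splits (insert 0 (Suc ` J)) (Suc i) j" "splits (Suc ` J) i (Suc j)"
proof -
  show "splits (insert 0 (Suc ` J)) (Suc i) j"
    unfolding splits_iff using splits_length[OF assms] by (auto simp: length_Suc_conv nths_shift simp del: insert_iff)
  show "splits (Suc ` J) i (Suc j)"
    unfolding splits_iff using splits_length[OF assms] by (auto simp: length_Suc_conv nths_shift)
qed

lemma splits_empty: "splits {} 0 j"
  by (simp add: splits_def)

text \<open>Changing one argument changes exactly one argument of exactly one factor, whence multilinearity.\<close>

lemma nths_update:
  assumes "p < length hs"
  shows "(\<exists>q < length (nths hs J). \<forall>h. nths (hs[p := h]) J = (nths hs J)[q := h] \<and> nths (hs[p := h]) (- J) = nths hs (- J)) \<or>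
   (\<exists>q < length (nths hs (- J)). \<forall>h. nths (hs[p := h]) (- J) = (nths hs (- J))[q := h] \<and> nths (hs[p := h]) J = nths hs J)"
  using assms
proof (induction hs arbitrary: p J)
  case (Cons a hs)
  define K where "K = {j. Suc j \<in> J}"
  have K: "{j. Suc j \<in> - J} = - K" by (auto simp: K_def)
  note nc = nths_Cons[of _ _ J, folded K_def] nths_Cons[of _ _ "- J", unfolded K]
  show ?case
  proof (cases p)
    case 0
    then show ?thesis by (cases "0 \<in> J") (auto simp: nc intro: exI[of _ 0])
  next
    case (Suc p')
    then have "p' < length hs" using Cons.prems by simp
    from Cons.IH[OF this, of K] show ?thesis
    proof
      assume "\<exists>q<length (nths hs K). \<forall>h. nths (hs[p' := h]) K = (nths hs K)[q := h] \<and> nths (hs[p' := h]) (- K) = nths hs (- K)"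
      then obtain q where q: "q < length (nths hs K)" "\<And>h. nths (hs[p' := h]) K = (nths hs K)[q := h]"
        "\<And>h. nths (hs[p' := h]) (- K) = nths hs (- K)" by blast
      show ?thesis by (rule disjI1, rule exI[of _ "if 0 \<in> J then Suc q else q"]) (use q Suc in \<open>auto simp: nc\<close>)
    next
      assume "\<exists>q<length (nths hs (- K)). \<forall>h. nths (hs[p' := h]) (- K) = (nths hs (- K))[q := h] \<and> nths (hs[p' := h]) K = nths hs K"
      then obtain q where q: "q < length (nths hs (- K))" "\<And>h. nths (hs[p' := h]) (- K) = (nths hs (- K))[q := h]"
        "\<And>h. nths (hs[p' := h]) K = nths hs K" by blast
      show ?thesis by (rule disjI2, rule exI[of _ "if 0 \<in> J then q else Suc q"]) (use q Suc in \<open>auto simp: nc\<close>)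
    qed
  qed
qed simp

lemma prod_list_nths:
  fixes f :: "'b \<Rightarrow> real"
  shows "prod_list (map f (nths hs J)) * prod_list (map f (nths hs (- J))) = prod_list (map f hs)"
proof (induction hs arbitrary: J)
  case (Cons a hs)
  have K: "{j. Suc j \<in> - J} = - {j. Suc j \<in> J}" by auto
  show ?case using Cons[of "{j. Suc j \<in> J}"] by (cases "0 \<in> J") (simp_all add: nths_Cons K[simplified] mult_ac Collect_neg_eq)
qed simp

lemma otimes_bound:
  assumes "splits J i j" "length hs = i + j"
    and "\<And>hs. length hs = i \<Longrightarrow> \<bar>m hs\<bar> \<le> C * prod_list (map norm hs)"
    and "\<And>hs. length hs = j \<Longrightarrow> \<bar>m' hs\<bar> \<le> D * prod_list (map norm hs)"
  shows "\<bar>otimes J (i + j) (m, m') hs\<bar> \<le> C * D * prod_list (map norm hs)"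
proof -
  note l = splits_length[OF assms(1,2)]
  have "\<bar>m (nths hs J)\<bar> * \<bar>m' (nths hs (- J))\<bar> \<le>
      (C * prod_list (map norm (nths hs J))) * (D * prod_list (map norm (nths hs (- J))))"
    using assms(3)[OF l(1)] assms(4)[OF l(2)] by (intro mult_mono) (auto intro: order_trans[OF abs_ge_zero])
  also have "\<dots> = C * D * prod_list (map norm hs)" 
    by (simp only: prod_list_nths[of norm hs J, symmetric] mult_ac)
  finally show ?thesis using assms(2) by (simp add: otimes_def abs_mult)
qed

lemma otimes_mlin:
  assumes "splits J i j" and m: "m \<in> tens_set i" and m': "m' \<in> tens_set j"
  shows "otimes J (i + j) (m, m') \<in> tens_set (i + j)"
proof -
  obtain C where C: "\<And>hs. length hs = i \<Longrightarrow> \<bar>m hs\<bar> \<le> C * prod_list (map norm hs)"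
    using mlin_setD(5)[OF m] by (auto simp: Ball_def)
  obtain D where D: "\<And>hs. length hs = j \<Longrightarrow> \<bar>m' hs\<bar> \<le> D * prod_list (map norm hs)"
    using mlin_setD(5)[OF m'] by (auto simp: Ball_def)
  show ?thesis
  proof (rule mlin_setI[where C = "C * D"])
    fix hs :: "'a list"
    show "otimes J (i + j) (m, m') hs = 0" if "hs \<notin> args type_nspace (i + j)"
      using that by (simp add: otimes_def)
    show "otimes J (i + j) (m, m') hs \<in> fst type_nspace" by simp
    assume "hs \<in> args type_nspace (i + j)"
    then have hs: "length hs = i + j" by simp
    show "snd type_nspace (otimes J (i + j) (m, m') hs) \<le> C * D * prod_list (map (snd type_nspace) hs)"
      using otimes_bound[OF assms(1) hs C D] by simp
    note l = splits_length[OF assms(1) hs]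
    fix p assume p: "p < i + j"
    then have p': "p < length hs" using hs by simp
    show "otimes J (i + j) (m, m') (hs[p := c *\<^sub>R h]) = c *\<^sub>R otimes J (i + j) (m, m') (hs[p := h])" for c h
      using nths_update[OF p', of J] hs l mlin_setD(4)[OF m, of "nths hs J" _ h c] mlin_setD(4)[OF m', of "nths hs (- J)" _ h c]
      by (auto simp: otimes_def)
    show "otimes J (i + j) (m, m') (hs[p := g + h]) = otimes J (i + j) (m, m') (hs[p := g]) + otimes J (i + j) (m, m') (hs[p := h])" for g h
      using nths_update[OF p', of J] hs l mlin_setD(3)[OF m, of "nths hs J" _ g h] mlin_setD(3)[OF m', of "nths hs (- J)" _ g h]
      by (auto simp: otimes_def algebra_simps)
  qed
qed

lemma bdd_bilin_otimes:
  assumes "splits J i j"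
  shows "bdd_bilin (tens i) (tens j) (tens (i + j) :: ('a::real_normed_vector list \<Rightarrow> real) nspace) (otimes J (i + j))"
  unfolding bdd_bilin_def mlin_simps
proof (intro conjI ballI allI)
  fix m m' :: "'a list \<Rightarrow> real" assume m: "m \<in> tens_set i" and m': "m' \<in> tens_set j"
  show "otimes J (i + j) (m, m') \<in> tens_set (i + j)" using otimes_mlin[OF assms m m'] .
next
  show "\<exists>C\<ge>0. \<forall>m\<in>tens_set i. \<forall>m'\<in>tens_set j. tens_norm (i + j) (otimes J (i + j) (m, m'))
      \<le> C * tens_norm i m * tens_norm j (m' :: 'a list \<Rightarrow> real)"
  proof (intro exI[of _ 1] conjI ballI)
    fix m m' :: "'a list \<Rightarrow> real" assume m: "m \<in> tens_set i" and m': "m' \<in> tens_set j"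
    have "tens_norm (i + j) (otimes J (i + j) (m, m')) \<le>
      tens_norm i m * tens_norm j m'"
    proof (rule mlin_norm_le[OF nspace_type])
      show "0 \<le> tens_norm i m * tens_norm j m'"
        by (intro mult_nonneg_nonneg mlin_norm_nonneg m m' nspace_type)
      fix hs :: "'a list" assume "hs \<in> args type_nspace (i + j)"
      then show "snd type_nspace (otimes J (i + j) (m, m') hs) \<le>
         tens_norm i m * tens_norm j m' * prod_list (map (snd type_nspace) hs)"
        using otimes_bound[OF assms, of hs m _ m'] mlin_bound[OF m nspace_type nspace_type]
          mlin_bound[OF m' nspace_type nspace_type] by simp
    qed
    then show "tens_norm (i + j) (otimes J (i + j) (m, m')) \<le>
      1 * tens_norm i m * tens_norm j m'" by simp
  qed simp
qed (auto simp: otimes_def fun_eq_iff scaleR_fun_def algebra_simps)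

lemma tbound_otimes:
  assumes "splits J i j" and S: "tbound B i S C" and T: "tbound B j T D"
  shows "tbound B (i + j) (\<lambda>x. otimes J (i + j) (S x, T x)) (C * D)"
  unfolding tbound_def
proof (intro conjI ballI allI impI)
  show "cont_on_nspace type_nspace (tens (i + j)) B (\<lambda>x. otimes J (i + j) (S x, T x))"
    by (rule cont_bilin[OF _ _ _ _ bdd_bilin_otimes[OF assms(1)] nspace_tens nspace_tens nspace_tens])
      (use S T in \<open>auto simp: tbound_def\<close>)
  fix x assume x: "x \<in> B"
  show "otimes J (i + j) (S x, T x) \<in> tens_set (i + j)"
    by (rule otimes_mlin[OF assms(1)]) (use S T x in \<open>auto simp: tbound_def\<close>)
  show "\<bar>otimes J (i + j) (S x, T x) hs\<bar> \<le> C * D * prod_list (map norm hs)" if "length hs = i + j" for hs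
    by (rule otimes_bound[OF assms(1) that]) (use S T x in \<open>auto simp: tbound_def\<close>)
qed

text \<open>Leibniz rule: \<open>D(S \<otimes> T)\<close> is the sum of \<open>DS \<otimes> T\<close> and \<open>S \<otimes> DT\<close>, with different sets of slots. Each
  differentiation doubles the number of terms.\<close>

lemma Cb_field_otimes:
  assumes "splits J i j" "Cb_field B k i S C" "Cb_field B k j T D" "0 \<le> C" "0 \<le> D"
  shows "Cb_field B k (i + j) (\<lambda>x. otimes J (i + j) (S x, T x)) (2 ^ k * (C * D))"
  using assms
proof (induction k arbitrary: i j J S T)
  case 0
  then show ?case using tbound_otimes by auto
next
  case (Suc k)
  obtain S' where S': "has_tderiv B i S S'" "Cb_field B k (Suc i) S' C" using Suc.prems by auto
  obtain T' where T': "has_tderiv B j T T'" "Cb_field B k (Suc j) T' D" using Suc.prems by auto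
  note sp = splits_shift[OF Suc.prems(1)]
  have 1: "Cb_field B k (Suc i + j) (\<lambda>x. otimes (insert 0 (Suc ` J)) (Suc i + j) (S' x, T x)) (2 ^ k * (C * D))"
    using Suc.IH[OF sp(1) S'(2) Cb_field_Suc_imp[OF Suc.prems(3)] Suc.prems(4,5)] .
  have 2: "Cb_field B k (i + Suc j) (\<lambda>x. otimes (Suc ` J) (i + Suc j) (S x, T' x)) (2 ^ k * (C * D))"
    using Suc.IH[OF sp(2) Cb_field_Suc_imp[OF Suc.prems(2)] T'(2) Suc.prems(4,5)] .
  let ?D = "\<lambda>x. otimes (insert 0 (Suc ` J)) (Suc i + j) (S' x, T x) + otimes (Suc ` J) (i + Suc j) (S x, T' x)"
  have 3: "Cb_field B k (Suc (i + j)) ?D (2 ^ Suc k * (C * D))"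
    using Cb_field_add[OF 1 2[unfolded add_Suc_right, folded add_Suc]] by (simp add: mult_ac)
  have 4: "has_tderiv B (i + j) (\<lambda>x. otimes J (i + j) (S x, T x)) ?D"
    unfolding has_tderiv_def
  proof (intro ballI conjI)
    fix x assume x: "x \<in> B"
    show "?D x \<in> tens_set (Suc (i + j))" using Cb_field_tbound[OF 3] x by (auto simp: tbound_def)
    have "has_fderiv type_nspace (tens (i + j)) B (\<lambda>x. otimes J (i + j) (S x, T x)) x
       (\<lambda>h. otimes J (i + j) (\<lambda>hs. S' x (h # hs), T x) + otimes J (i + j) (S x, \<lambda>hs. T' x (h # hs)))"
      by (rule has_fderiv_bilin_comp[OF _ _ bdd_bilin_otimes[OF Suc.prems(1)] nspace_type
            nspace_tens nspace_tens nspace_tens])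
        (use S' T' x in \<open>auto simp: has_tderiv_def\<close>)
    moreover have "otimes J (i + j) (\<lambda>hs. S' x (h # hs), T x) + otimes J (i + j) (S x, \<lambda>hs. T' x (h # hs)) =
        (\<lambda>hs. ?D x (h # hs))" for h
      by (auto simp: fun_eq_iff otimes_def nths_shift simp del: insert_iff)
    ultimately show "has_fderiv type_nspace (tens (i + j)) B (\<lambda>x. otimes J (i + j) (S x, T x)) x (\<lambda>h hs. ?D x (h # hs))"
      by simp
  qed
  have tb: "tbound B (i + j) (\<lambda>x. otimes J (i + j) (S x, T x)) (2 ^ Suc k * (C * D))"
  proof (rule tbound_mono)
    show "tbound B (i + j) (\<lambda>x. otimes J (i + j) (S x, T x)) (C * D)"
      using tbound_otimes[OF Suc.prems(1)] Suc.prems(2,3) by auto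
    show "C * D \<le> 2 ^ Suc k * (C * D)"
      using mult_right_mono[of 1 "2 ^ Suc k" "C * D"] Suc.prems(4,5) one_le_power[of "2::real" "Suc k"] by simp
  qed
  show ?case unfolding Cb_field.simps using tb 3 4 by blast
qed

section \<open>Scalar fields and the exponential\<close>

text \<open>Functions as tensor fields of rank 0; this is \<open>nth_fderiv\<close> of order 0.\<close>

definition rank0 :: "('a \<Rightarrow> real) \<Rightarrow> 'a \<Rightarrow> 'a list \<Rightarrow> real" where
  "rank0 f = (\<lambda>x hs. if hs = [] then f x else 0)"

lemma cont_real_iff:
  fixes f :: "'a::real_normed_vector \<Rightarrow> real"
  shows "cont_on_nspace type_nspace type_nspace B f \<longleftrightarrow> continuous_on B f"
  by (auto simp: cont_on_nspace_def continuous_on_iff dist_norm)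

lemma tbound_rank0: "tbound B 0 (rank0 f) C \<longleftrightarrow> continuous_on B f \<and> (\<forall>x\<in>B. \<bar>f x\<bar> \<le> C)"
proof -
  have m: "rank0 f x \<in> tens_set 0" for x
    using bdd_lin_simps(1)[OF bdd_lin_to_mlin0[OF nspace_type nspace_type] nspace_type, of "f x"]
    by (simp add: rank0_def)
  have "cont_on_nspace type_nspace (tens 0) B (rank0 f) \<longleftrightarrow> continuous_on B f"
  proof
    assume "cont_on_nspace type_nspace (tens 0) B (rank0 f)"
    from cont_linear_comp[OF this _ bdd_lin_from_mlin0[OF nspace_type nspace_type] nspace_tens nspace_type]
    show "continuous_on B f" using m by (simp add: cont_real_iff rank0_def)
  next
    assume "continuous_on B f"
    then have "cont_on_nspace type_nspace type_nspace B f" by (simp add: cont_real_iff)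
    from cont_linear_comp[OF this _ bdd_lin_to_mlin0[OF nspace_type nspace_type] nspace_type nspace_tens]
    show "cont_on_nspace type_nspace (tens 0) B (rank0 f)" by (simp add: rank0_def)
  qed
  then show ?thesis by (auto simp: tbound_def m) (auto simp: rank0_def)
qed

lemma has_tderiv_rank0:
  assumes "\<And>x. x \<in> B \<Longrightarrow> T' x \<in> tens_set 1"
    "\<And>x. x \<in> B \<Longrightarrow> has_fderiv type_nspace type_nspace B f x (\<lambda>h. T' x [h])"
  shows "has_tderiv B 0 (rank0 f) T'"
  unfolding has_tderiv_def
proof (intro ballI conjI)
  fix x assume x: "x \<in> B"
  show "T' x \<in> tens_set (Suc 0)" using assms(1)[OF x] by simp
  have "has_fderiv type_nspace (tens 0) B (rank0 f) x (\<lambda>h hs. if hs = [] then T' x [h] else 0)"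
    using has_fderiv_linear_comp[OF assms(2)[OF x] bdd_lin_to_mlin0[OF nspace_type nspace_type]
      nspace_type nspace_type nspace_tens] by (simp add: rank0_def)
  moreover have "(if hs = [] then T' x [h] else 0) = T' x (h # hs)" for h hs
    using mlin_setD(1)[OF assms(1)[OF x], of "h # hs"] by simp
  ultimately show "has_fderiv type_nspace (tens 0) B (rank0 f) x (\<lambda>h hs. T' x (h # hs))" by simp
qed

lemma has_tderiv_rank0D:
  assumes "has_tderiv B 0 (rank0 f) T'" "x \<in> B"
  shows "has_fderiv type_nspace type_nspace B f x (\<lambda>h. T' x [h])"
proof -
  have "has_fderiv type_nspace (tens 0) B (rank0 f) x (\<lambda>h hs. T' x (h # hs))"
    using assms by (simp add: has_tderiv_def)
  from has_fderiv_linear_comp[OF this bdd_lin_from_mlin0[OF nspace_type nspace_type]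
      nspace_type nspace_tens nspace_type]
  show ?thesis by (simp add: rank0_def)
qed

text \<open>The derivative of \<open>\<phi> \<circ> f\<close> is \<open>(\<phi>' \<circ> f) \<otimes> Df\<close>, so bounds of order \<open>k\<close> for \<open>\<phi>' \<circ> f\<close> give bounds of order
  \<open>k + 1\<close> for \<open>\<phi> \<circ> f\<close>.\<close>

lemma Cb_field_chain:
  fixes f :: "'a::real_normed_vector \<Rightarrow> real"
  assumes B: "open B" and \<phi>: "\<And>r. (\<phi> has_real_derivative \<phi>' r) (at r)"
    and f: "Cb_field B (Suc k) 0 (rank0 f) C" and \<phi>'f: "Cb_field B k 0 (rank0 (\<lambda>x. \<phi>' (f x))) D"
    and b: "\<And>x. x \<in> B \<Longrightarrow> \<bar>\<phi> (f x)\<bar> \<le> A" and nn: "0 \<le> C" "0 \<le> D"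
    and A: "A \<le> K" and K: "2 ^ k * (D * C) \<le> K"
  shows "Cb_field B (Suc k) 0 (rank0 (\<lambda>x. \<phi> (f x))) K"
proof -
  obtain T' where T': "has_tderiv B 0 (rank0 f) T'" "Cb_field B k 1 T' C" using f by auto
  define S where "S x = otimes {} 1 (rank0 (\<lambda>x. \<phi>' (f x)) x, T' x)" for x
  have 1: "Cb_field B k 1 S (2 ^ k * (D * C))"
    using Cb_field_otimes[OF splits_empty \<phi>'f T'(2) nn(2,1)] by (simp add: S_def[abs_def])
  have 2: "has_tderiv B 0 (rank0 (\<lambda>x. \<phi> (f x))) S"
  proof (rule has_tderiv_rank0)
    fix x assume x: "x \<in> B"
    show "S x \<in> tens_set 1" using Cb_field_tbound[OF 1] x by (auto simp: tbound_def)
    have "(f has_derivative (\<lambda>h. T' x [h])) (at x)"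
      using has_tderiv_rank0D[OF T'(1) x] has_fderiv_type[OF B x] by blast
    from has_derivative_compose[OF this, of \<phi> "(*) (\<phi>' (f x))"]
    have "((\<lambda>x. \<phi> (f x)) has_derivative (\<lambda>h. \<phi>' (f x) * T' x [h])) (at x)"
      using \<phi>[of "f x"] by (simp add: has_field_derivative_def)
    moreover have "S x [h] = \<phi>' (f x) * T' x [h]" for h
      by (simp add: S_def otimes_def rank0_def nths_Cons)
    ultimately show "has_fderiv type_nspace type_nspace B (\<lambda>x. \<phi> (f x)) x (\<lambda>h. S x [h])"
      by (simp add: has_fderiv_type[OF B x])
  qed
  have "continuous_on B f" using Cb_field_tbound[OF f] by (simp add: tbound_rank0)
  moreover have "continuous_on UNIV \<phi>" using \<phi> by (meson DERIV_continuous_on UNIV_I has_field_derivative_at_within)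
  ultimately have "continuous_on B (\<lambda>x. \<phi> (f x))"
    using continuous_on_compose2 by blast
  then have "tbound B 0 (rank0 (\<lambda>x. \<phi> (f x))) K" using b A by (force simp: tbound_rank0)
  then show ?thesis using 2 Cb_field_mono[OF 1 K] by auto
qed

lemma Cb_field_rank0_bound: "Cb_field B k 0 (rank0 f) C \<Longrightarrow> x \<in> B \<Longrightarrow> \<bar>f x\<bar> \<le> C"
  using Cb_field_tbound tbound_rank0 by blast

lemma Cb_field_exp:
  assumes "open B" "0 \<le> C"
  shows "\<exists>D\<ge>0. \<forall>f. Cb_field B k 0 (rank0 f) C \<longrightarrow> Cb_field B k 0 (rank0 (\<lambda>x. exp (f x))) D"
proof (induction k)
  case 0
  show ?case by (rule exI[of _ "exp C"]) (auto simp: tbound_rank0 abs_le_iff intro!: continuous_intros)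
next
  case (Suc k)
  then obtain D where D: "D \<ge> 0" "\<And>f. Cb_field B k 0 (rank0 f) C \<Longrightarrow> Cb_field B k 0 (rank0 (\<lambda>x. exp (f x))) D" by blast
  show ?case
  proof (intro exI[of _ "max (exp C) (2 ^ k * (D * C))"] conjI allI impI)
    show "0 \<le> max (exp C) (2 ^ k * (D * C))" by (simp add: le_max_iff_disj)
    fix f assume f: "Cb_field B (Suc k) 0 (rank0 f) C"
    show "Cb_field B (Suc k) 0 (rank0 (\<lambda>x. exp (f x))) (max (exp C) (2 ^ k * (D * C)))"
      by (rule Cb_field_chain[OF assms(1) DERIV_exp f D(2)[OF Cb_field_Suc_imp[OF f]], where A = "exp C"])
        (use assms(2) D(1) Cb_field_rank0_bound[OF f] in \<open>auto simp: abs_le_iff\<close>)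
  qed
qed

lemma exp_rem_bound:
  fixes x :: real assumes "\<bar>x\<bar> \<le> 1" shows "\<bar>exp x - 1 - x\<bar> \<le> x\<^sup>2"
proof -
  have "exp x \<le> 1 + x + x\<^sup>2"
  proof (cases "x \<ge> 0")
    case True then show ?thesis using exp_bound[of x] assms by simp
  next
    case False
    \<comment> \<open>Negative arguments: invert the quadratic lower bound of \<open>exp (- x)\<close>.\<close>
    define y where "y = - x"
    have y: "y > 0" using False by (simp add: y_def)
    have "(1 - y + y\<^sup>2) * (1 + y + y\<^sup>2 / 2) = 1 + (y\<^sup>2 + y ^ 3 + y ^ 4) / 2"
      by (simp add: field_simps power2_eq_square power3_eq_cube power4_eq_xxxx)
    then have "1 \<le> (1 - y + y\<^sup>2) * (1 + y + y\<^sup>2 / 2)" using y by simp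
    also have "\<dots> \<le> (1 - y + y\<^sup>2) * exp y"
    proof (rule mult_left_mono)
      show "1 + y + y\<^sup>2 / 2 \<le> exp y" using exp_lower_Taylor_quadratic[of y] y by simp
      show "0 \<le> 1 - y + y\<^sup>2" using assms by (simp add: y_def)
    qed
    finally have "exp (- y) \<le> 1 - y + y\<^sup>2" by (simp add: exp_minus field_simps)
    then show ?thesis by (simp add: y_def)
  qed
  then show ?thesis using exp_ge_add_one_self[of x] zero_le_power2[of x] unfolding abs_le_iff by linarith
qed

lemma exp_m1_bound:
  fixes x :: real assumes "\<bar>x\<bar> \<le> 1" shows "\<bar>exp x - 1\<bar> \<le> 2 * \<bar>x\<bar>"
proof -
  have "\<bar>exp x - 1\<bar> \<le> x\<^sup>2 + \<bar>x\<bar>" using exp_rem_bound[OF assms] by linarith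
  also have "x\<^sup>2 \<le> \<bar>x\<bar>" using assms mult_left_le[of "\<bar>x\<bar>" "\<bar>x\<bar>"] by (simp add: power2_eq_square)
  finally show ?thesis by simp
qed

text \<open>A linear bound: the derivative is \<open>exp f \<otimes> Df\<close>, where \<open>exp f\<close> is bounded and \<open>Df\<close> is bounded by \<open>C\<close>.\<close>

lemma Cb_field_exp_minus_one:
  assumes "open B"
  shows "\<exists>A\<ge>0. \<forall>f C. 0 \<le> C \<longrightarrow> C \<le> 1 \<longrightarrow> Cb_field B k 0 (rank0 f) C \<longrightarrow> Cb_field B k 0 (rank0 (\<lambda>x. exp (f x) - 1)) (A * C)"
proof -
  have b: "\<bar>exp (f x) - 1\<bar> \<le> 2 * C" if "C \<le> 1" "Cb_field B k 0 (rank0 f) C" "x \<in> B" for k f C x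
    using exp_m1_bound[of "f x"] Cb_field_rank0_bound[OF that(2,3)] that(1) by simp
  show ?thesis
  proof (cases k)
    case 0
    show ?thesis unfolding 0
      by (rule exI[of _ 2]) (use b[of _ 0] in \<open>auto simp: tbound_rank0 intro!: continuous_intros\<close>)
  next
    case (Suc k)
    obtain D where D: "D \<ge> 0" "\<And>f. Cb_field B k 0 (rank0 f) 1 \<Longrightarrow> Cb_field B k 0 (rank0 (\<lambda>x. exp (f x))) D"
      using Cb_field_exp[OF assms zero_le_one] by blast
    show ?thesis unfolding Suc
    proof (intro exI[of _ "max 2 (2 ^ k * D)"] conjI allI impI)
      fix f C assume C: "0 \<le> C" "C \<le> 1" and f: "Cb_field B (Suc k) 0 (rank0 f) C"
      show "Cb_field B (Suc k) 0 (rank0 (\<lambda>x. exp (f x) - 1)) (max 2 (2 ^ k * D) * C)"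
      proof (rule Cb_field_chain[OF assms _ f, where \<phi> = "\<lambda>r. exp r - 1" and \<phi>' = exp and A = "2 * C" and D = D])
        show "((\<lambda>r. exp r - 1) has_real_derivative exp r) (at r)" for r
          by (auto intro!: derivative_eq_intros)
        show "Cb_field B k 0 (rank0 (\<lambda>x. exp (f x))) D" using D(2) Cb_field_mono[OF Cb_field_Suc_imp[OF f] C(2)] by blast
        show "2 ^ k * (D * C) \<le> max 2 (2 ^ k * D) * C"
          using mult_right_mono[of "2 ^ k * D" "max 2 (2 ^ k * D)" C] C by (simp add: mult.assoc)
      qed (use C D(1) b[OF C(2) f] in \<open>auto intro: mult_right_mono\<close>)
    qed simp
  qed
qed

text \<open>A quadratic bound: the derivative is \<open>(exp f - 1) \<otimes> Df\<close>, and both factors are bounded by multiples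
  of \<open>C\<close>.\<close>

lemma Cb_field_exp_remainder:
  assumes "open B"
  shows "\<exists>A\<ge>0. \<forall>f C. 0 \<le> C \<longrightarrow> C \<le> 1 \<longrightarrow> Cb_field B k 0 (rank0 f) C \<longrightarrow> Cb_field B k 0 (rank0 (\<lambda>x. exp (f x) - 1 - f x)) (A * C\<^sup>2)"
proof -
  have b: "\<bar>exp (f x) - 1 - f x\<bar> \<le> 1 * C\<^sup>2" if "C \<le> 1" "Cb_field B k 0 (rank0 f) C" "x \<in> B" for k f C x
    using exp_rem_bound[of "f x"] Cb_field_rank0_bound[OF that(2,3)] that(1) abs_le_square_iff[of "f x" C] by simp
  show ?thesis
  proof (cases k)
    case 0
    show ?thesis unfolding 0
      by (rule exI[of _ 1]) (use b[of _ 0] in \<open>auto simp: tbound_rank0 intro!: continuous_intros\<close>)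
  next
    case (Suc k)
    obtain A where A: "A \<ge> 0" "\<And>f C. 0 \<le> C \<Longrightarrow> C \<le> 1 \<Longrightarrow> Cb_field B k 0 (rank0 f) C \<Longrightarrow> Cb_field B k 0 (rank0 (\<lambda>x. exp (f x) - 1)) (A * C)"
      using Cb_field_exp_minus_one[OF assms] by blast
    show ?thesis unfolding Suc
    proof (intro exI[of _ "max 1 (2 ^ k * A)"] conjI allI impI)
      fix f C assume C: "0 \<le> C" "C \<le> 1" and f: "Cb_field B (Suc k) 0 (rank0 f) C"
      show "Cb_field B (Suc k) 0 (rank0 (\<lambda>x. exp (f x) - 1 - f x)) (max 1 (2 ^ k * A) * C\<^sup>2)"
      proof (rule Cb_field_chain[OF assms _ f, where \<phi> = "\<lambda>r. exp r - 1 - r" and \<phi>' = "\<lambda>r. exp r - 1" and A = "1 * C\<^sup>2" and D = "A * C"])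
        show "((\<lambda>r. exp r - 1 - r) has_real_derivative exp r - 1) (at r)" for r
          by (auto intro!: derivative_eq_intros)
        show "Cb_field B k 0 (rank0 (\<lambda>x. exp (f x) - 1)) (A * C)" using A(2) Cb_field_Suc_imp[OF f] C by blast
        show "2 ^ k * (A * C * C) \<le> max 1 (2 ^ k * A) * C\<^sup>2"
          using mult_right_mono[of "2 ^ k * A" "max 1 (2 ^ k * A)" "C\<^sup>2"] by (simp add: mult.assoc power2_eq_square)
        show "1 * C\<^sup>2 \<le> max 1 (2 ^ k * A) * C\<^sup>2" by (rule mult_right_mono) auto
      qed (use C A(1) b[OF C(2) f] in auto)
    qed simp
  qed
qed

lemma Cb_field_zero: "0 \<le> C \<Longrightarrow> Cb_field B k j (\<lambda>x. 0) C"
proof (induction k arbitrary: j)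
  case (Suc k)
  have "has_tderiv B j (\<lambda>x. 0) (\<lambda>x. 0)"
    unfolding has_tderiv_def
  proof (intro ballI conjI)
    fix x assume x: "x \<in> B"
    show "0 \<in> tens_set (Suc j)" using nspace_closed(1)[OF nspace_tens] by simp
    have "has_fderiv type_nspace (tens j) UNIV (\<lambda>x. 0) x (\<lambda>h. 0)"
      using twice_fdiff_deriv[OF twice_fdiff_const[OF nspace_closed(1)[OF nspace_tens] nspace_type nspace_tens]] by auto
    from has_fderiv_restrict[OF this order_refl refl subset_UNIV x]
    have "has_fderiv type_nspace (tens j) B (\<lambda>x. 0) x (\<lambda>h. 0)" .
    then show "has_fderiv type_nspace (tens j) B (\<lambda>x. 0) x (\<lambda>h hs. 0 (h # hs))" by (simp add: zero_fun_def)
  qed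
  moreover have "tbound B j (\<lambda>x. 0) C" using Suc.IH[OF Suc.prems, of j] Cb_field_tbound by blast
  ultimately show ?case unfolding Cb_field.simps using Suc.IH[OF Suc.prems] by blast
next
  case 0
  have "cont_on_nspace type_nspace (tens j) B (\<lambda>x. 0)"
    unfolding cont_on_nspace_def
    by (intro ballI allI impI exI[of _ 1])
      (simp add: nspace_norm_zero[OF nspace_tens, unfolded mlin_simps])
  moreover have "(0 :: 'a list \<Rightarrow> real) \<in> tens_set j" using nspace_closed(1)[OF nspace_tens] by simp
  ultimately show ?case using mult_nonneg_nonneg[OF 0 prod_list_norm_ge0]
    unfolding Cb_field.simps tbound_def zero_fun_apply abs_zero by blast
qed

lemma Cb_field_const:
  assumes "\<bar>c\<bar> \<le> C" shows "Cb_field B k 0 (rank0 (\<lambda>x. c)) C"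
proof (cases k)
  case (Suc m)
  have C: "0 \<le> C" using assms by linarith
  have "has_tderiv B 0 (rank0 (\<lambda>x. c)) (\<lambda>x. 0)"
  proof (rule has_tderiv_rank0)
    fix x assume x: "x \<in> B"
    show "0 \<in> tens_set 1" using nspace_closed(1)[OF nspace_tens] by simp
    have "has_fderiv type_nspace type_nspace UNIV (\<lambda>x. c) x (\<lambda>h. 0)"
      using twice_fdiff_deriv[OF twice_fdiff_const[OF _ nspace_type nspace_type]] by auto
    from has_fderiv_restrict[OF this order_refl refl subset_UNIV x]
    show "has_fderiv type_nspace type_nspace B (\<lambda>x. c) x (\<lambda>h. 0 [h])" by simp
  qed
  then show ?thesis using assms Cb_field_zero[OF C, of B m 1] unfolding Suc Cb_field.simps
    by (auto simp: tbound_rank0)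
qed (use assms in \<open>simp add: tbound_rank0\<close>)

lemma Cb_field_mult:
  assumes "Cb_field B k 0 (rank0 f) C" "Cb_field B k 0 (rank0 g) D" "0 \<le> C" "0 \<le> D"
  shows "Cb_field B k 0 (rank0 (\<lambda>x. f x * g x)) (2 ^ k * (C * D))"
proof -
  have "(\<lambda>x. otimes {} (0 + 0) (rank0 f x, rank0 g x)) = rank0 (\<lambda>x. f x * g x)"
    by (auto simp: fun_eq_iff otimes_def rank0_def)
  then show ?thesis using Cb_field_otimes[OF splits_empty assms] by simp
qed

lemma Cb_field_rank0_add:
  assumes "Cb_field B k 0 (rank0 f) C" "Cb_field B k 0 (rank0 g) D"
  shows "Cb_field B k 0 (rank0 (\<lambda>x. f x + g x)) (C + D)"
proof -
  have "(\<lambda>x. rank0 f x + rank0 g x) = rank0 (\<lambda>x. f x + g x)"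
    by (auto simp: fun_eq_iff rank0_def)
  then show ?thesis using Cb_field_add[OF assms] by simp
qed

section \<open>Iterated derivatives as tensor fields\<close>

text \<open>The norm occurs unapplied in \<open>type_nspace\<close>; on the reals it must not be rewritten there.\<close>

declare real_norm_def [simp del] nth_fderiv.simps [simp del]

abbreviation nderiv :: "'a::real_normed_vector set \<Rightarrow> ('a \<Rightarrow> real) \<Rightarrow> nat \<Rightarrow> 'a \<Rightarrow> 'a list \<Rightarrow> real" where
  "nderiv B a i \<equiv> nth_fderiv type_nspace type_nspace B a i"

lemma nderiv_0: "nderiv B a 0 = rank0 a"
  by (simp add: rank0_def nth_fderiv.simps)

text \<open>By uniqueness of derivatives, any tensor field that differentiates the \<open>j\<close>-th derivative is the
  next one.\<close>

lemma nderiv_Suc_eq: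
  assumes B: "open B" and T: "\<And>x. x \<in> B \<Longrightarrow> nderiv B a j x = T x" and T': "has_tderiv B j T T'" and x: "x \<in> B"
  shows "nderiv B a (Suc j) x = T' x"
proof
  fix hs
  have "has_fderiv type_nspace (tens j) B T x (\<lambda>h hs. T' x (h # hs))" using T' x by (simp add: has_tderiv_def)
  then have d: "has_fderiv type_nspace (tens j) B (nderiv B a j) x (\<lambda>h hs. T' x (h # hs))"
    using has_fderiv_cong[of B "nderiv B a j" T type_nspace, OF T refl nspace_type] by simp
  have "T' x [] = 0" using T' x mlin_setD(1)[of "T' x" "Suc j" type_nspace type_nspace "[]"] by (simp add: has_tderiv_def)
  then show "nderiv B a (Suc j) x hs = T' x hs"
    using fderiv_eq[OF d nspace_type nspace_tens, unfolded nopen_type, OF B] by (simp add: nth_fderiv.simps split: list.splits)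
qed

lemma Cb_field_nderiv:
  assumes B: "open B" and T: "\<And>x. x \<in> B \<Longrightarrow> nderiv B a j x = T x" and "Cb_field B m j T C" and "i \<le> m"
  shows "tbound B (j + i) (nderiv B a (j + i)) C \<and>
    (i < m \<longrightarrow> (\<exists>T'. has_tderiv B (j + i) (nderiv B a (j + i)) T'))"
  using assms(2-)
proof (induction m arbitrary: j T i)
  case 0
  then show ?case using tbound_cong[of B "nderiv B a j" T] by simp
next
  case (Suc m)
  obtain T' where T': "has_tderiv B j T T'" "Cb_field B m (Suc j) T' C" using Suc.prems by auto
  have eq: "nderiv B a (Suc j) x = T' x" if "x \<in> B" for x using nderiv_Suc_eq[OF B Suc.prems(1) T'(1) that] .
  show ?case
  proof (cases i)
    case 0
    have "tbound B j (nderiv B a j) C" using tbound_cong[of B "nderiv B a j" T] Suc.prems by simp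
    moreover have "has_tderiv B j (nderiv B a j) T'" using has_tderiv_cong[of B "nderiv B a j" T] T' Suc.prems(1) by simp
    ultimately show ?thesis using 0 by auto
  next
    case (Suc i')
    then show ?thesis using Suc.IH[of "Suc j" T' i', OF eq T'(2)] Suc.prems(3) by simp
  qed
qed

lemma tbound_tens_norm:
  assumes "tbound B j T C" "0 \<le> C" "x \<in> B"
  shows "tens_norm j (T x) \<le> C"
  by (rule mlin_norm_le[OF nspace_type]) (use assms in \<open>auto simp: tbound_def real_norm_def\<close>)

lemma Ck_on_of_Cb_field:
  assumes "open B" "Cb_field B k 0 (rank0 a) C"
  shows "Ck_on k type_nspace type_nspace B a"
    "\<And>i. i \<le> k \<Longrightarrow> tbound B i (nderiv B a i) C"
proof -
  have *: "tbound B i (nderiv B a i) C \<and> (i < k \<longrightarrow> (\<exists>T'. has_tderiv B i (nderiv B a i) T'))" if "i \<le> k" for i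
    using Cb_field_nderiv[OF assms(1) _ assms(2) that, of a] nderiv_0[of B a] by simp
  show tb: "\<And>i. i \<le> k \<Longrightarrow> tbound B i (nderiv B a i) C" using * by blast
  have "\<exists>L. has_fderiv type_nspace (tens i) B (nderiv B a i) x L" if "i < k" "x \<in> B" for i x
    using *[of i] that unfolding has_tderiv_def by auto
  then show "Ck_on k type_nspace type_nspace B a"
    using tb unfolding Ck_on_def tbound_def by simp
qed

lemma nderiv_mlin:
  assumes "Ck_on k type_nspace type_nspace B a" "i \<le> k" "x \<in> B"
  shows "nderiv B a i x \<in> tens_set i"
proof (cases "i < k")
  case True
  then obtain L where "has_fderiv type_nspace (tens i) B (nderiv B a i) x L" using assms unfolding Ck_on_def by blast
  from has_fderiv_into(2)[OF this assms(3)] show ?thesis by simp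
next
  case False
  show ?thesis
  proof (cases i)
    case 0
    then show ?thesis
      using bdd_lin_simps(1)[OF bdd_lin_to_mlin0[OF nspace_type nspace_type] nspace_type, of "a x"]
      by (simp add: nderiv_0 rank0_def)
  next
    case (Suc j)
    then obtain L where L: "has_fderiv type_nspace (tens j) B (nderiv B a j) x L" 
      using assms unfolding Ck_on_def by (meson Suc_le_lessD)
    then have "has_fderiv type_nspace (tens j) B (nderiv B a j) x (fderiv type_nspace (tens j) B (nderiv B a j) x)"
      unfolding fderiv_def by (rule someI[where P = "has_fderiv type_nspace (tens j) B (nderiv B a j) x"])
    from uncurry_mlin_in_mlin_set[OF has_fderiv_into(3)[OF this] nspace_type nspace_type]
    show ?thesis unfolding Suc nth_fderiv.simps uncurry_mlin_def .
  qed
qed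

lemma nderiv_tder:
  assumes B: "open B" and a: "Ck_on k type_nspace type_nspace B a" and i: "i < k"
  shows "has_tderiv B i (nderiv B a i) (nderiv B a (Suc i))"
  unfolding has_tderiv_def
proof (intro ballI conjI)
  fix x assume x: "x \<in> B"
  show "nderiv B a (Suc i) x \<in> tens_set (Suc i)" using nderiv_mlin[OF a _ x, of "Suc i"] i by simp
  obtain L where "has_fderiv type_nspace (tens i) B (nderiv B a i) x L" using a i x unfolding Ck_on_def by blast
  then have "has_fderiv type_nspace (tens i) B (nderiv B a i) x (fderiv type_nspace (tens i) B (nderiv B a i) x)"
    unfolding fderiv_def by (rule someI[where P = "has_fderiv type_nspace (tens i) B (nderiv B a i) x"])
  then show "has_fderiv type_nspace (tens i) B (nderiv B a i) x (\<lambda>h hs. nderiv B a (Suc i) x (h # hs))"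
    by (simp add: nth_fderiv.simps)
qed

lemma Cb_field_of_Ck_on:
  assumes B: "open B" and a: "Ck_on k type_nspace type_nspace B a"
    and C: "\<And>i x. i \<le> k \<Longrightarrow> x \<in> B \<Longrightarrow> tens_norm i (nderiv B a i x) \<le> C"
  shows "Cb_field B k 0 (rank0 a) C"
proof -
  have tb: "tbound B i (nderiv B a i) C" if "i \<le> k" for i
    unfolding tbound_def
  proof (intro conjI ballI allI impI)
    show "cont_on_nspace type_nspace (tens i) B (nderiv B a i)" using a that by (simp add: Ck_on_def)
    fix x assume x: "x \<in> B"
    show m: "nderiv B a i x \<in> tens_set i" using nderiv_mlin[OF a that x] .
    show "\<bar>nderiv B a i x hs\<bar> \<le> C * prod_list (map norm hs)" if "length hs = i" for hs
      using mlin_bound[OF m nspace_type nspace_type, of hs] that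
        mult_right_mono[OF C[OF \<open>i \<le> k\<close> x] prod_list_norm_ge0[of hs]] by (simp add: real_norm_def)
  qed
  have "Cb_field B m j (nderiv B a j) C" if "j + m = k" for j m
    using that
  proof (induction m arbitrary: j)
    case 0 then show ?case using tb by simp
  next
    case (Suc m)
    then show ?case using tb[of j] nderiv_tder[OF B a, of j] unfolding Cb_field.simps by (metis add_Suc_right add_Suc less_add_Suc1 le_add1)
  qed
  from this[of 0 k] show ?thesis by (simp add: nderiv_0)
qed

section \<open>The algebra G\<close>

lemma G_simps [simp]: "fst (G B k) = G_set B k" "snd (G B k) = G_norm B k"
  by (simp_all add: G_def)

definition sup_deriv :: "'a::banach set \<Rightarrow> ('a \<Rightarrow> real) \<Rightarrow> nat \<Rightarrow> real" where
  "sup_deriv B a i = (SUP x\<in>B. tens_norm i (nderiv B a i x))"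

lemma nderiv_0_norm: "tens_norm 0 (nderiv B a 0 x) = \<bar>a x\<bar>"
proof -
  have "{snd type_nspace (nderiv B a 0 x hs) |hs. hs \<in> args (type_nspace :: 'a nspace) 0 \<and> (\<forall>h\<in>set hs. snd type_nspace h \<le> 1)} = {\<bar>a x\<bar>}"
    by (auto simp: nderiv_0 rank0_def real_norm_def)
  then show ?thesis by (simp add: mlin_norm_def)
qed

lemma G_norm_eq: "G_norm B k a = (\<Sum>i\<le>k. sup_deriv B a i)"
proof -
  have "{..k} = insert 0 {1..k}" by auto
  then show ?thesis by (simp add: G_norm_def sup_deriv_def nderiv_0_norm)
qed

lemma G_set_iff:
  assumes "open B"
  shows "a \<in> G_set B k \<longleftrightarrow> (\<forall>x. x \<notin> B \<longrightarrow> a x = 0) \<and> (\<exists>C. Cb_field B k 0 (rank0 a) C)"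
proof
  assume a: "a \<in> G_set B k"
  have bd: "bdd_above ((\<lambda>x. tens_norm i (nderiv B a i x)) ` B)" if "i \<le> k" for i
    using a that by (cases "i = 0") (auto simp: G_set_def nderiv_0_norm)
  have Ck: "Ck_on k type_nspace type_nspace B a" using a by (simp add: G_set_def)
  have "\<exists>C. \<forall>i\<le>m. \<forall>x\<in>B. tens_norm i (nderiv B a i x) \<le> C" if "m \<le> k" for m
    using that
  proof (induction m)
    case 0 then show ?case using bd[of 0] by (auto simp: bdd_above_def)
  next
    case (Suc m)
    obtain C where C: "\<forall>i\<le>m. \<forall>x\<in>B. tens_norm i (nderiv B a i x) \<le> C" using Suc by auto
    obtain D where D: "\<forall>x\<in>B. tens_norm (Suc m) (nderiv B a (Suc m) x) \<le> D"
      using bd[OF Suc.prems] by (auto simp: bdd_above_def)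
    show ?case
      by (rule exI[of _ "max C D"]) (use C D in \<open>auto simp: le_Suc_eq le_max_iff_disj\<close>)
  qed
  from this[of k] Cb_field_of_Ck_on[OF assms Ck] show "(\<forall>x. x \<notin> B \<longrightarrow> a x = 0) \<and> (\<exists>C. Cb_field B k 0 (rank0 a) C)"
    using a by (auto simp: G_set_def)
next
  assume "(\<forall>x. x \<notin> B \<longrightarrow> a x = 0) \<and> (\<exists>C. Cb_field B k 0 (rank0 a) C)"
  then obtain C where C: "Cb_field B k 0 (rank0 a) (max C 0)" and z: "\<forall>x. x \<notin> B \<longrightarrow> a x = 0"
    using Cb_field_mono by (metis max.cobounded1)
  note ck = Ck_on_of_Cb_field[OF assms C]
  have "tens_norm i (nderiv B a i x) \<le> max C 0" if "i \<le> k" "x \<in> B" for i x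
    using tbound_tens_norm[OF ck(2)[OF that(1)] _ that(2)] by simp
  then have bd: "bdd_above ((\<lambda>x. tens_norm i (nderiv B a i x)) ` B)" if "i \<le> k" for i
    using that by (auto simp: bdd_above_def)
  show "a \<in> G_set B k"
    unfolding G_set_def using z ck(1) bd bd[of 0] by (auto simp: nderiv_0_norm)
qed

lemma G_sup:
  assumes "open B" "a \<in> G_set B k" "i \<le> k" "x \<in> B"
  shows "tens_norm i (nderiv B a i x) \<le> sup_deriv B a i" "0 \<le> sup_deriv B a i"
proof -
  have bd: "bdd_above ((\<lambda>x. tens_norm i (nderiv B a i x)) ` B)"
    using assms(2,3) by (cases "i = 0") (auto simp: G_set_def nderiv_0_norm)
  show 1: "tens_norm i (nderiv B a i x) \<le> sup_deriv B a i"
    unfolding sup_deriv_def using assms(4) bd by (rule cSUP_upper)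
  have "nderiv B a i x \<in> tens_set i" using nderiv_mlin[OF _ assms(3,4)] assms(2) by (auto simp: G_set_def)
  from mlin_norm_nonneg[OF this nspace_type nspace_type] show "0 \<le> sup_deriv B a i" using 1 by linarith
qed

lemma Cb_field_G_norm:
  assumes "open B" "a \<in> G_set B k"
  shows "Cb_field B k 0 (rank0 a) (G_norm B k a)"
proof (rule Cb_field_of_Ck_on[OF assms(1)])
  show "Ck_on k type_nspace type_nspace B a" using assms by (simp add: G_set_def)
  fix i x assume i: "i \<le> k" and x: "x \<in> B"
  have "tens_norm i (nderiv B a i x) \<le> sup_deriv B a i" using G_sup(1)[OF assms i x] .
  also have "\<dots> \<le> (\<Sum>i\<le>k. sup_deriv B a i)"
    by (rule member_le_sum) (use i G_sup(2)[OF assms _ x] in auto)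
  finally show "tens_norm i (nderiv B a i x) \<le> G_norm B k a" by (simp add: G_norm_eq)
qed

lemma G_eval_le:
  assumes "open B" "a \<in> G_set B k" "x \<in> B"
  shows "\<bar>a x\<bar> \<le> G_norm B k a"
  using Cb_field_rank0_bound[OF Cb_field_G_norm[OF assms(1,2)] assms(3)] .

lemma G_norm_le:
  assumes "open B" "B \<noteq> {}" "Cb_field B k 0 (rank0 a) C" "0 \<le> C"
  shows "G_norm B k a \<le> (real k + 1) * C"
proof -
  have "sup_deriv B a i \<le> C" if "i \<le> k" for i
    unfolding sup_deriv_def
    by (rule cSUP_least[OF assms(2)]) (rule tbound_tens_norm[OF Ck_on_of_Cb_field(2)[OF assms(1,3) that] assms(4)])
  then have "(\<Sum>i\<le>k. sup_deriv B a i) \<le> (\<Sum>i\<le>k. C)" by (intro sum_mono) auto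
  then show ?thesis by (simp add: G_norm_eq add.commute)
qed

lemma one_B_in_G: "open B \<Longrightarrow> one_B B \<in> G_set B k"
proof -
  assume B: "open B"
  have "Cb_field B k 0 (rank0 (one_B B)) 1 \<longleftrightarrow> Cb_field B k 0 (rank0 (\<lambda>x. 1)) 1"
    by (rule Cb_field_cong) (auto simp: rank0_def one_B_def)
  then show ?thesis using Cb_field_const[of 1 1 B k] by (auto simp: G_set_iff[OF B] one_B_def)
qed

lemma G_add:
  assumes B: "open B" and a: "a \<in> G_set B k" and b: "b \<in> G_set B k"
  shows "a + b \<in> G_set B k"
  using Cb_field_rank0_add[OF Cb_field_G_norm[OF B a] Cb_field_G_norm[OF B b]] a b by (auto simp: G_set_iff[OF B] plus_fun_def)

lemma G_norm_nonneg:
  assumes "open B" "B \<noteq> {}" "a \<in> G_set B k"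
  shows "0 \<le> G_norm B k a"
  using assms G_eval_le[OF assms(1,3)] by (meson abs_ge_zero all_not_in_conv order_trans)

lemma G_mult:
  assumes B: "open B" "B \<noteq> {}" and a: "a \<in> G_set B k" and b: "b \<in> G_set B k"
  shows "a * b \<in> G_set B k" "G_norm B k (a * b) \<le> (real k + 1) * 2 ^ k * G_norm B k a * G_norm B k b"
proof -
  note nn = G_norm_nonneg[OF B a] G_norm_nonneg[OF B b]
  have 1: "Cb_field B k 0 (rank0 (a * b)) (2 ^ k * (G_norm B k a * G_norm B k b))"
    using Cb_field_mult[OF Cb_field_G_norm[OF B(1) a] Cb_field_G_norm[OF B(1) b] nn] by (simp add: times_fun_def)
  then show "a * b \<in> G_set B k" using a b by (auto simp: G_set_iff[OF B(1)])
  show "G_norm B k (a * b) \<le> (real k + 1) * 2 ^ k * G_norm B k a * G_norm B k b"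
    using G_norm_le[OF B 1] mult_nonneg_nonneg[OF _ mult_nonneg_nonneg[OF nn], of "2 ^ k"] by (simp only: mult.assoc) simp
qed

lemma G_scale:
  assumes B: "open B" "B \<noteq> {}" and a: "a \<in> G_set B k"
  shows "c *\<^sub>R a \<in> G_set B k"
proof -
  have "Cb_field B k 0 (rank0 (\<lambda>x. c * a x)) (2 ^ k * (\<bar>c\<bar> * G_norm B k a))"
    using Cb_field_mult[OF Cb_field_const Cb_field_G_norm[OF B(1) a]] G_norm_nonneg[OF B a] by simp
  then show ?thesis using a by (auto simp: G_set_iff[OF B(1)] scaleR_fun_def)
qed

lemma nderiv_add:
  assumes B: "open B" and a: "Ck_on k type_nspace type_nspace B a" and b: "Ck_on k type_nspace type_nspace B b"
    and "i \<le> k" "x \<in> B"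
  shows "nderiv B (a + b) i x = nderiv B a i x + nderiv B b i x"
  using assms(4,5)
proof (induction i arbitrary: x)
  case (Suc i)
  show ?case
  proof (rule nderiv_Suc_eq[OF B _ _ Suc.prems(2), where j = i])
    show "nderiv B (a + b) i x = nderiv B a i x + nderiv B b i x" if "x \<in> B" for x
      by (rule Suc.IH[OF _ that]) (use Suc.prems in simp)
    show "has_tderiv B i (\<lambda>x. nderiv B a i x + nderiv B b i x) (\<lambda>x. nderiv B a (Suc i) x + nderiv B b (Suc i) x)"
      unfolding has_tderiv_def
    proof (intro ballI conjI)
      fix x assume x: "x \<in> B"
      note ta = nderiv_tder[OF B a, of i] and tb = nderiv_tder[OF B b, of i]
      show "nderiv B a (Suc i) x + nderiv B b (Suc i) x \<in> tens_set (Suc i)"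
        using nspace_closed(2)[OF nspace_tens[of "Suc i"] ] nderiv_mlin[OF a Suc.prems(1) x] nderiv_mlin[OF b Suc.prems(1) x] 
        unfolding mlin_simps by blast
      have "has_fderiv type_nspace (tens i) B (\<lambda>x. nderiv B a i x + nderiv B b i x) x
          (\<lambda>h. (\<lambda>hs. nderiv B a (Suc i) x (h # hs)) + (\<lambda>hs. nderiv B b (Suc i) x (h # hs)))"
        by (rule has_fderiv_add[OF _ _ nspace_type nspace_tens])
          (use ta tb x Suc.prems in \<open>auto simp: has_tderiv_def\<close>)
      then show "has_fderiv type_nspace (tens i) B (\<lambda>x. nderiv B a i x + nderiv B b i x) x
         (\<lambda>h hs. (nderiv B a (Suc i) x + nderiv B b (Suc i) x) (h # hs))"
        by (simp add: func_plus)
    qed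
  qed
qed (auto simp: nderiv_0 rank0_def fun_eq_iff)

lemma nderiv_scale:
  assumes B: "open B" and a: "Ck_on k type_nspace type_nspace B a"
    and "i \<le> k" "x \<in> B"
  shows "nderiv B (c *\<^sub>R a) i x = c *\<^sub>R nderiv B a i x"
  using assms(3,4)
proof (induction i arbitrary: x)
  case (Suc i)
  show ?case
  proof (rule nderiv_Suc_eq[OF B _ _ Suc.prems(2), where j = i])
    show "nderiv B (c *\<^sub>R a) i x = c *\<^sub>R nderiv B a i x" if "x \<in> B" for x
      by (rule Suc.IH[OF _ that]) (use Suc.prems in simp)
    show "has_tderiv B i (\<lambda>x. c *\<^sub>R nderiv B a i x) (\<lambda>x. c *\<^sub>R nderiv B a (Suc i) x)"
      unfolding has_tderiv_def
    proof (intro ballI conjI)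
      fix x assume x: "x \<in> B"
      note ta = nderiv_tder[OF B a, of i]
      show "c *\<^sub>R nderiv B a (Suc i) x \<in> tens_set (Suc i)"
        using nspace_closed(4)[OF nspace_tens[of "Suc i"] ] nderiv_mlin[OF a Suc.prems(1) x]
        unfolding mlin_simps by blast
      have "has_fderiv type_nspace (tens i) B (\<lambda>x. c *\<^sub>R nderiv B a i x) x
          (\<lambda>h. c *\<^sub>R (\<lambda>hs. nderiv B a (Suc i) x (h # hs)))"
        by (rule has_fderiv_scaleR[OF _ nspace_type nspace_tens])
          (use ta x Suc.prems in \<open>auto simp: has_tderiv_def\<close>)
      then show "has_fderiv type_nspace (tens i) B (\<lambda>x. c *\<^sub>R nderiv B a i x) x
         (\<lambda>h hs. (c *\<^sub>R nderiv B a (Suc i) x) (h # hs))"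
        by (simp add: scaleR_fun_def)
    qed
  qed
qed (auto simp: nderiv_0 rank0_def fun_eq_iff scaleR_fun_def)

lemma normed_nspace_G:
  assumes B: "open B" "B \<noteq> {}"
  shows "normed_nspace (G B k)"
proof (rule normed_nspaceI, unfold G_simps)
  have "0 \<in> G_set B k" using Cb_field_zero[of 0 B k 0] 
    by (auto simp: G_set_iff[OF B(1)] rank0_def zero_fun_def)
  then show "subspace (G_set B k)"
    using G_add[OF B(1)] G_scale[OF B] by (auto simp: subspace_def)
  show "a = 0" if "a \<in> G_set B k" "G_norm B k a = 0" for a
  proof
    fix x show "a x = 0 x" using G_eval_le[OF B(1) that(1), of x] that G_set_iff[OF B(1)] by (cases "x \<in> B") auto
  qed
  fix a assume a: "a \<in> G_set B k"
  have Ca: "Ck_on k type_nspace type_nspace B a" using a by (simp add: G_set_def)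
  show "G_norm B k (a + b) \<le> G_norm B k a + G_norm B k b" if b: "b \<in> G_set B k" for b
    unfolding G_norm_eq sum.distrib[symmetric]
  proof (rule sum_mono)
    have Cb: "Ck_on k type_nspace type_nspace B b" using b by (simp add: G_set_def)
    fix i assume "i \<in> {..k}"
    then have i: "i \<le> k" by simp
    show "sup_deriv B (a + b) i \<le> sup_deriv B a i + sup_deriv B b i"
      unfolding sup_deriv_def[of B "a + b"]
    proof (rule cSUP_least[OF B(2)])
      fix x assume x: "x \<in> B"
      have "tens_norm i (nderiv B a i x + nderiv B b i x) \<le>
        tens_norm i (nderiv B a i x) + tens_norm i (nderiv B b i x)"
        using nspace_norm(1)[OF nspace_tens] nderiv_mlin[OF Ca i x] nderiv_mlin[OF Cb i x] unfolding mlin_simps by blast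
      then show "tens_norm i (nderiv B (a + b) i x) \<le> sup_deriv B a i + sup_deriv B b i"
        using G_sup(1)[OF B(1) a i x] G_sup(1)[OF B(1) b i x] by (simp add: nderiv_add[OF B(1) Ca Cb i x])
    qed
  qed
  show "G_norm B k (c *\<^sub>R a) \<le> \<bar>c\<bar> * G_norm B k a" for c
    unfolding G_norm_eq sum_distrib_left
  proof (rule sum_mono)
    fix i assume "i \<in> {..k}"
    then have i: "i \<le> k" by simp
    show "sup_deriv B (c *\<^sub>R a) i \<le> \<bar>c\<bar> * sup_deriv B a i"
      unfolding sup_deriv_def[of B "c *\<^sub>R a"]
    proof (rule cSUP_least[OF B(2)])
      fix x assume x: "x \<in> B"
      have "tens_norm i (c *\<^sub>R nderiv B a i x) = \<bar>c\<bar> * tens_norm i (nderiv B a i x)"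
        using nspace_norm(2)[OF nspace_tens] nderiv_mlin[OF Ca i x] unfolding mlin_simps by blast
      then show "tens_norm i (nderiv B (c *\<^sub>R a) i x) \<le> \<bar>c\<bar> * sup_deriv B a i"
        using mult_left_mono[OF G_sup(1)[OF B(1) a i x], of "\<bar>c\<bar>"] by (simp add: nderiv_scale[OF B(1) Ca i x])
    qed
  qed
qed

lemma bdd_bilin_G:
  assumes B: "open B" "B \<noteq> {}"
  shows "bdd_bilin (G B k) (G B k) (G B k) (\<lambda>z. fst z * snd z)"
  unfolding bdd_bilin_def G_simps fst_conv snd_conv
proof (intro conjI ballI allI)
  show "\<exists>C\<ge>0. \<forall>x\<in>G_set B k. \<forall>y\<in>G_set B k. G_norm B k (x * y) \<le> C * G_norm B k x * G_norm B k y"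
    by (rule exI[of _ "(real k + 1) * 2 ^ k"]) (use G_mult(2)[OF B, of _ k] in simp)
qed (use G_mult(1)[OF B] in \<open>auto simp: fun_eq_iff scaleR_fun_def algebra_simps\<close>)

lemma exp_B_in_G:
  assumes B: "open B" "B \<noteq> {}" and a: "a \<in> G_set B k"
  shows "exp_B B a \<in> G_set B k"
proof -
  obtain D where D: "Cb_field B k 0 (rank0 (\<lambda>x. exp (a x))) D"
    using Cb_field_exp[OF B(1) G_norm_nonneg[OF B a], of k] Cb_field_G_norm[OF B(1) a] by blast
  have "Cb_field B k 0 (rank0 (exp_B B a)) D \<longleftrightarrow> Cb_field B k 0 (rank0 (\<lambda>x. exp (a x))) D"
    by (rule Cb_field_cong) (auto simp: rank0_def exp_B_def)
  then show ?thesis using D by (auto simp: G_set_iff[OF B(1)] exp_B_def)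
qed

text \<open>Since \<open>exp (a + h) - exp a - exp a * h = exp a * (exp h - 1 - h)\<close>, the quadratic bound for the last
  factor and the boundedness of the product suffice.\<close>

lemma has_fderiv_exp_B:
  assumes B: "open B" "B \<noteq> {}" and a: "a \<in> G_set B k"
  shows "has_fderiv (G B k) (G B k) (G_set B k) (exp_B B) a (\<lambda>h. exp_B B a * h)"
proof -
  note nspace_GB = normed_nspace_G[OF B, of k]
  note cG = nspace_closed[OF nspace_GB, unfolded G_simps]
  note ea = exp_B_in_G[OF B a]
  obtain A where A: "A \<ge> 0" "\<And>f C. 0 \<le> C \<Longrightarrow> C \<le> 1 \<Longrightarrow> Cb_field B k 0 (rank0 f) C \<Longrightarrow> Cb_field B k 0 (rank0 (\<lambda>x. exp (f x) - 1 - f x)) (A * C\<^sup>2)"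
    using Cb_field_exp_remainder[OF B(1), of k] by blast
  define M where "M = (real k + 1) * 2 ^ k * G_norm B k (exp_B B a)"
  have M: "0 \<le> M" using G_norm_nonneg[OF B ea] by (simp add: M_def)
  have lin: "bdd_lin (G B k) (G B k) (\<lambda>h. exp_B B a * h)"
    by (rule bdd_linI[where C = M])
      (use G_mult[OF B ea] in \<open>auto simp: M_def fun_eq_iff scaleR_fun_def algebra_simps\<close>)
  define K where "K = M * ((real k + 1) * A)"
  have K: "0 \<le> K" using M A by (simp add: K_def)
  have rem: "G_norm B k (exp_B B y - exp_B B a - exp_B B a * (y - a)) \<le> K * (G_norm B k (y - a))\<^sup>2"
    if y: "y \<in> G_set B k" and s: "G_norm B k (y - a) \<le> 1" for y
  proof -
    define h where "h = y - a"
    have h: "h \<in> G_set B k" using cG(3)[OF y a] by (simp add: h_def)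
    define r where "r = (\<lambda>x. if x \<in> B then exp (h x) - 1 - h x else 0)"
    have "Cb_field B k 0 (rank0 r) (A * (G_norm B k h)\<^sup>2) \<longleftrightarrow> Cb_field B k 0 (rank0 (\<lambda>x. exp (h x) - 1 - h x)) (A * (G_norm B k h)\<^sup>2)"
      by (rule Cb_field_cong) (auto simp: rank0_def r_def)
    then have CBr: "Cb_field B k 0 (rank0 r) (A * (G_norm B k h)\<^sup>2)"
      using A(2)[OF G_norm_nonneg[OF B h] _ Cb_field_G_norm[OF B(1) h]] s by (simp add: h_def)
    then have r: "r \<in> G_set B k" by (auto simp: G_set_iff[OF B(1)] r_def)
    have nr: "G_norm B k r \<le> (real k + 1) * (A * (G_norm B k h)\<^sup>2)" using G_norm_le[OF B CBr] A by simp
    have eq: "exp_B B y - exp_B B a - exp_B B a * (y - a) = exp_B B a * r"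
      by (auto simp: fun_eq_iff exp_B_def r_def h_def exp_diff algebra_simps)
    have "G_norm B k (exp_B B a * r) \<le> M * G_norm B k r" using G_mult(2)[OF B ea r] by (simp add: M_def)
    also have "\<dots> \<le> K * (G_norm B k h)\<^sup>2" using mult_left_mono[OF nr M] by (simp add: K_def mult.assoc)
    finally show ?thesis using eq by (simp add: h_def)
  qed
  have "\<exists>d>0. \<forall>y\<in>G_set B k. G_norm B k (y - a) < d \<longrightarrow>
     G_norm B k (exp_B B y - exp_B B a - exp_B B a * (y - a)) \<le> e * G_norm B k (y - a)" if e: "e > 0" for e
  proof (intro exI[of _ "min 1 (e / (K + 1))"] conjI ballI impI)
    show "0 < min 1 (e / (K + 1))" using e K by simp
    fix y assume y: "y \<in> G_set B k" and s: "G_norm B k (y - a) < min 1 (e / (K + 1))"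
    have n: "0 \<le> G_norm B k (y - a)" using G_norm_nonneg[OF B cG(3)[OF y a]] .
    have "K * G_norm B k (y - a) \<le> (K + 1) * G_norm B k (y - a)" using n by (simp add: algebra_simps)
    also have "\<dots> \<le> e" using s K by (simp add: field_simps)
    finally have "K * (G_norm B k (y - a))\<^sup>2 \<le> e * G_norm B k (y - a)"
      using mult_right_mono[OF _ n, of "K * G_norm B k (y - a)" e] by (simp add: power2_eq_square mult.assoc)
    then show "G_norm B k (exp_B B y - exp_B B a - exp_B B a * (y - a)) \<le> e * G_norm B k (y - a)"
      using rem[OF y] s by simp
  qed
  then show ?thesis unfolding has_fderiv_def using a exp_B_in_G[OF B] lin by simp
qed

section \<open>Finite measures and their densities\<close>

locale measure_manifold =
  fixes B :: "'a::banach set" and \<mu> :: "'a measure" and k :: nat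
  assumes open_B: "open B"
    and prob: "prob_space \<mu>"
    and sets_mu: "sets \<mu> = sets (restrict_space borel B)"
    and full_support: "\<And>A. open A \<Longrightarrow> A \<noteq> {} \<Longrightarrow> A \<subseteq> B \<Longrightarrow> measure \<mu> A > 0"
begin

sublocale prob_space \<mu> by (rule prob)

abbreviation "GS \<equiv> G_set B k"
abbreviation "GB \<equiv> G B k"
abbreviation "GN \<equiv> G_norm B k"
abbreviation "G0B \<equiv> G0 B \<mu> k"
abbreviation "oneB \<equiv> one_B B"
abbreviation "expB \<equiv> exp_B B"
abbreviation "E \<equiv> E\<^sub>\<mu> \<mu>"
abbreviation "meas \<equiv> meas_of B \<mu>"

lemma space_mu: "space \<mu> = B"
  using sets_eq_imp_space_eq[OF sets_mu] by (simp add: space_restrict_space)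

lemma B_ne: "B \<noteq> {}"
  using not_empty space_mu by simp

lemmas oB = open_B B_ne

lemma nspace_GB: "normed_nspace GB"
  by (rule normed_nspace_G[OF oB])

lemmas cG = nspace_closed[OF nspace_GB, unfolded G_simps]

lemma oneB_G [simp]: "oneB \<in> GS" by (rule one_B_in_G[OF open_B])
lemma expB_G: "a \<in> GS \<Longrightarrow> expB a \<in> GS" by (rule exp_B_in_G[OF oB])
lemma mult_G: "a \<in> GS \<Longrightarrow> b \<in> GS \<Longrightarrow> a * b \<in> GS" by (rule G_mult(1)[OF oB])

lemma G_outside: "a \<in> GS \<Longrightarrow> x \<notin> B \<Longrightarrow> a x = 0"
  by (simp add: G_set_def)

lemma G_cont: "a \<in> GS \<Longrightarrow> continuous_on B a"
  using Cb_field_tbound[OF Cb_field_G_norm[OF open_B]] tbound_rank0 by blast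

lemma G_meas: "a \<in> GS \<Longrightarrow> a \<in> borel_measurable \<mu>"
  using borel_measurable_continuous_on_restrict[OF G_cont] measurable_cong_sets[OF sets_mu refl] by blast

lemma G_int: "a \<in> GS \<Longrightarrow> integrable \<mu> a"
  by (rule integrable_const_bound[where B = "GN a"])
    (auto intro!: AE_I2 G_meas G_eval_le[OF open_B] simp: space_mu real_norm_def)

lemma G_eqI: "a \<in> GS \<Longrightarrow> b \<in> GS \<Longrightarrow> (\<And>x. x \<in> B \<Longrightarrow> a x = b x) \<Longrightarrow> a = b"
  using G_outside by (metis ext)

lemma E_add: "a \<in> GS \<Longrightarrow> b \<in> GS \<Longrightarrow> E (a + b) = E a + E b"
  using Bochner_Integration.integral_add[OF G_int G_int] by (simp add: E\<^sub>\<mu>_def plus_fun_def)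

lemma E_scale: "a \<in> GS \<Longrightarrow> E (c *\<^sub>R a) = c * E a"
  by (simp add: E\<^sub>\<mu>_def scaleR_fun_def)

lemma E_one [simp]: "E oneB = 1"
proof -
  have "E oneB = (\<integral>x. 1 \<partial>\<mu>)" unfolding E\<^sub>\<mu>_def
    by (rule Bochner_Integration.integral_cong) (auto simp: one_B_def space_mu)
  then show ?thesis by (simp add: prob_space)
qed

lemma E_le: assumes a: "a \<in> GS" shows "\<bar>E a\<bar> \<le> GN a"
proof -
  have "\<bar>E a\<bar> \<le> (\<integral>x. \<bar>a x\<bar> \<partial>\<mu>)" unfolding E\<^sub>\<mu>_def by (rule integral_abs_bound)
  also have "\<dots> \<le> (\<integral>x. GN a \<partial>\<mu>)"
    by (rule integral_mono[OF integrable_abs[OF G_int[OF a]] integrable_const])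
      (use G_eval_le[OF open_B a] space_mu in simp)
  finally have "\<bar>E a\<bar> \<le> (\<integral>x. GN a \<partial>\<mu>)" .
  then show ?thesis by (simp add: prob_space real_norm_def)
qed

lemma bdd_lin_E: "bdd_lin GB type_nspace E"
  by (rule bdd_linI[where C = 1]) (use E_add E_scale E_le in \<open>auto simp: real_norm_def\<close>)

lemma E_diff: "a \<in> GS \<Longrightarrow> b \<in> GS \<Longrightarrow> E (a - b) = E a - E b"
  using bdd_lin_simps(5)[OF bdd_lin_E nspace_GB] by simp

lemma E_pos: assumes a: "a \<in> GS" shows "0 < E (expB a)"
proof -
  have "(\<integral>x. exp (- GN a) \<partial>\<mu>) \<le> E (expB a)" unfolding E\<^sub>\<mu>_def
  proof (rule integral_mono)
    show "integrable \<mu> (expB a)" using G_int[OF expB_G[OF a]] .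
    fix x assume "x \<in> space \<mu>"
    then show "exp (- GN a) \<le> expB a x" using G_eval_le[OF open_B a, of x] space_mu by (simp add: exp_B_def abs_le_iff)
  qed simp
  then have "exp (- GN a) \<le> E (expB a)" by (simp add: prob_space)
  then show ?thesis using exp_gt_zero[of "- GN a"] by linarith
qed

text \<open>The set where two continuous functions differ is open; if it has measure 0, it is empty.\<close>

lemma AE_G_eq:
  assumes a: "a \<in> GS" and b: "b \<in> GS" and ae: "AE x in \<mu>. a x = b x"
  shows "a = b"
proof (rule G_eqI[OF a b])
  define S where "S = B \<inter> (\<lambda>x. a x - b x) -` (- {0})"
  have "continuous_on B (\<lambda>x. a x - b x)" by (intro continuous_on_diff G_cont a b)
  then have op: "open S" unfolding S_def
    by (rule continuous_open_preimage[OF _ open_B]) auto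
  have SB: "S \<subseteq> B" by (auto simp: S_def)
  have "S = B \<inter> S" using SB by blast
  then have "S \<in> sets \<mu>" unfolding sets_mu sets_restrict_space using op by (auto simp: image_iff intro!: bexI[of _ S])
  moreover have "{x \<in> space \<mu>. \<not> a x = b x} = S" by (auto simp: S_def space_mu)
  ultimately have "emeasure \<mu> S = 0" using AE_iff_measurable[of S \<mu> "\<lambda>x. a x = b x"] ae by simp
  then have "measure \<mu> S = 0" by (simp add: measure_def)
  then have "S = {}" using full_support[OF op _ SB] less_irrefl by metis
  then show "a x = b x" if "x \<in> B" for x using that by (auto simp: S_def)
qed

lemma sets_meas [simp]: "sets (meas a) = sets \<mu>" and space_meas [simp]: "space (meas a) = B"
  by (simp_all add: meas_of_def space_mu)

lemma meas_integral:
  assumes a: "a \<in> GS" and u: "u \<in> borel_measurable \<mu>"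
  shows "integral\<^sup>L (meas a) u = (\<integral>x. expB a x * u x \<partial>\<mu>)"
  unfolding meas_of_def
  by (subst integral_density[OF u G_meas[OF expB_G[OF a]]]) (auto simp: exp_B_def)

lemma meas_measure:
  assumes a: "a \<in> GS" shows "emeasure (meas a) B = ennreal (E (expB a))"
proof -
  have "emeasure (meas a) B = (\<integral>\<^sup>+ x. ennreal (expB a x) * indicator B x \<partial>\<mu>)"
    unfolding meas_of_def using G_meas[OF expB_G[OF a]] sets.top[of \<mu>] space_mu
    by (subst emeasure_density) auto
  also have "\<dots> = (\<integral>\<^sup>+ x. ennreal (expB a x) \<partial>\<mu>)"
    by (rule nn_integral_cong) (simp add: space_mu)
  also have "\<dots> = ennreal (E (expB a))" unfolding E\<^sub>\<mu>_def
    by (rule nn_integral_eq_integral[OF G_int[OF expB_G[OF a]]]) (simp add: exp_B_def)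
  finally show ?thesis .
qed

lemma meas_inj:
  assumes a: "a \<in> GS" and b: "b \<in> GS" and eq: "meas a = meas b"
  shows "a = b"
proof -
  have "AE x in \<mu>. ennreal (expB a x) = ennreal (expB b x)"
    by (rule density_unique[where f = "\<lambda>x. ennreal (expB a x)" and f' = "\<lambda>x. ennreal (expB b x)"])
      (use G_meas[OF expB_G[OF a]] G_meas[OF expB_G[OF b]] eq in \<open>auto simp: meas_of_def\<close>)
  then have "AE x in \<mu>. a x = b x"
    by eventually_elim (auto simp: exp_B_def G_outside[OF a] G_outside[OF b] split: if_splits)
  then show ?thesis using AE_G_eq[OF a b] by blast
qed

lemma meas_M: assumes a: "a \<in> GS" shows "meas a \<in> M B \<mu> k"
proof -
  have m: "(\<lambda>x. ennreal (expB a x)) \<in> borel_measurable \<mu>" using G_meas[OF expB_G[OF a]] by simp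
  have "finite_measure (meas a)"
    by (rule finite_measureI) (use meas_measure[OF a] space_meas in simp)
  moreover have "absolutely_continuous \<mu> (meas a)"
    unfolding meas_of_def by (rule absolutely_continuousI_density[OF m])
  moreover have "absolutely_continuous (meas a) \<mu>"
    unfolding absolutely_continuous_def
  proof
    fix A assume "A \<in> null_sets (meas a)"
    then have A: "A \<in> sets \<mu>" and "AE x\<in>A in \<mu>. ennreal (expB a x) = 0"
      using null_sets_density_iff[OF m] by (auto simp: meas_of_def)
    from this(2) have "AE x in \<mu>. x \<notin> A"
      using AE_space by eventually_elim (auto simp: exp_B_def space_mu)
    then show "A \<in> null_sets \<mu>" using AE_iff_null_sets[OF A] by blast
  qed
  ultimately show ?thesis using a unfolding M_def by auto
qed

lemma M_eq: "M B \<mu> k = meas ` GS"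
  using meas_M by (auto simp: M_def)

lemma phi1_meas [simp]: "a \<in> GS \<Longrightarrow> phi1 B \<mu> k (meas a) = a"
  unfolding phi1_def by (rule the_equality) (auto dest: meas_inj)

lemma inv_phi1 [simp]: assumes "a \<in> GS" shows "inv_into (M B \<mu> k) (phi1 B \<mu> k) a = meas a"
proof -
  have "inj_on (phi1 B \<mu> k) (M B \<mu> k)" by (auto simp: M_eq inj_on_def)
  from inv_into_f_eq[OF this meas_M[OF assms]] show ?thesis using assms by simp
qed

lemma signed_meas_meas:
  assumes a: "a \<in> GS" and u: "u \<in> GS" and A: "A \<in> sets \<mu>"
  shows "signed_meas (meas a) u A = set_lebesgue_integral \<mu> A (expB a * u)"
proof -
  have "signed_meas (meas a) u A = (\<integral>x. indicator A x * u x \<partial>(meas a))"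
    using A by (simp add: signed_meas_def set_lebesgue_integral_def)
  also have "\<dots> = (\<integral>x. expB a x * (indicator A x * u x) \<partial>\<mu>)"
    by (rule meas_integral[OF a]) (use G_meas[OF u] A in simp)
  finally show ?thesis by (simp add: set_lebesgue_integral_def mult_ac)
qed

lemma signed_total:
  assumes a: "a \<in> GS" and u: "u \<in> GS"
  shows "signed_meas (meas a) u B = E (expB a * u)"
proof -
  have "signed_meas (meas a) u B = set_lebesgue_integral \<mu> B (expB a * u)"
    by (rule signed_meas_meas[OF a u]) (use sets.top[of \<mu>] space_mu in simp)
  also have "\<dots> = E (expB a * u)"
    unfolding set_lebesgue_integral_def E\<^sub>\<mu>_def by (rule Bochner_Integration.integral_cong) (auto simp: space_mu)
  finally show ?thesis .
qed

text \<open>The density of a tangent vector is unique: the strictly positive density of the base point can be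
  cancelled.\<close>

lemma signed_inj:
  assumes a: "a \<in> GS" and u: "u \<in> GS" and v: "v \<in> GS" and eq: "signed_meas (meas a) u = signed_meas (meas a) v"
  shows "u = v"
proof -
  have "AE x in \<mu>. (expB a * u) x = (expB a * v) x"
  proof (rule density_unique_real)
    show "integrable \<mu> (expB a * u)" "integrable \<mu> (expB a * v)"
      by (intro G_int mult_G expB_G a u v)+
    fix A assume A: "A \<in> sets \<mu>"
    show "(LINT x:A|\<mu>. (expB a * u) x) = (LINT x:A|\<mu>. (expB a * v) x)"
      using trans[OF sym[OF signed_meas_meas[OF a u A]] trans[OF fun_cong[OF eq] signed_meas_meas[OF a v A]]] .
  qed
  then have "AE x in \<mu>. u x = v x"
    by eventually_elim (auto simp: exp_B_def G_outside[OF u] G_outside[OF v] split: if_splits)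
  then show ?thesis using AE_G_eq[OF u v] by blast
qed

lemma tdens_signed [simp]: "a \<in> GS \<Longrightarrow> u \<in> GS \<Longrightarrow> tdens B k (meas a) (signed_meas (meas a) u) = u"
  unfolding tdens_def by (rule the_equality) (auto dest: signed_inj)

lemma signed_diff:
  assumes a: "a \<in> GS" and u: "u \<in> GS" and v: "v \<in> GS"
  shows "signed_meas (meas a) (u - v) = signed_meas (meas a) u - signed_meas (meas a) v"
proof
  fix A
  show "signed_meas (meas a) (u - v) A = (signed_meas (meas a) u - signed_meas (meas a) v) A"
  proof (cases "A \<in> sets \<mu>")
    case True
    have i: "set_integrable \<mu> A (expB a * w)" if "w \<in> GS" for w
      unfolding set_integrable_def using integrable_mult_indicator[OF True G_int[OF mult_G[OF expB_G[OF a] that]]] by simp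
    have e: "expB a * (u - v) = (\<lambda>x. (expB a * u) x - (expB a * v) x)" by (auto simp: fun_eq_iff algebra_simps)
    have "signed_meas (meas a) (u - v) A = set_lebesgue_integral \<mu> A (expB a * (u - v))"
      by (rule signed_meas_meas[OF a cG(3)[OF u v] True])
    also have "\<dots> = set_lebesgue_integral \<mu> A (expB a * u) - set_lebesgue_integral \<mu> A (expB a * v)"
      unfolding e by (rule set_integral_diff(2)[OF i[OF u] i[OF v]])
    finally show ?thesis using signed_meas_meas[OF a u True] signed_meas_meas[OF a v True] by simp
  qed (simp add: signed_meas_def)
qed

section \<open>Normalisation and the exponential chart\<close>

definition "log_dens a = a - ln (E (expB a)) *\<^sub>R oneB"
definition "dens a = expB (log_dens a)"
definition "centred y = y - E y *\<^sub>R oneB"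
definition "dlog a h = h - E (dens a * h) *\<^sub>R oneB"
abbreviation "G0S \<equiv> fst G0B"
definition "pmeas a = meas (log_dens a)"

lemma G0_simps: "G0S = {a \<in> GS. E a = 0}" "snd G0B = GN"
  by (simp_all add: G0_def)

lemma G0_sub: "a \<in> G0S \<Longrightarrow> a \<in> GS" by (simp add: G0_simps)

lemma log_dens_G: "a \<in> GS \<Longrightarrow> log_dens a \<in> GS" by (simp add: log_dens_def cG)
lemma dens_G: "a \<in> GS \<Longrightarrow> dens a \<in> GS" by (simp add: dens_def expB_G log_dens_G)
lemma dlog_G: "a \<in> GS \<Longrightarrow> h \<in> GS \<Longrightarrow> dlog a h \<in> GS" by (simp add: dlog_def cG)
lemma centred_G: "y \<in> GS \<Longrightarrow> centred y \<in> GS" by (simp add: centred_def cG)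

lemma centred_G0: "y \<in> GS \<Longrightarrow> centred y \<in> G0S"
  by (simp add: G0_simps centred_G) (simp add: centred_def E_diff cG E_scale)

lemma centred_id: "y \<in> G0S \<Longrightarrow> centred y = y"
  by (simp add: centred_def G0_simps)

lemma times_one_scale: "a \<in> GS \<Longrightarrow> a * (c *\<^sub>R oneB) = c *\<^sub>R a"
  using G_outside by (auto simp: fun_eq_iff one_B_def scaleR_fun_def)

lemma expB_shift: "expB (a - c *\<^sub>R oneB) = exp (- c) *\<^sub>R expB a"
  by (auto simp: fun_eq_iff exp_B_def one_B_def scaleR_fun_def exp_diff exp_minus field_simps)

lemma E_dens: assumes a: "a \<in> GS" shows "E (dens a) = 1"
  using E_pos[OF a] E_scale[OF expB_G[OF a]] by (simp add: dens_def log_dens_def expB_shift exp_minus)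

lemma pmeas_N: assumes a: "a \<in> GS" shows "pmeas a \<in> N B \<mu> k"
proof -
  have "measure (pmeas a) B = 1" using meas_measure[OF log_dens_G[OF a]] E_dens[OF a]
    by (simp add: pmeas_def dens_def measure_def)
  then show ?thesis using meas_M[OF log_dens_G[OF a]] by (simp add: N_def pmeas_def)
qed

lemma centred_log_dens: "a \<in> GS \<Longrightarrow> centred (log_dens a) = centred a"
  by (simp add: centred_def log_dens_def E_diff cG E_scale algebra_simps)

lemma phi_e_meas: "a \<in> GS \<Longrightarrow> phi_e B \<mu> k (meas a) = centred a"
  by (simp add: phi_e_def centred_def)

lemma log_dens_centred: 
  assumes b: "b \<in> GS" and 1: "E (expB b) = 1" shows "log_dens (centred b) = b"
proof -
  have "E (expB (centred b)) = exp (- E b)" using 1 E_scale[OF expB_G[OF b]] by (simp add: centred_def expB_shift)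
  then show ?thesis by (simp add: log_dens_def) (simp add: centred_def)
qed

lemma N_cases:
  assumes "P \<in> N B \<mu> k"
  obtains a where "a \<in> G0S" "P = pmeas a"
proof -
  obtain b where b: "b \<in> GS" "P = meas b" using assms by (auto simp: N_def M_eq)
  have "E (expB b) = 1" using assms b meas_measure[OF b(1)] E_pos[OF b(1)] by (simp add: N_def measure_def)
  from that[OF centred_G0[OF b(1)]] log_dens_centred[OF b(1) this] b(2) show ?thesis by (simp add: pmeas_def)
qed

lemma phi_e_pmeas: "a \<in> G0S \<Longrightarrow> phi_e B \<mu> k (pmeas a) = a"
  by (simp add: pmeas_def phi_e_meas log_dens_G G0_sub centred_log_dens centred_id)

lemma inv_phi_e: assumes "a \<in> G0S" shows "inv_into (N B \<mu> k) (phi_e B \<mu> k) a = pmeas a"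
proof -
  have "inj_on (phi_e B \<mu> k) (N B \<mu> k)"
    by (rule inj_onI) (metis N_cases phi_e_pmeas)
  from inv_into_f_eq[OF this pmeas_N[OF G0_sub[OF assms]]] show ?thesis using phi_e_pmeas[OF assms] by simp
qed

end

section \<open>Smooth vector fields and differentiability of the density\<close>

text \<open>The evaluation \<open>(m, h) \<mapsto> m h\<close> of linear maps is bilinear and bounded, so the tangent map is
  differentiable once \<open>Df\<close> is differentiable in the operator norm.\<close>

lemma twice_fdiff_of_Ck_on:
  assumes f: "Ck_on 2 E F (fst E) f" and E: "normed_nspace E" and F: "normed_nspace F"
  shows "\<exists>T. twice_fdiff E F (fst E) f T"
proof -
  let ?n = "nth_fderiv E F (fst E) f"
  note nm = nspace_mlin[OF E F]
  have expB: "\<exists>L. has_fderiv E (mlin i E F) (fst E) (?n i) a L" if "i < 2" "a \<in> fst E" for i a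
    using f that unfolding Ck_on_def by blast
  define T where "T z = ?n 1 (fst z) [snd z]" for z
  have lin: "has_fderiv E F (fst E) f a (\<lambda>h. T (a, h))" if a: "a \<in> fst E" for a
  proof -
    obtain L where L: "has_fderiv E (mlin 0 E F) (fst E) (?n 0) a L" using expB[of 0 a] a by auto
    have 1: "has_fderiv E F (fst E) f a (\<lambda>h. L h [])"
      using has_fderiv_linear_comp[OF L bdd_lin_from_mlin0[OF E F] E nm F order_refl] by (simp add: nth_fderiv.simps)
    have "L h [] = T (a, h)" if "h \<in> fst E" for h
      using fderiv_eq[OF L E nm nopen_carrier that] that by (simp add: T_def nth_fderiv.simps)
    then show ?thesis using has_fderiv_cong[OF refl _ E order_refl, of "\<lambda>h. L h []" "\<lambda>h. T (a, h)" F f a] 1 by simp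
  qed
  have "\<exists>K. has_fderiv (nprod E E) F (fst E \<times> fst E) T z K" if z0: "z \<in> fst E \<times> fst E" for z
  proof -
    obtain a h where z: "z = (a, h)" "a \<in> fst E" "h \<in> fst E" using z0 by auto
    obtain L where L: "has_fderiv E (mlin 1 E F) (fst E) (?n 1) a L" using expB[of 1 a] z by auto
    define b :: "('a list \<Rightarrow> 'b) \<times> 'a \<Rightarrow> 'b" where "b w = fst w [snd w]" for w
    have ar: "[h] \<in> args E 1" if "h \<in> fst E" for h using that by (simp add: args_def)
    have bdd_bilin_GB: "bdd_bilin (mlin 1 E F) E F b"
      unfolding bdd_bilin_def b_def fst_conv snd_conv mlin_simps
    proof (intro conjI ballI allI)
      show "\<exists>C\<ge>0. \<forall>m\<in>mlin_set 1 E F. \<forall>h\<in>fst E. snd F (m [h]) \<le> C * mlin_norm 1 E F m * snd E h"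
        using mlin_bound[OF _ E F ar] by (intro exI[of _ 1]) auto
      fix m assume m: "m \<in> mlin_set 1 E F"
      show "m [h] \<in> fst F" if "h \<in> fst E" for h using mlin_setD(2)[OF m ar[OF that]] .
      show "m [h + h'] = m [h] + m [h']" if "h \<in> fst E" "h' \<in> fst E" for h h'
        using mlin_setD(3)[OF m ar[OF that(1)], of 0 h h'] that by simp
      show "m [c *\<^sub>R h] = c *\<^sub>R m [h]" if "h \<in> fst E" for c h
        using mlin_setD(4)[OF m ar[OF that], of 0 h c] that by simp
    qed (auto simp: scaleR_fun_def)
    note EE = nspace_nprod[OF E E]
    have zE: "z \<in> fst (nprod E E)" using z0 by simp
    have "has_fderiv (nprod E E) (mlin 1 E F) (fst E \<times> fst E) (\<lambda>w. ?n 1 (fst w)) z (\<lambda>w. L (fst w))"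
      by (rule has_fderiv_comp[OF has_fderiv_bdd_lin[OF bdd_lin_fst[OF E] EE E zE, unfolded nprod_simps] _ _ EE E nm])
        (use L z in auto)
    from has_fderiv_bilin_comp[OF this _ bdd_bilin_GB EE nm E F] has_fderiv_bdd_lin[OF bdd_lin_snd[OF E] EE E zE]
    have "\<exists>K. has_fderiv (nprod E E) F (fst E \<times> fst E) (\<lambda>w. b (?n 1 (fst w), snd w)) z K" by auto
    then show ?thesis by (simp add: b_def T_def[abs_def])
  qed
  then show ?thesis using lin unfolding twice_fdiff_def by blast
qed

context measure_manifold
begin

lemma nspace_G0B: "normed_nspace G0B"
proof -
  have "subspace G0S"
    using cG by (auto simp: subspace_def G0_simps E_add E_scale)
      (use E_scale[OF oneB_G, of 0] in simp)
  then show ?thesis using nspace_GB unfolding normed_nspace_def G0_simps(2) by (auto simp: G0_sub)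
qed

lemmas cG0 = nspace_closed[OF nspace_G0B]

lemma bdd_lin_oneB: "bdd_lin type_nspace GB (\<lambda>c. c *\<^sub>R oneB)"
  by (rule bdd_linI[where C = "GN oneB"])
    (use nspace_norm(2)[OF nspace_GB] in \<open>auto simp: cG scaleR_add_left real_norm_def\<close>)

lemma bdd_lin_incl: "bdd_lin G0B GB (\<lambda>x. x)"
  by (rule bdd_linI[where C = 1]) (auto simp: G0_simps)

lemma bdd_lin_centred: "bdd_lin GB G0B centred"
proof (rule bdd_linI[where C = "1 + GN oneB"])
  fix y assume "y \<in> fst GB"
  then have y: "y \<in> GS" by simp
  show "centred y \<in> G0S" using centred_G0[OF y] .
  show "centred (c *\<^sub>R y) = c *\<^sub>R centred y" for c by (simp add: centred_def E_scale[OF y] scaleR_diff_right)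
  show "centred (y + z) = centred y + centred z" if "z \<in> fst GB" for z
    using that by (simp add: centred_def E_add[OF y] scaleR_add_left)
  have "GN (centred y) \<le> GN y + GN (E y *\<^sub>R oneB)"
    unfolding centred_def using nspace_norm_diff[OF nspace_GB] y cG by simp
  also have "GN (E y *\<^sub>R oneB) = \<bar>E y\<bar> * GN oneB" using nspace_norm(2)[OF nspace_GB] by simp
  also have "\<dots> \<le> GN y * GN oneB"
    by (rule mult_right_mono[OF E_le[OF y]]) (use nspace_norm_nonneg[OF nspace_GB] in simp)
  finally show "snd G0B (centred y) \<le> (1 + GN oneB) * snd GB y" by (simp add: G0_simps algebra_simps)
qed

lemmas nspace_R = nspace_type[where 'v = real]
lemmas bdd_bilin_GB = bdd_bilin_G[OF oB, of k]

lemma twice_fdiff_expB: "twice_fdiff GB GB GS expB (\<lambda>z. expB (fst z) * snd z)"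
  unfolding twice_fdiff_def
proof (intro conjI ballI)
  fix a assume "a \<in> GS"
  then show "has_fderiv GB GB GS expB a (\<lambda>h. expB (fst (a, h)) * snd (a, h))" using has_fderiv_exp_B[OF oB] by simp
next
  fix z assume z: "z \<in> GS \<times> fst GB"
  note GG = nspace_nprod[OF nspace_GB nspace_GB]
  have zG: "z \<in> fst (nprod GB GB)" using z by simp
  have 1: "has_fderiv (nprod GB GB) GB (GS \<times> fst GB) (\<lambda>w. expB (fst w)) z (\<lambda>w. expB (fst z) * fst w)"
    using has_fderiv_comp[OF has_fderiv_bdd_lin[OF bdd_lin_fst[OF nspace_GB] GG nspace_GB zG], of GB GS expB "\<lambda>h. expB (fst z) * h"]
      has_fderiv_exp_B[OF oB, of "fst z"] z GG nspace_GB by auto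
  have 2: "has_fderiv (nprod GB GB) GB (GS \<times> fst GB) snd z snd"
    using has_fderiv_bdd_lin[OF bdd_lin_snd[OF nspace_GB] GG nspace_GB zG] by simp
  show "\<exists>L. has_fderiv (nprod GB GB) GB (GS \<times> fst GB) (\<lambda>z. expB (fst z) * snd z) z L"
    using has_fderiv_bilin_comp[OF 1 2 bdd_bilin_GB GG nspace_GB nspace_GB nspace_GB] by auto
qed

lemma twice_fdiff_ln: "twice_fdiff type_nspace type_nspace {0<..} (ln :: real \<Rightarrow> real) (\<lambda>z. inverse (fst z) * snd z)"
  unfolding twice_fdiff_def
proof (intro conjI ballI)
  fix a :: real assume a: "a \<in> {0<..}"
  have "(ln has_derivative (*) (inverse a)) (at a)"
    using DERIV_ln[of a] a by (simp add: has_field_derivative_def)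
  then show "has_fderiv type_nspace type_nspace {0<..} ln a (\<lambda>h. inverse (fst (a, h)) * snd (a, h))"
    using has_fderiv_type[of "{0<..}" a ln] a by simp
next
  fix z :: "real \<times> real" assume z: "z \<in> {0<..} \<times> fst type_nspace"
  let ?R = "type_nspace :: real nspace"
  note RR = nspace_nprod[OF nspace_R nspace_R]
  have zR: "z \<in> fst (nprod ?R ?R)" by simp
  have sub: "{0<..} \<times> fst type_nspace \<subseteq> fst (nprod ?R ?R)" by simp
  have 2: "has_fderiv (nprod ?R ?R) ?R ({0<..} \<times> fst type_nspace) snd z snd"
    by (rule has_fderiv_restrict[OF has_fderiv_bdd_lin[OF bdd_lin_snd[OF nspace_R] RR nspace_R zR]]) (use z in auto)
  have f: "has_fderiv (nprod ?R ?R) ?R ({0<..} \<times> fst type_nspace) fst z fst"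
    by (rule has_fderiv_restrict[OF has_fderiv_bdd_lin[OF bdd_lin_fst[OF nspace_R] RR nspace_R zR]]) (use z in auto)
  have "(inverse has_derivative (\<lambda>h. - (inverse (fst z) * h * inverse (fst z)))) (at (fst z))"
    using z by (intro has_derivative_inverse') auto
  then have i: "has_fderiv ?R ?R {0<..} inverse (fst z) (\<lambda>h. - (inverse (fst z) * h * inverse (fst z)))"
    using has_fderiv_type[of "{0<..}" "fst z" inverse] z by auto
  have 1: "has_fderiv (nprod ?R ?R) ?R ({0<..} \<times> fst type_nspace) (\<lambda>w. inverse (fst w)) z
     (\<lambda>w. - (inverse (fst z) * fst w * inverse (fst z)))"
    by (rule has_fderiv_comp[OF f i _ RR nspace_R nspace_R sub]) auto
  have b: "bdd_bilin ?R ?R ?R (\<lambda>z. fst z * snd z)"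
    unfolding bdd_bilin_def by (auto simp: algebra_simps abs_mult real_norm_def intro!: exI[of _ 1])
  show "\<exists>L. has_fderiv (nprod ?R ?R) ?R ({0<..} \<times> fst type_nspace) (\<lambda>z. inverse (fst z) * snd z) z L"
    using has_fderiv_bilin_comp[OF 1 2 b RR nspace_R nspace_R nspace_R sub] by auto
qed

lemma twice_fdiff_log_dens: "twice_fdiff GB GB GS log_dens (\<lambda>z. dlog (fst z) (snd z))"
proof -
  have 1: "twice_fdiff GB type_nspace GS (\<lambda>a. E (expB a)) (\<lambda>z. E (expB (fst z) * snd z))"
    by (rule twice_fdiff_linear_comp[OF twice_fdiff_expB bdd_lin_E nspace_GB nspace_GB nspace_R]) simp
  have 2: "twice_fdiff GB type_nspace GS (\<lambda>a. ln (E (expB a))) (\<lambda>z. inverse (E (expB (fst z))) * E (expB (fst z) * snd z))"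
    using twice_fdiff_comp[OF 1 twice_fdiff_ln _ nspace_GB nspace_R nspace_R] E_pos by simp
  have 3: "twice_fdiff GB GB GS (\<lambda>a. ln (E (expB a)) *\<^sub>R oneB) (\<lambda>z. (inverse (E (expB (fst z))) * E (expB (fst z) * snd z)) *\<^sub>R oneB)"
    by (rule twice_fdiff_linear_comp[OF 2 bdd_lin_oneB nspace_GB nspace_R nspace_GB]) simp
  have id: "bdd_lin GB GB (\<lambda>x. x)" by (rule bdd_linI[where C = 1]) auto
  have 4: "twice_fdiff GB GB GS (\<lambda>a. a) (\<lambda>z. snd z)"
    using twice_fdiff_bdd_lin[OF id nspace_GB nspace_GB] by simp
  have eq: "(inverse (E (expB a)) * E (expB a * h)) = E (dens a * h)" if "a \<in> GS" "h \<in> GS" for a h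
  proof -
    have "dens a = inverse (E (expB a)) *\<^sub>R expB a"
      using E_pos[OF that(1)] by (simp add: dens_def log_dens_def expB_shift exp_minus)
    then have "dens a * h = inverse (E (expB a)) *\<^sub>R (expB a * h)"
      by (simp add: fun_eq_iff scaleR_fun_def)
    then show ?thesis using E_scale[OF mult_G[OF expB_G[OF that(1)] that(2)]] by simp
  qed
  have T: "has_fderiv (nprod GB GB) GB (GS \<times> fst GB) T' z L"
    if "has_fderiv (nprod GB GB) GB (GS \<times> fst GB) T z L" "\<And>w. w \<in> GS \<times> GS \<Longrightarrow> T w = T' w" for T T' z L
    using has_fderiv_cong[of "GS \<times> fst GB" T T' "nprod GB GB" L L GB z] that nspace_nprod[OF nspace_GB nspace_GB] by simp
  note D = twice_fdiff_diff[OF 4 3 nspace_GB nspace_GB eq_refl[OF G_simps(1)[symmetric]]]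
  show ?thesis unfolding twice_fdiff_def
  proof (intro conjI ballI)
    fix a assume a: "a \<in> GS"
    have "has_fderiv GB GB GS log_dens a (\<lambda>h. h - (inverse (E (expB a)) * E (expB a * h)) *\<^sub>R oneB)"
      using twice_fdiff_deriv[OF D a] unfolding log_dens_def[abs_def] by simp
    then show "has_fderiv GB GB GS log_dens a (\<lambda>h. dlog (fst (a, h)) (snd (a, h)))"
      using has_fderiv_cong[OF refl _ nspace_GB, of "\<lambda>h. h - (inverse (E (expB a)) * E (expB a * h)) *\<^sub>R oneB"
          "\<lambda>h. dlog a h" GS GB log_dens a] eq[OF a] by (simp add: dlog_def)
  next
    fix z assume "z \<in> GS \<times> fst GB"
    then obtain L where L: "has_fderiv (nprod GB GB) GB (GS \<times> fst GB)
      (\<lambda>z. snd z - (inverse (E (expB (fst z))) * E (expB (fst z) * snd z)) *\<^sub>R oneB) z L"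
      using D unfolding twice_fdiff_def by fastforce
    then show "\<exists>L. has_fderiv (nprod GB GB) GB (GS \<times> fst GB) (\<lambda>z. dlog (fst z) (snd z)) z L"
      using T[OF L, of "\<lambda>z. dlog (fst z) (snd z)"] eq by (auto simp: dlog_def)
  qed
qed

lemma twice_fdiff_incl: "twice_fdiff G0B GB G0S (\<lambda>x. x) snd"
  using twice_fdiff_bdd_lin[OF bdd_lin_incl nspace_G0B nspace_GB] by simp

lemma twice_fdiff_log_dens0: "twice_fdiff G0B GB G0S log_dens (\<lambda>z. dlog (fst z) (snd z))"
  using twice_fdiff_comp[OF twice_fdiff_incl twice_fdiff_log_dens _ nspace_G0B nspace_GB nspace_GB order_refl] G0_sub by simp

lemma twice_fdiff_dens0: "twice_fdiff G0B GB G0S dens (\<lambda>z. dens (fst z) * dlog (fst z) (snd z))"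
  using twice_fdiff_comp[OF twice_fdiff_log_dens0 twice_fdiff_expB _ nspace_G0B nspace_GB nspace_GB order_refl] log_dens_G[OF G0_sub] by (simp add: dens_def[abs_def])

definition "ddens a h = dens a * dlog a h"

lemma deriv_log_dens: "a \<in> G0S \<Longrightarrow> has_fderiv G0B GB G0S log_dens a (dlog a)"
  using twice_fdiff_deriv[OF twice_fdiff_log_dens0] by simp

lemma deriv_dens: "a \<in> G0S \<Longrightarrow> has_fderiv G0B GB G0S dens a (ddens a)"
  using twice_fdiff_deriv[OF twice_fdiff_dens0] by (simp add: ddens_def[abs_def])

text \<open>For a vector field that is only differentiable once, as the covariant derivative of another
  field is here.\<close>

lemma dlog_differentiable:
  assumes v: "has_fderiv G0B GB G0S v a K"
  shows "\<exists>L. has_fderiv G0B GB G0S (\<lambda>c. dlog c (v c)) a L"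
proof -
  have a: "a \<in> G0S" using has_fderiv_into(1)[OF v] .
  have 1: "has_fderiv G0B GB G0S (\<lambda>c. dens c * v c) a (\<lambda>h. ddens a h * v a + dens a * K h)"
    using has_fderiv_bilin_comp[OF deriv_dens[OF a] v bdd_bilin_GB nspace_G0B nspace_GB nspace_GB nspace_GB order_refl] by simp
  have l1: "bdd_lin GB GB (\<lambda>y. - (E y *\<^sub>R oneB))"
    using bdd_lin_comp[OF bdd_lin_comp[OF bdd_lin_E bdd_lin_oneB nspace_GB nspace_R] bdd_lin_scaleR[OF nspace_GB, of "-1"] nspace_GB nspace_GB] by simp
  from has_fderiv_add[OF v has_fderiv_linear_comp[OF 1 l1 nspace_G0B nspace_GB nspace_GB order_refl] nspace_G0B nspace_GB order_refl]
  show ?thesis by (auto simp: dlog_def)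
qed

lemma twice_fdiff_ddens:
  assumes w: "twice_fdiff G0B GB G0S w T"
  shows "\<exists>S. twice_fdiff G0B GB G0S (\<lambda>c. ddens c (w c)) S"
proof -
  have b: "twice_fdiff G0B GB G0S (\<lambda>c. dens c * f c) (\<lambda>z. (dens (fst z) * dlog (fst z) (snd z)) * f (fst z) + dens (fst z) * S z)"
    if "twice_fdiff G0B GB G0S f S" for f S
    using twice_fdiff_bilin_comp[OF twice_fdiff_dens0 that bdd_bilin_GB nspace_G0B nspace_GB nspace_GB nspace_GB order_refl] by simp
  have l1: "bdd_lin GB GB (\<lambda>y. E y *\<^sub>R oneB)" by (rule bdd_lin_comp[OF bdd_lin_E bdd_lin_oneB nspace_GB nspace_R])
  from b[OF twice_fdiff_diff[OF w twice_fdiff_linear_comp[OF b[OF w] l1 nspace_G0B nspace_GB nspace_GB order_refl] nspace_G0B nspace_GB order_refl]]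
  show ?thesis unfolding ddens_def dlog_def by blast
qed

section \<open>Tangent vectors in coordinates\<close>

definition "tangent_at a h = signed_meas (pmeas a) (dlog a h)"

lemma E_ddens: "a \<in> GS \<Longrightarrow> h \<in> GS \<Longrightarrow> E (ddens a h) = 0"
proof -
  assume a: "a \<in> GS" and h: "h \<in> GS"
  have "ddens a h = dens a * h - E (dens a * h) *\<^sub>R dens a"
    using times_one_scale[OF dens_G[OF a], of "E (dens a * h)"] by (simp add: ddens_def dlog_def right_diff_distrib)
  then show ?thesis using E_dens[OF a] by (simp add: E_diff E_scale mult_G dens_G a h cG)
qed

lemma centred_dlog: "a \<in> GS \<Longrightarrow> h \<in> G0S \<Longrightarrow> centred (dlog a h) = h"
  using G0_sub[of h] by (simp add: centred_def dlog_def E_diff E_scale cG G0_simps)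

lemma dlog_centred:
  assumes a: "a \<in> GS" and u: "u \<in> GS" shows "dlog a (centred u) = u - E (dens a * u) *\<^sub>R oneB"
proof -
  have "dens a * centred u = dens a * u - E u *\<^sub>R dens a"
    using times_one_scale[OF dens_G[OF a], of "E u"] by (simp add: centred_def right_diff_distrib)
  then have "E (dens a * centred u) = E (dens a * u) - E u"
    using E_dens[OF a] by (simp add: E_diff E_scale mult_G dens_G a u cG)
  then show ?thesis by (simp add: dlog_def centred_def scaleR_diff_left)
qed

text \<open>A density \<open>u\<close> has total mass 0 iff \<open>u = dlog a (centred u)\<close>: a constant is determined by the mean with
  respect to the base point.\<close>

lemma TN_pmeas: assumes a: "a \<in> G0S" shows "TN B k (pmeas a) = tangent_at a ` G0S"
proof -
  note a' = G0_sub[OF a]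
  have tot: "signed_meas (pmeas a) u B = E (dens a * u)" if "u \<in> GS" for u
    using signed_total[OF log_dens_G[OF a'] that] by (simp add: pmeas_def dens_def)
  show ?thesis
  proof (intro set_eqI iffI)
    fix X assume "X \<in> TN B k (pmeas a)"
    then obtain u where u: "u \<in> GS" "X = signed_meas (pmeas a) u" "E (dens a * u) = 0"
      using tot by (auto simp: TN_def TM_def)
    then have "X = tangent_at a (centred u)" using dlog_centred[OF a' u(1)] by (simp add: tangent_at_def)
    then show "X \<in> tangent_at a ` G0S" using centred_G0[OF u(1)] by blast
  next
    fix X assume "X \<in> tangent_at a ` G0S"
    then obtain h where h: "h \<in> G0S" "X = tangent_at a h" by blast
    then show "X \<in> TN B k (pmeas a)"
      using tot[OF dlog_G[OF a' G0_sub[OF h(1)]]] E_ddens[OF a' G0_sub[OF h(1)]] dlog_G[OF a' G0_sub[OF h(1)]]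
      by (auto simp: TN_def TM_def tangent_at_def ddens_def)
  qed
qed

lemma dM_eqI:
  assumes b: "b \<in> GS" and u: "u \<in> GS" and f: "has_fderiv GB F GS (\<lambda>c. f (meas c)) b L" and F: "normed_nspace F"
  shows "dM B \<mu> k F f (meas b) (signed_meas (meas b) u) = L u"
proof -
  have "dM B \<mu> k F f (meas b) (signed_meas (meas b) u) = fderiv GB F GS (f \<circ> inv_into (M B \<mu> k) (phi1 B \<mu> k)) b u"
    by (simp add: dM_def b u)
  also have "fderiv GB F GS (f \<circ> inv_into (M B \<mu> k) (phi1 B \<mu> k)) b = fderiv GB F GS (\<lambda>c. f (meas c)) b"
    by (rule fderiv_cong[OF _ nspace_GB]) simp_all
  also have "\<dots> u = L u"
    by (rule fderiv_eq[OF f nspace_GB F]) (use nopen_carrier[of GB] u in simp_all)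
  finally show ?thesis .
qed

lemma dM_phi_e:
  assumes "b \<in> GS" "u \<in> GS" shows "dM B \<mu> k G0B (phi_e B \<mu> k) (meas b) (signed_meas (meas b) u) = centred u"
proof (rule dM_eqI[OF assms _ nspace_G0B])
  show "has_fderiv GB G0B GS (\<lambda>c. phi_e B \<mu> k (meas c)) b centred"
    using has_fderiv_cong[of GS "\<lambda>c. phi_e B \<mu> k (meas c)" centred GB centred centred G0B b]
      has_fderiv_bdd_lin[OF bdd_lin_centred nspace_GB nspace_G0B, of b] assms(1) nspace_GB by (simp add: phi_e_meas)
qed

lemma dN_tangent_at:
  assumes a: "a \<in> G0S" and h: "h \<in> G0S"
  shows "dN B \<mu> k F f (pmeas a) (tangent_at a h) = fderiv G0B F G0S (\<lambda>c. f (pmeas c)) a h"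
proof -
  note a' = G0_sub[OF a] and h' = G0_sub[OF h]
  have "dM B \<mu> k G0B (phi_e B \<mu> k) (pmeas a) (tangent_at a h) = h"
    using dM_phi_e[OF log_dens_G[OF a'] dlog_G[OF a' h']] centred_dlog[OF a' h] by (simp add: pmeas_def tangent_at_def)
  moreover have "fderiv G0B F G0S (f \<circ> inv_into (N B \<mu> k) (phi_e B \<mu> k)) a = fderiv G0B F G0S (\<lambda>c. f (pmeas c)) a"
    by (rule fderiv_cong[OF _ nspace_G0B]) (simp_all add: inv_phi_e)
  ultimately show ?thesis by (simp add: dN_def phi_e_pmeas[OF a])
qed

lemma dN_eqI:
  assumes h: "h \<in> G0S" and f: "has_fderiv G0B F G0S (\<lambda>c. f (pmeas c)) a L" and F: "normed_nspace F"
  shows "dN B \<mu> k F f (pmeas a) (tangent_at a h) = L h"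
  using dN_tangent_at[OF has_fderiv_into(1)[OF f] h, of F f] fderiv_eq[OF f nspace_G0B F nopen_carrier h] by simp

lemma deriv_phi_e: "a \<in> G0S \<Longrightarrow> has_fderiv G0B G0B G0S (\<lambda>c. phi_e B \<mu> k (pmeas c)) a (\<lambda>h. h)"
proof -
  assume a: "a \<in> G0S"
  have "bdd_lin G0B G0B (\<lambda>h. h)" by (rule bdd_linI[where C = 1]) auto
  from has_fderiv_bdd_lin[OF this nspace_G0B nspace_G0B a]
  show ?thesis using has_fderiv_cong[of G0S "\<lambda>c. phi_e B \<mu> k (pmeas c)" "\<lambda>c. c" G0B] phi_e_pmeas nspace_G0B by simp
qed

lemma dN_phi_e: "a \<in> G0S \<Longrightarrow> h \<in> G0S \<Longrightarrow> dN B \<mu> k G0B (phi_e B \<mu> k) (pmeas a) (tangent_at a h) = h"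
  using dN_eqI[OF _ deriv_phi_e nspace_G0B] by simp

lemma normalise_meas: assumes b: "b \<in> GS" shows "normalise B (meas b) = meas (log_dens b)"
proof (rule measure_eqI)
  show "sets (normalise B (meas b)) = sets (meas (log_dens b))" by (simp add: normalise_def)
  fix A assume "A \<in> sets (normalise B (meas b))"
  then have A: "A \<in> sets \<mu>" by (simp add: normalise_def)
  define c where "c = E (expB b)"
  have c: "c > 0" using E_pos[OF b] by (simp add: c_def)
  have m: "measure (meas b) B = c" using meas_measure[OF b] c by (simp add: measure_def c_def)
  have "emeasure (normalise B (meas b)) A = ennreal (1 / c) * (\<integral>\<^sup>+ x. ennreal (expB b x) * indicator A x \<partial>\<mu>)"
    using A G_meas[OF expB_G[OF b]] by (simp add: normalise_def m) (simp add: meas_of_def emeasure_density)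
  also have "\<dots> = (\<integral>\<^sup>+ x. ennreal (1 / c) * (ennreal (expB b x) * indicator A x) \<partial>\<mu>)"
    using A G_meas[OF expB_G[OF b]] by (intro nn_integral_cmult[symmetric]) simp
  also have "\<dots> = (\<integral>\<^sup>+ x. ennreal (expB (log_dens b) x) * indicator A x \<partial>\<mu>)"
  proof (rule nn_integral_cong)
    fix x
    have "expB (log_dens b) = (1 / c) *\<^sub>R expB b" using c by (simp add: log_dens_def expB_shift exp_minus c_def field_simps)
    then show "ennreal (1 / c) * (ennreal (expB b x) * indicator A x) = ennreal (expB (log_dens b) x) * indicator A x"
      using c by (simp add: scaleR_fun_def ennreal_mult[symmetric] mult.assoc[symmetric] exp_B_def)
  qed
  also have "\<dots> = emeasure (meas (log_dens b)) A"
    using A G_meas[OF expB_G[OF log_dens_G[OF b]]] by (simp add: meas_of_def emeasure_density)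
  finally show "emeasure (normalise B (meas b)) A = emeasure (meas (log_dens b)) A" .
qed

lemma log_dens_idem: "a \<in> G0S \<Longrightarrow> log_dens (log_dens a) = log_dens a"
  using E_dens[OF G0_sub] by (simp add: log_dens_def[of "log_dens a"] dens_def)

lemma normalise_pmeas: "a \<in> G0S \<Longrightarrow> normalise B (pmeas a) = pmeas a"
  using normalise_meas[OF log_dens_G[OF G0_sub]] log_dens_idem by (simp add: pmeas_def)

text \<open>In the chart \<open>phi_e\<close> the normalisation is the linear map \<open>centred\<close> of the log-density.\<close>

lemma T_normalise_eq:
  assumes a: "a \<in> G0S" and u: "u \<in> GS"
  shows "T_normalise B \<mu> k (pmeas a) (signed_meas (pmeas a) u) = tangent_at a (centred u)"
proof -
  note a' = G0_sub[OF a]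
  have d: "dM B \<mu> k G0B (phi_e B \<mu> k \<circ> normalise B) (pmeas a) (signed_meas (pmeas a) u) = centred u"
    unfolding pmeas_def
  proof (rule dM_eqI[OF log_dens_G[OF a'] u _ nspace_G0B])
    have "has_fderiv GB G0B GS centred (log_dens a) centred" using has_fderiv_bdd_lin[OF bdd_lin_centred nspace_GB nspace_G0B, of "log_dens a"] log_dens_G[OF a'] by simp
    then show "has_fderiv GB G0B GS (\<lambda>c. (phi_e B \<mu> k \<circ> normalise B) (meas c)) (log_dens a) centred"
      using has_fderiv_cong[of GS "\<lambda>c. (phi_e B \<mu> k \<circ> normalise B) (meas c)" centred GB centred centred G0B "log_dens a"] nspace_GB
      by (simp add: normalise_meas phi_e_meas log_dens_G centred_log_dens)
  qed
  show ?thesis unfolding T_normalise_def normalise_pmeas[OF a] d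
  proof (rule the_equality)
    show "tangent_at a (centred u) \<in> TN B k (pmeas a) \<and> dN B \<mu> k G0B (phi_e B \<mu> k) (pmeas a) (tangent_at a (centred u)) = centred u"
      using TN_pmeas[OF a] centred_G0[OF u] dN_phi_e[OF a] by simp
    fix Y assume "Y \<in> TN B k (pmeas a) \<and> dN B \<mu> k G0B (phi_e B \<mu> k) (pmeas a) Y = centred u"
    then show "Y = tangent_at a (centred u)" using TN_pmeas[OF a] dN_phi_e[OF a] by auto
  qed
qed

lemma tangent_at_diff:
  assumes a: "a \<in> G0S" and "x \<in> G0S" "y \<in> G0S"
  shows "tangent_at a x - tangent_at a y = tangent_at a (x - y)"
proof -
  note a' = G0_sub[OF a] and x = G0_sub[OF assms(2)] and y = G0_sub[OF assms(3)]
  have "dens a * (x - y) = dens a * x - dens a * y" by (simp add: right_diff_distrib)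
  then have "dlog a x - dlog a y = dlog a (x - y)"
    by (simp add: dlog_def E_diff mult_G dens_G a' x y scaleR_diff_left)
  then show ?thesis using signed_diff[OF log_dens_G[OF a'] dlog_G[OF a' x] dlog_G[OF a' y]] by (simp add: tangent_at_def pmeas_def)
qed

lemma tangent_at_zero: "a \<in> G0S \<Longrightarrow> tangent_at a 0 = 0"
  using tangent_at_diff[of a 0 0] cG0(1) by simp

end

section \<open>Covariant derivatives and curvature in coordinates\<close>

context measure_manifold
begin

definition "per_dens a z = expB (- log_dens a) * z"

lemma per_dens_props:
  assumes a: "a \<in> GS" and z: "z \<in> GS"
  shows "per_dens a z \<in> GS" "dens a * per_dens a z = z" "\<And>w. w \<in> GS \<Longrightarrow> dens a * w = z \<Longrightarrow> w = per_dens a z"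
proof -
  show d: "per_dens a z \<in> GS" by (simp add: per_dens_def mult_G expB_G log_dens_G a z cG)
  have inv: "dens a x * expB (- log_dens a) x = 1" if "x \<in> B" for x
    using that by (simp add: dens_def exp_B_def exp_minus)
  show "dens a * per_dens a z = z"
    by (rule G_eqI[OF mult_G[OF dens_G[OF a] d] z]) (use inv in \<open>simp add: per_dens_def mult.assoc[symmetric]\<close>)
  fix w assume w: "w \<in> GS" "dens a * w = z"
  show "w = per_dens a z"
  proof (rule G_eqI[OF w(1) d])
    fix x assume x: "x \<in> B"
    have "per_dens a z x = (dens a x * expB (- log_dens a) x) * w x" using w(2) by (auto simp: per_dens_def)
    then show "w x = per_dens a z x" using inv[OF x] by simp
  qed
qed

lemma ddens_centred_per_dens:
  assumes a: "a \<in> GS" and z: "z \<in> GS" and "E z = 0"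
  shows "ddens a (centred (per_dens a z)) = z"
  using dlog_centred[OF a per_dens_props(1)[OF a z]] per_dens_props(2)[OF a z] assms(3) by (simp add: ddens_def)

lemma per_dens_diff: "per_dens a (x - y) = per_dens a x - per_dens a y"
  by (simp add: per_dens_def right_diff_distrib)

lemma phi_one_meas: "a \<in> GS \<Longrightarrow> phi B \<mu> k 1 (meas a) = a"
  by (simp add: phi_def)

lemma phi_minus_one_meas: "a \<in> GS \<Longrightarrow> phi B \<mu> k (-1) (meas a) = expB a - oneB"
  by (simp add: phi_def)

lemma phi_m_meas: "a \<in> GS \<Longrightarrow> phi_m B \<mu> k (meas a) = expB a - oneB"
  by (simp add: phi_m_def)

text \<open>Coordinates of a vector field, required on \<open>N\<close> only. Covariant derivatives and Lie brackets of
  vector fields have coordinates in this sense as well.\<close>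

definition coord_field :: "('a measure \<Rightarrow> 'a set \<Rightarrow> real) \<Rightarrow> (('a \<Rightarrow> real) \<Rightarrow> 'a \<Rightarrow> real) \<Rightarrow> bool" where
  "coord_field V v \<longleftrightarrow> (\<forall>c\<in>G0S. v c \<in> G0S \<and> V (pmeas c) = tangent_at c (v c))"

lemma coord_fieldD: "coord_field V v \<Longrightarrow> c \<in> G0S \<Longrightarrow> v c \<in> G0S" "coord_field V v \<Longrightarrow> c \<in> G0S \<Longrightarrow> V (pmeas c) = tangent_at c (v c)"
  by (auto simp: coord_field_def)

lemma vf_eqI:
  assumes V: "coord_field V v" and c: "c \<in> G0S" and f: "has_fderiv G0B F G0S (\<lambda>c. f (pmeas c)) c L" and F: "normed_nspace F"
  shows "vf B \<mu> k F V f (pmeas c) = L (v c)"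
  using dN_eqI[OF coord_fieldD(1)[OF V c] f F] by (simp add: vf_def coord_fieldD(2)[OF V c])

lemma deriv_minus_oneB:
  assumes "has_fderiv E' GB U f a L" "normed_nspace E'" "U \<subseteq> fst E'"
  shows "has_fderiv E' GB U (\<lambda>c. f c - oneB) a L"
proof -
  have "- oneB \<in> fst GB" using cG by simp
  from twice_fdiff_deriv[OF twice_fdiff_const[OF this assms(2) nspace_GB]]
  have "has_fderiv E' GB (fst E') (\<lambda>c. - oneB) a (\<lambda>h. 0)" using has_fderiv_into(1)[OF assms(1)] assms(3) by auto
  from has_fderiv_restrict[OF this order_refl refl assms(3) has_fderiv_into(1)[OF assms(1)]]
  have "has_fderiv E' GB U (\<lambda>c. - oneB) a (\<lambda>h. 0)" .
  from has_fderiv_add[OF assms(1) this assms(2) nspace_GB assms(3)] show ?thesis by simp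
qed

lemma deriv_phi_one: "a \<in> G0S \<Longrightarrow> has_fderiv G0B GB G0S (\<lambda>c. phi B \<mu> k 1 (pmeas c)) a (dlog a)"
  using has_fderiv_cong[of G0S "\<lambda>c. phi B \<mu> k 1 (pmeas c)" log_dens G0B "dlog a" "dlog a" GB a] deriv_log_dens nspace_G0B
  by (simp add: pmeas_def phi_one_meas log_dens_G G0_sub)

lemma deriv_phi_minus_one: "a \<in> G0S \<Longrightarrow> has_fderiv G0B GB G0S (\<lambda>c. phi B \<mu> k (-1) (pmeas c)) a (ddens a)"
  using has_fderiv_cong[of G0S "\<lambda>c. phi B \<mu> k (-1) (pmeas c)" "\<lambda>c. dens c - oneB" G0B "ddens a" "ddens a" GB a] 
    deriv_minus_oneB[OF deriv_dens nspace_G0B order_refl] nspace_G0B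
  by (simp add: pmeas_def phi_minus_one_meas log_dens_G G0_sub dens_def)

text \<open>The map \<open>centred\<close> is linear and fixes the values of \<open>f\<close>, hence also the values of the derivative.\<close>

lemma has_fderiv_G0:
  assumes f: "has_fderiv G0B GB G0S f a L" and 0: "\<And>c. c \<in> G0S \<Longrightarrow> E (f c) = 0"
  shows "has_fderiv G0B G0B G0S f a L" "\<And>h. h \<in> G0S \<Longrightarrow> L h \<in> G0S"
proof -
  have fG: "f c \<in> GS" if "c \<in> G0S" for c using has_fderiv_into(2)[OF f that] by simp
  have 1: "has_fderiv G0B G0B G0S f a (\<lambda>h. centred (L h))"
    using has_fderiv_cong[of G0S "\<lambda>c. centred (f c)" f G0B "\<lambda>h. centred (L h)" "\<lambda>h. centred (L h)" G0B a]
      has_fderiv_linear_comp[OF f bdd_lin_centred nspace_G0B nspace_GB nspace_G0B order_refl] nspace_G0B 0 fG centred_id by (simp add: G0_simps)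
  have 2: "has_fderiv G0B GB G0S f a (\<lambda>h. centred (L h))"
    using has_fderiv_linear_comp[OF 1 bdd_lin_incl nspace_G0B nspace_G0B nspace_GB order_refl] .
  have eq: "L h = centred (L h)" if "h \<in> G0S" for h
    using has_fderiv_unique[OF f 2 nspace_G0B nspace_GB nopen_carrier that] .
  show "has_fderiv G0B G0B G0S f a L"
    using has_fderiv_cong[OF refl _ nspace_G0B order_refl, of L "\<lambda>h. centred (L h)" G0B f a] eq 1 by simp
  show "L h \<in> G0S" if "h \<in> G0S" for h
    using has_fderiv_into(3)[OF \<open>has_fderiv G0B G0B G0S f a L\<close>] bdd_lin_simps(1)[OF _ nspace_G0B that] by blast
qed

lemma vf_vf_eqI:
  assumes V: "coord_field V v" and U: "coord_field U u" and a: "a \<in> G0S"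
    and d: "\<And>c. c \<in> G0S \<Longrightarrow> has_fderiv G0B F G0S (\<lambda>c. f (pmeas c)) c (D c)" and F: "normed_nspace F"
    and L: "has_fderiv G0B F G0S (\<lambda>c. D c (v c)) a L"
  shows "vf B \<mu> k F U (vf B \<mu> k F V f) (pmeas a) = L (u a)"
proof (rule vf_eqI[OF U a _ F])
  show "has_fderiv G0B F G0S (\<lambda>c. vf B \<mu> k F V f (pmeas c)) a L"
    using has_fderiv_cong[OF _ refl nspace_G0B order_refl, of "\<lambda>c. vf B \<mu> k F V f (pmeas c)" "\<lambda>c. D c (v c)" F a L]
      vf_eqI[OF V _ d F] L by simp
qed

text \<open>The derivative \<open>Z\<close> of \<open>dlog c (v c)\<close> along \<open>u\<close> is \<open>Dv u\<close> up to a constant. The constant drops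
  out: \<open>centred\<close> maps \<open>dlog c (v c)\<close> back to \<open>v c\<close> and, being linear, maps \<open>Z\<close> to \<open>Dv u\<close>.\<close>

lemma nabla_one:
  assumes V: "coord_field V v" and U: "coord_field U u" and a: "a \<in> G0S" and K: "has_fderiv G0B G0B G0S v a K"
  shows "nabla B \<mu> k 1 U V (pmeas a) = tangent_at a (K (u a))"
proof -
  note a' = G0_sub[OF a] and ua = coord_fieldD(1)[OF U a]
  obtain L where L: "has_fderiv G0B GB G0S (\<lambda>c. dlog c (v c)) a L"
    using dlog_differentiable[OF has_fderiv_linear_comp[OF K bdd_lin_incl nspace_G0B nspace_G0B nspace_GB order_refl]] by blast
  define Z where "Z = L (u a)"
  have Z: "Z \<in> GS" using bdd_lin_simps(1)[OF has_fderiv_into(3)[OF L] nspace_G0B ua] by (simp add: Z_def)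
  have vv: "vf B \<mu> k GB U (vf B \<mu> k GB V (phi B \<mu> k 1)) (pmeas a) = Z"
    unfolding Z_def by (rule vf_vf_eqI[OF V U a deriv_phi_one nspace_GB L])
  have "has_fderiv G0B G0B G0S v a (\<lambda>h. centred (L h))"
    using has_fderiv_cong[OF _ refl nspace_G0B order_refl, of "\<lambda>c. centred (dlog c (v c))" v G0B a "\<lambda>h. centred (L h)"]
      has_fderiv_linear_comp[OF L bdd_lin_centred nspace_G0B nspace_GB nspace_G0B order_refl] centred_dlog[OF G0_sub coord_fieldD(1)[OF V]] by simp
  then have cZ: "centred Z = K (u a)" unfolding Z_def using has_fderiv_unique[OF _ K nspace_G0B nspace_G0B nopen_carrier ua] by blast
  have dM: "dM B \<mu> k GB (phi B \<mu> k 1) (pmeas a) (signed_meas (pmeas a) w) = w" if w: "w \<in> GS" for w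
    unfolding pmeas_def
  proof (rule dM_eqI[OF log_dens_G[OF a'] w _ nspace_GB])
    have "bdd_lin GB GB (\<lambda>h. h)" by (rule bdd_linI[where C = 1]) auto
    from has_fderiv_bdd_lin[OF this nspace_GB nspace_GB, of "log_dens a"] log_dens_G[OF a']
    show "has_fderiv GB GB GS (\<lambda>c. phi B \<mu> k 1 (meas c)) (log_dens a) (\<lambda>h. h)"
      using has_fderiv_cong[of GS "\<lambda>c. phi B \<mu> k 1 (meas c)" "\<lambda>c. c" GB "\<lambda>h. h" "\<lambda>h. h" GB "log_dens a"] nspace_GB
      by (simp add: phi_one_meas)
  qed
  have "(THE W. W \<in> TM B k (pmeas a) \<and> dM B \<mu> k GB (phi B \<mu> k 1) (pmeas a) W = Z) = signed_meas (pmeas a) Z"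
    by (rule the_equality) (use dM Z in \<open>auto simp: TM_def\<close>)
  then show ?thesis unfolding nabla_def vv using T_normalise_eq[OF a Z] cZ by simp
qed

text \<open>The derivative of \<open>exp - 1\<close> on \<open>M\<close> is multiplication by the density, so the vector \<open>W\<close> has the
  density \<open>Z / dens a\<close>.\<close>

lemma nabla_minus_one:
  assumes V: "coord_field V v" and U: "coord_field U u" and a: "a \<in> G0S"
    and L: "has_fderiv G0B GB G0S (\<lambda>c. ddens c (v c)) a L"
  shows "nabla B \<mu> k (-1) U V (pmeas a) = tangent_at a (centred (per_dens a (L (u a))))"
proof -
  note a' = G0_sub[OF a] and ua = coord_fieldD(1)[OF U a]
  define Z where "Z = L (u a)"
  have Z: "Z \<in> GS" using bdd_lin_simps(1)[OF has_fderiv_into(3)[OF L] nspace_G0B ua] by (simp add: Z_def)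
  have vv: "vf B \<mu> k GB U (vf B \<mu> k GB V (phi B \<mu> k (-1))) (pmeas a) = Z"
    unfolding Z_def by (rule vf_vf_eqI[OF V U a deriv_phi_minus_one nspace_GB L])
  have dM: "dM B \<mu> k GB (phi B \<mu> k (-1)) (pmeas a) (signed_meas (pmeas a) w) = dens a * w" if w: "w \<in> GS" for w
    unfolding pmeas_def
  proof (rule dM_eqI[OF log_dens_G[OF a'] w _ nspace_GB])
    have "has_fderiv GB GB GS (\<lambda>c. expB c - oneB) (log_dens a) (\<lambda>h. expB (log_dens a) * h)"
      using deriv_minus_oneB[OF has_fderiv_exp_B[OF oB log_dens_G[OF a']] nspace_GB] by simp
    then show "has_fderiv GB GB GS (\<lambda>c. phi B \<mu> k (-1) (meas c)) (log_dens a) (\<lambda>h. dens a * h)"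
      using has_fderiv_cong[of GS "\<lambda>c. phi B \<mu> k (-1) (meas c)" "\<lambda>c. expB c - oneB" GB "\<lambda>h. dens a * h" "\<lambda>h. dens a * h" GB "log_dens a"] nspace_GB
      by (simp add: phi_minus_one_meas dens_def)
  qed
  have "(THE W. W \<in> TM B k (pmeas a) \<and> dM B \<mu> k GB (phi B \<mu> k (-1)) (pmeas a) W = Z) = signed_meas (pmeas a) (per_dens a Z)"
  proof (rule the_equality)
    show "signed_meas (pmeas a) (per_dens a Z) \<in> TM B k (pmeas a) \<and>
        dM B \<mu> k GB (phi B \<mu> k (-1)) (pmeas a) (signed_meas (pmeas a) (per_dens a Z)) = Z"
      using dM[OF per_dens_props(1)[OF a' Z]] per_dens_props(1,2)[OF a' Z] by (simp add: TM_def)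
    fix W assume W: "W \<in> TM B k (pmeas a) \<and> dM B \<mu> k GB (phi B \<mu> k (-1)) (pmeas a) W = Z"
    then obtain w where w: "w \<in> GS" "W = signed_meas (pmeas a) w" by (auto simp: TM_def)
    then have "dens a * w = Z" using W dM[OF w(1)] by simp
    then show "W = signed_meas (pmeas a) (per_dens a Z)" using per_dens_props(3)[OF a' Z w(1)] w(2) by simp
  qed
  then show ?thesis unfolding nabla_def vv using T_normalise_eq[OF a per_dens_props(1)[OF a' Z]] by (simp add: Z_def)
qed

lemma lie_bracket_coords:
  assumes V: "coord_field V v" and U: "coord_field U u" and a: "a \<in> G0S"
    and K: "has_fderiv G0B G0B G0S v a K" and L: "has_fderiv G0B G0B G0S u a L"
  shows "lie_bracket B \<mu> k U V (pmeas a) = tangent_at a (K (u a) - L (v a))" "K (u a) - L (v a) \<in> G0S"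
proof -
  have 1: "vf B \<mu> k G0B U (vf B \<mu> k G0B V (phi_e B \<mu> k)) (pmeas a) = K (u a)"
    by (rule vf_vf_eqI[OF V U a deriv_phi_e nspace_G0B K])
  have 2: "vf B \<mu> k G0B V (vf B \<mu> k G0B U (phi_e B \<mu> k)) (pmeas a) = L (v a)"
    by (rule vf_vf_eqI[OF U V a deriv_phi_e nspace_G0B L])
  show x: "K (u a) - L (v a) \<in> G0S"
    using bdd_lin_simps(1)[OF has_fderiv_into(3)[OF K] nspace_G0B coord_fieldD(1)[OF U a]]
      bdd_lin_simps(1)[OF has_fderiv_into(3)[OF L] nspace_G0B coord_fieldD(1)[OF V a]] cG0 by blast
  show "lie_bracket B \<mu> k U V (pmeas a) = tangent_at a (K (u a) - L (v a))"
    unfolding lie_bracket_def 1 2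
  proof (rule the_equality)
    show "tangent_at a (K (u a) - L (v a)) \<in> TN B k (pmeas a) \<and>
      dN B \<mu> k G0B (phi_e B \<mu> k) (pmeas a) (tangent_at a (K (u a) - L (v a))) = K (u a) - L (v a)"
      using TN_pmeas[OF a] x dN_phi_e[OF a x] by simp
    show "Z = tangent_at a (K (u a) - L (v a))" if "Z \<in> TN B k (pmeas a) \<and>
      dN B \<mu> k G0B (phi_e B \<mu> k) (pmeas a) Z = K (u a) - L (v a)" for Z
      using that TN_pmeas[OF a] dN_phi_e[OF a] by auto
  qed
qed

lemma coord_field_lie_bracket:
  assumes V: "coord_field V v" and U: "coord_field U u" 
    and v: "twice_fdiff G0B G0B G0S v T" and u: "twice_fdiff G0B G0B G0S u S"
  shows "coord_field (lie_bracket B \<mu> k U V) (\<lambda>c. T (c, u c) - S (c, v c))"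
  using lie_bracket_coords[OF V U _ twice_fdiff_deriv[OF v] twice_fdiff_deriv[OF u]] by (simp add: coord_field_def)

lemma vfields_coords:
  assumes "V \<in> vfields B \<mu> k"
  obtains v T where "coord_field V v" "twice_fdiff G0B G0B G0S v T"
proof -
  define v where "v c = dN B \<mu> k G0B (phi_e B \<mu> k) (pmeas c) (V (pmeas c))" for c
  have "v c \<in> G0S \<and> V (pmeas c) = tangent_at c (v c)" if c: "c \<in> G0S" for c
  proof -
    have "V (pmeas c) \<in> TN B k (pmeas c)" using assms pmeas_N[OF G0_sub[OF c]] by (auto simp: vfields_def)
    then obtain h where "h \<in> G0S" "V (pmeas c) = tangent_at c h" using TN_pmeas[OF c] by auto
    then show ?thesis using dN_phi_e[OF c] by (simp add: v_def)
  qed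
  then have f: "coord_field V v" by (simp add: coord_field_def)
  let ?w = "\<lambda>a. dN B \<mu> k G0B (phi_e B \<mu> k) (inv_into (N B \<mu> k) (phi_e B \<mu> k) a) (V (inv_into (N B \<mu> k) (phi_e B \<mu> k) a))"
  have "Ck_on 2 G0B G0B G0S ?w" using assms unfolding vfields_def smooth_on_nspace_def by blast
  from twice_fdiff_of_Ck_on[OF this nspace_G0B nspace_G0B] obtain T where T: "twice_fdiff G0B G0B G0S ?w T" by blast
  have "twice_fdiff G0B G0B G0S v T"
    by (rule twice_fdiff_cong[OF T _ nspace_G0B order_refl]) (simp add: inv_phi_e v_def)
  then show ?thesis using that f by blast
qed

text \<open>Equality in \<open>G\<close> is pointwise, and evaluation at a point is linear and bounded.\<close>

lemma second_deriv_symmetric_G: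
  assumes f: "twice_fdiff G0B GB G0S f T" and a: "a \<in> G0S" and h: "h \<in> G0S" and k: "l \<in> G0S"
    and L: "has_fderiv (nprod G0B G0B) GB (G0S \<times> G0S) T (a, h) L"
    and K: "has_fderiv (nprod G0B G0B) GB (G0S \<times> G0S) T (a, l) K"
  shows "L (l, 0) = K (h, 0)"
proof -
  note PP = nspace_nprod[OF nspace_G0B nspace_G0B]
  have GG: "L (l, 0) \<in> GS" "K (h, 0) \<in> GS"
    using bdd_lin_simps(1)[OF has_fderiv_into(3)[OF L] PP, of "(l, 0)"]
      bdd_lin_simps(1)[OF has_fderiv_into(3)[OF K] PP, of "(h, 0)"] h k cG0(1) by auto
  show ?thesis
  proof (rule G_eqI[OF GG])
    fix x assume x: "x \<in> B"
    have ev: "bdd_lin GB type_nspace (\<lambda>f. f x)"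
      by (rule bdd_linI[where C = 1]) (use G_eval_le[OF open_B _ x] in \<open>auto simp: scaleR_fun_def real_norm_def\<close>)
    have sub: "G0S \<times> G0S \<subseteq> fst (nprod G0B G0B)" by simp
    show "L (l, 0) x = K (h, 0) x"
      by (rule second_deriv_symmetric[OF twice_fdiff_linear_comp[OF f ev nspace_G0B nspace_GB nspace_R order_refl] nspace_G0B a h k
           has_fderiv_linear_comp[OF L ev PP nspace_GB nspace_R sub] has_fderiv_linear_comp[OF K ev PP nspace_GB nspace_R sub]])
  qed
qed

text \<open>The identity \<open>D(Df \<cdot> v) u - D(Df \<cdot> u) v = Df \<cdot> (Dv u - Du v)\<close>: the second derivatives of \<open>f\<close> on the
  left cancel by symmetry.\<close>

lemma commutator:
  assumes f: "twice_fdiff G0B GB G0S f T" and a: "a \<in> G0S"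
    and u: "\<And>c. c \<in> G0S \<Longrightarrow> u c \<in> G0S" "has_fderiv G0B G0B G0S u a Ku"
    and v: "\<And>c. c \<in> G0S \<Longrightarrow> v c \<in> G0S" "has_fderiv G0B G0B G0S v a Kv"
  shows "\<exists>L K. has_fderiv G0B GB G0S (\<lambda>c. T (c, v c)) a L \<and> has_fderiv G0B GB G0S (\<lambda>c. T (c, u c)) a K \<and>
    L (u a) - K (v a) - T (a, Kv (u a) - Ku (v a)) = 0"
proof -
  obtain L where L: "has_fderiv (nprod G0B G0B) GB (G0S \<times> G0S) T (a, v a) L"
    using f a v(1)[OF a] unfolding twice_fdiff_def by blast
  obtain K where K: "has_fderiv (nprod G0B G0B) GB (G0S \<times> G0S) T (a, u a) K"
    using f a u(1)[OF a] unfolding twice_fdiff_def by blast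
  have K1: "Kv (u a) \<in> G0S" and K2: "Ku (v a) \<in> G0S"
    using bdd_lin_simps(1)[OF has_fderiv_into(3)[OF v(2)] nspace_G0B u(1)[OF a]]
      bdd_lin_simps(1)[OF has_fderiv_into(3)[OF u(2)] nspace_G0B v(1)[OF a]] by auto
  have "T (a, Kv (u a) - Ku (v a)) = T (a, Kv (u a)) - T (a, Ku (v a))"
    using bdd_lin_simps(5)[OF has_fderiv_into(3)[OF twice_fdiff_deriv[OF f a]] nspace_G0B K1 K2] .
  moreover have "L (u a, 0) = K (v a, 0)" by (rule second_deriv_symmetric_G[OF f a v(1)[OF a] u(1)[OF a] L K])
  ultimately have "(L (u a, 0) + T (a, Kv (u a))) - (K (v a, 0) + T (a, Ku (v a))) - T (a, Kv (u a) - Ku (v a)) = 0"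
    by simp
  then show ?thesis
    using twice_fdiff_field_deriv[OF f v(2) L nspace_G0B nspace_GB nopen_carrier] twice_fdiff_field_deriv[OF f u(2) K nspace_G0B nspace_GB nopen_carrier] by blast
qed

text \<open>In the coordinate \<open>phi_e\<close> all three terms are ordinary derivatives of the coordinates \<open>w\<close> of \<open>W\<close>, so
  the curvature is the commutator identity for \<open>w\<close>.\<close>

lemma flat_one: "nabla_flat B \<mu> k 1"
  unfolding nabla_flat_def
proof (intro ballI)
  fix U V W P assume U: "U \<in> vfields B \<mu> k" and V: "V \<in> vfields B \<mu> k" and W: "W \<in> vfields B \<mu> k"
    and P: "P \<in> N B \<mu> k"
  obtain u Tu where u: "coord_field U u" "twice_fdiff G0B G0B G0S u Tu" using vfields_coords[OF U] .
  obtain v Tv where v: "coord_field V v" "twice_fdiff G0B G0B G0S v Tv" using vfields_coords[OF V] .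
  obtain w Tw where w: "coord_field W w" "twice_fdiff G0B G0B G0S w Tw" using vfields_coords[OF W] .
  obtain a where a: "a \<in> G0S" "P = pmeas a" using N_cases[OF P] .
  have fT: "twice_fdiff G0B GB G0S w Tw" using twice_fdiff_linear_comp[OF w(2) bdd_lin_incl nspace_G0B nspace_G0B nspace_GB order_refl] .
  have TwG0: "Tw (c, h) \<in> G0S" if "c \<in> G0S" "h \<in> G0S" for c h
    using bdd_lin_simps(1)[OF has_fderiv_into(3)[OF twice_fdiff_deriv[OF w(2) that(1)]] nspace_G0B that(2)] .
  have fVW: "coord_field (nabla B \<mu> k 1 X W) (\<lambda>c. Tw (c, x c))" if X: "coord_field X x" for X x
    unfolding coord_field_def using nabla_one[OF w(1) X _ twice_fdiff_deriv[OF w(2)]] TwG0 coord_fieldD(1)[OF X] by simp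
  obtain L K where LK: "has_fderiv G0B GB G0S (\<lambda>c. Tw (c, v c)) a L" "has_fderiv G0B GB G0S (\<lambda>c. Tw (c, u c)) a K"
    and z: "L (u a) - K (v a) - Tw (a, Tv (a, u a) - Tu (a, v a)) = 0"
    using commutator[OF fT a(1) coord_fieldD(1)[OF u(1)] twice_fdiff_deriv[OF u(2) a(1)] coord_fieldD(1)[OF v(1)] twice_fdiff_deriv[OF v(2) a(1)]] by blast
  have EL: "\<And>c. c \<in> G0S \<Longrightarrow> E (Tw (c, x c)) = 0" if "coord_field X x" for X x
    using TwG0 coord_fieldD(1)[OF that] by (simp add: G0_simps)
  have L: "has_fderiv G0B G0B G0S (\<lambda>c. Tw (c, v c)) a L" "L (u a) \<in> G0S"
    using has_fderiv_G0[OF LK(1)] EL[OF v(1)] coord_fieldD(1)[OF u(1) a(1)] by blast+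
  have K: "has_fderiv G0B G0B G0S (\<lambda>c. Tw (c, u c)) a K" "K (v a) \<in> G0S"
    using has_fderiv_G0[OF LK(2)] EL[OF u(1)] coord_fieldD(1)[OF v(1) a(1)] by blast+
  note fl = coord_field_lie_bracket[OF v(1) u(1) v(2) u(2)]
  have 1: "nabla B \<mu> k 1 U (nabla B \<mu> k 1 V W) P = tangent_at a (L (u a))"
    unfolding a(2) by (rule nabla_one[OF fVW[OF v(1)] u(1) a(1) L(1)])
  have 2: "nabla B \<mu> k 1 V (nabla B \<mu> k 1 U W) P = tangent_at a (K (v a))"
    unfolding a(2) by (rule nabla_one[OF fVW[OF u(1)] v(1) a(1) K(1)])
  have 3: "nabla B \<mu> k 1 (lie_bracket B \<mu> k U V) W P = tangent_at a (Tw (a, Tv (a, u a) - Tu (a, v a)))"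
    unfolding a(2) by (rule nabla_one[OF w(1) fl a(1) twice_fdiff_deriv[OF w(2) a(1)]])
  have g: "L (u a) \<in> G0S" "K (v a) \<in> G0S" "Tw (a, Tv (a, u a) - Tu (a, v a)) \<in> G0S"
    using L(2) K(2) TwG0[OF a(1) coord_fieldD(1)[OF fl a(1)]] by auto
  show "nabla B \<mu> k 1 U (nabla B \<mu> k 1 V W) P - nabla B \<mu> k 1 V (nabla B \<mu> k 1 U W) P
      - nabla B \<mu> k 1 (lie_bracket B \<mu> k U V) W P = 0"
    unfolding 1 2 3 tangent_at_diff[OF a(1) g(1,2)] tangent_at_diff[OF a(1) cG0(3)[OF g(1,2)] g(3)] z
    by (rule tangent_at_zero[OF a(1)])
qed

text \<open>The commutator identity for \<open>ddens c (w c)\<close>, the \<open>phi_m\<close>-component of \<open>W\<close>; passing from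
  components with respect to \<open>phi_m\<close> to tangent vectors is linear.\<close>

lemma flat_minus_one: "nabla_flat B \<mu> k (-1)"
  unfolding nabla_flat_def
proof (intro ballI)
  fix U V W P assume U: "U \<in> vfields B \<mu> k" and V: "V \<in> vfields B \<mu> k" and W: "W \<in> vfields B \<mu> k"
    and P: "P \<in> N B \<mu> k"
  obtain u Tu where u: "coord_field U u" "twice_fdiff G0B G0B G0S u Tu" using vfields_coords[OF U] .
  obtain v Tv where v: "coord_field V v" "twice_fdiff G0B G0B G0S v Tv" using vfields_coords[OF V] .
  obtain w Tw where w: "coord_field W w" "twice_fdiff G0B G0B G0S w Tw" using vfields_coords[OF W] .
  obtain a where a: "a \<in> G0S" "P = pmeas a" using N_cases[OF P] .
  note a' = G0_sub[OF a(1)]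
  obtain S where S: "twice_fdiff G0B GB G0S (\<lambda>c. ddens c (w c)) S"
    using twice_fdiff_ddens[OF twice_fdiff_linear_comp[OF w(2) bdd_lin_incl nspace_G0B nspace_G0B nspace_GB order_refl]] by blast
  have Emm: "E (ddens c (w c)) = 0" if "c \<in> G0S" for c
    using E_ddens[OF G0_sub[OF that] G0_sub[OF coord_fieldD(1)[OF w(1) that]]] .
  have SG0: "S (c, h) \<in> G0S" if "c \<in> G0S" "h \<in> G0S" for c h
    using has_fderiv_G0(2)[OF twice_fdiff_deriv[OF S that(1)] Emm that(2)] .
  have ES: "E (S (c, x c)) = 0" if "coord_field X x" "c \<in> G0S" for X x c
    using SG0[OF that(2) coord_fieldD(1)[OF that]] by (simp add: G0_simps)
  have fX: "coord_field (nabla B \<mu> k (-1) X W) (\<lambda>c. centred (per_dens c (S (c, x c))))" if X: "coord_field X x" for X x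
    unfolding coord_field_def
    using nabla_minus_one[OF w(1) X _ twice_fdiff_deriv[OF S]] centred_G0[OF per_dens_props(1)[OF G0_sub G0_sub[OF SG0[OF _ coord_fieldD(1)[OF X]]]]] by simp
  have mX: "has_fderiv G0B GB G0S (\<lambda>c. ddens c (centred (per_dens c (S (c, x c))))) a L"
    if X: "coord_field X x" and L: "has_fderiv G0B GB G0S (\<lambda>c. S (c, x c)) a L" for X x L
    using has_fderiv_cong[of G0S "\<lambda>c. ddens c (centred (per_dens c (S (c, x c))))" "\<lambda>c. S (c, x c)" G0B L L GB a] L nspace_G0B
      ddens_centred_per_dens[OF G0_sub G0_sub[OF SG0[OF _ coord_fieldD(1)[OF X]]] ES[OF X]] by simp
  obtain L K where LK: "has_fderiv G0B GB G0S (\<lambda>c. S (c, v c)) a L" "has_fderiv G0B GB G0S (\<lambda>c. S (c, u c)) a K"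
    and z: "L (u a) - K (v a) - S (a, Tv (a, u a) - Tu (a, v a)) = 0"
    using commutator[OF S a(1) coord_fieldD(1)[OF u(1)] twice_fdiff_deriv[OF u(2) a(1)] coord_fieldD(1)[OF v(1)] twice_fdiff_deriv[OF v(2) a(1)]] by blast
  note fl = coord_field_lie_bracket[OF v(1) u(1) v(2) u(2)]
  have g: "L (u a) \<in> GS" "K (v a) \<in> GS" "S (a, Tv (a, u a) - Tu (a, v a)) \<in> GS"
    using bdd_lin_simps(1)[OF has_fderiv_into(3)[OF LK(1)] nspace_G0B coord_fieldD(1)[OF u(1) a(1)]]
      bdd_lin_simps(1)[OF has_fderiv_into(3)[OF LK(2)] nspace_G0B coord_fieldD(1)[OF v(1) a(1)]]
      G0_sub[OF SG0[OF a(1) coord_fieldD(1)[OF fl a(1)]]] by auto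
  have 1: "nabla B \<mu> k (-1) U (nabla B \<mu> k (-1) V W) P = tangent_at a (centred (per_dens a (L (u a))))"
    unfolding a(2) by (rule nabla_minus_one[OF fX[OF v(1)] u(1) a(1) mX[OF v(1) LK(1)]])
  have 2: "nabla B \<mu> k (-1) V (nabla B \<mu> k (-1) U W) P = tangent_at a (centred (per_dens a (K (v a))))"
    unfolding a(2) by (rule nabla_minus_one[OF fX[OF u(1)] v(1) a(1) mX[OF u(1) LK(2)]])
  have 3: "nabla B \<mu> k (-1) (lie_bracket B \<mu> k U V) W P = tangent_at a (centred (per_dens a (S (a, Tv (a, u a) - Tu (a, v a)))))"
    unfolding a(2) by (rule nabla_minus_one[OF w(1) fl a(1) twice_fdiff_deriv[OF S a(1)]])
  note dg = per_dens_props(1)[OF a' g(1)] per_dens_props(1)[OF a' g(2)] per_dens_props(1)[OF a' g(3)]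
  have cd: "centred x - centred y = centred (x - y)" if "x \<in> GS" "y \<in> GS" for x y
    using bdd_lin_simps(5)[OF bdd_lin_centred nspace_GB] that by simp
  note cen3 = cd[OF dg(1,2)] cd[OF cG(3)[OF dg(1,2)] dg(3)]
  have z': "centred (per_dens a (L (u a)) - per_dens a (K (v a)) - per_dens a (S (a, Tv (a, u a) - Tu (a, v a)))) = 0"
    unfolding per_dens_diff[symmetric] z using bdd_lin_simps(6)[OF bdd_lin_centred nspace_GB] by (simp add: per_dens_def)
  show "nabla B \<mu> k (-1) U (nabla B \<mu> k (-1) V W) P - nabla B \<mu> k (-1) V (nabla B \<mu> k (-1) U W) P
      - nabla B \<mu> k (-1) (lie_bracket B \<mu> k U V) W P = 0"
    unfolding 1 2 3 tangent_at_diff[OF a(1) centred_G0[OF dg(1)] centred_G0[OF dg(2)]]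
      tangent_at_diff[OF a(1) cG0(3)[OF centred_G0[OF dg(1)] centred_G0[OF dg(2)]] centred_G0[OF dg(3)]]
    unfolding cen3 z' by (rule tangent_at_zero[OF a(1)])
qed

lemma affine_one:
  assumes U: "U \<in> vfields B \<mu> k" and V: "V \<in> vfields B \<mu> k" and P: "P \<in> N B \<mu> k"
  shows "vf B \<mu> k G0B (nabla B \<mu> k 1 U V) (phi_e B \<mu> k) P = vf B \<mu> k G0B U (vf B \<mu> k G0B V (phi_e B \<mu> k)) P"
proof -
  obtain u Tu where u: "coord_field U u" "twice_fdiff G0B G0B G0S u Tu" using vfields_coords[OF U] .
  obtain v Tv where v: "coord_field V v" "twice_fdiff G0B G0B G0S v Tv" using vfields_coords[OF V] .
  obtain a where a: "a \<in> G0S" "P = pmeas a" using N_cases[OF P] .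
  note K = twice_fdiff_deriv[OF v(2) a(1)]
  have "Tv (a, u a) \<in> G0S" using bdd_lin_simps(1)[OF has_fderiv_into(3)[OF K] nspace_G0B coord_fieldD(1)[OF u(1) a(1)]] .
  then have "vf B \<mu> k G0B (nabla B \<mu> k 1 U V) (phi_e B \<mu> k) (pmeas a) = Tv (a, u a)"
    unfolding vf_def nabla_one[OF v(1) u(1) a(1) K] using dN_phi_e[OF a(1)] by simp
  then show ?thesis unfolding a(2) using vf_vf_eqI[OF v(1) u(1) a(1) deriv_phi_e nspace_G0B K] by simp
qed

lemma affine_minus_one:
  assumes U: "U \<in> vfields B \<mu> k" and V: "V \<in> vfields B \<mu> k" and P: "P \<in> N B \<mu> k"
  shows "vf B \<mu> k G0B (nabla B \<mu> k (-1) U V) (phi_m B \<mu> k) P = vf B \<mu> k G0B U (vf B \<mu> k G0B V (phi_m B \<mu> k)) P"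
proof -
  obtain u Tu where u: "coord_field U u" "twice_fdiff G0B G0B G0S u Tu" using vfields_coords[OF U] .
  obtain v Tv where v: "coord_field V v" "twice_fdiff G0B G0B G0S v Tv" using vfields_coords[OF V] .
  obtain a where a: "a \<in> G0S" "P = pmeas a" using N_cases[OF P] .
  note a' = G0_sub[OF a(1)]
  have pm: "phi_m B \<mu> k (pmeas c) = dens c - oneB" if "c \<in> G0S" for c
    using that by (simp add: pmeas_def phi_m_meas log_dens_G G0_sub dens_def)
  have d: "has_fderiv G0B G0B G0S (\<lambda>c. phi_m B \<mu> k (pmeas c)) c (ddens c)" if c: "c \<in> G0S" for c
  proof (rule has_fderiv_G0(1))
    show "has_fderiv G0B GB G0S (\<lambda>c. phi_m B \<mu> k (pmeas c)) c (ddens c)"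
      using has_fderiv_cong[of G0S "\<lambda>c. phi_m B \<mu> k (pmeas c)" "\<lambda>c. dens c - oneB" G0B "ddens c" "ddens c" GB c]
        deriv_minus_oneB[OF deriv_dens[OF c] nspace_G0B order_refl] nspace_G0B pm by simp
    show "E (phi_m B \<mu> k (pmeas c)) = 0" if "c \<in> G0S" for c
      using pm[OF that] E_dens[OF G0_sub[OF that]] by (simp add: E_diff dens_G G0_sub that)
  qed
  obtain S where S: "twice_fdiff G0B GB G0S (\<lambda>c. ddens c (v c)) S"
    using twice_fdiff_ddens[OF twice_fdiff_linear_comp[OF v(2) bdd_lin_incl nspace_G0B nspace_G0B nspace_GB order_refl]] by blast
  have Emm: "E (ddens c (v c)) = 0" if "c \<in> G0S" for c
    using E_ddens[OF G0_sub[OF that] G0_sub[OF coord_fieldD(1)[OF v(1) that]]] .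
  have SL: "has_fderiv G0B G0B G0S (\<lambda>c. ddens c (v c)) a (\<lambda>h. S (a, h))" "S (a, u a) \<in> G0S"
    using has_fderiv_G0[OF twice_fdiff_deriv[OF S a(1)]] Emm coord_fieldD(1)[OF u(1) a(1)] by blast+
  note Sa = SL(2)
  have "vf B \<mu> k G0B (nabla B \<mu> k (-1) U V) (phi_m B \<mu> k) (pmeas a) = ddens a (centred (per_dens a (S (a, u a))))"
    unfolding vf_def nabla_minus_one[OF v(1) u(1) a(1) twice_fdiff_deriv[OF S a(1)]]
    by (rule dN_eqI[OF centred_G0[OF per_dens_props(1)[OF a' G0_sub[OF Sa]]] d[OF a(1)] nspace_G0B])
  also have "\<dots> = S (a, u a)" by (rule ddens_centred_per_dens[OF a' G0_sub[OF Sa]]) (use Sa in \<open>simp add: G0_simps\<close>)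
  also have "\<dots> = vf B \<mu> k G0B U (vf B \<mu> k G0B V (phi_m B \<mu> k)) (pmeas a)"
    using vf_vf_eqI[OF v(1) u(1) a(1) d nspace_G0B SL(1)] by simp
  finally show ?thesis unfolding a(2) .
qed

end

theorem mainTheorem5:
  fixes B :: "'a::banach set" and \<mu> :: "'a measure" and k :: nat
  assumes "open B"
    and "prob_space \<mu>"
    and "sets \<mu> = sets (restrict_space borel B)"
    and "\<And>A. open A \<Longrightarrow> A \<noteq> {} \<Longrightarrow> A \<subseteq> B \<Longrightarrow> measure \<mu> A > 0"
  shows "nabla_flat B \<mu> k 1 \<and> nabla_flat B \<mu> k (-1) \<and>
    (\<forall>U\<in>vfields B \<mu> k. \<forall>V\<in>vfields B \<mu> k. \<forall>P\<in>N B \<mu> k.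
       vf B \<mu> k (G0 B \<mu> k) (nabla B \<mu> k 1 U V) (phi_e B \<mu> k) P =
         vf B \<mu> k (G0 B \<mu> k) U (vf B \<mu> k (G0 B \<mu> k) V (phi_e B \<mu> k)) P \<and>
       vf B \<mu> k (G0 B \<mu> k) (nabla B \<mu> k (-1) U V) (phi_m B \<mu> k) P =
         vf B \<mu> k (G0 B \<mu> k) U (vf B \<mu> k (G0 B \<mu> k) V (phi_m B \<mu> k)) P)"
proof -
  interpret measure_manifold B \<mu> k
    using assms by (intro measure_manifold.intro) auto
  show ?thesis using flat_one flat_minus_one affine_one affine_minus_one by blast
qed

end
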